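(* Let $p \geq 2$ and $d \geq 1$ be integers and let $\delta > 0$. Then for all sufficiently large $n$, $M_{p,d}(n) < \delta n^p$. Moreover, for each $p \geq 2$ there exists a value $D_p$ depending only on $p$ such that $M_{p,2}(n) \leq D_p n^{p-1}$ for all $n$.
   Context: For a finite set $S \subset \mathbb{R}^d$, the Vietoris–Rips complex $R(S)$ is the simplicial complex on vertex set $S$ whose faces are all subsets of $S$ of (Euclidean) diameter at most $1$. For a fixed field $\mathbf{k}$, $\tilde{\beta}_p(\Gamma)=\dim_{\mathbf{k}}\tilde{H}_p(\Gamma;\mathbf{k})$ denotes the $p$-th reduced Betti number. Define $M_{p,d}(n) := \max\{\tilde{\beta}_p(R(S)) : S \subset \mathbb{R}^d,\ |S| \leq n\}$. *)

theory Defs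
  imports "HOL-Analysis.Analysis" "HOL-Library.Function_Algebras"
begin

subsection \<open>Dimension of a quotient of spaces of functions\<close>

definition chain_scale :: "'k::field \<Rightarrow> ('b \<Rightarrow> 'k) \<Rightarrow> 'b \<Rightarrow> 'k" where
  "chain_scale a c = (\<lambda>\<sigma>. a * c \<sigma>)"

interpretation chain: vector_space "chain_scale :: 'k::field \<Rightarrow> ('b \<Rightarrow> 'k) \<Rightarrow> 'b \<Rightarrow> 'k"
  by unfold_locales (auto simp: chain_scale_def fun_eq_iff algebra_simps)

text \<open>For a subspace \<open>W\<close> of \<open>V\<close>: the classes of the elements of \<open>E\<close> are pairwise distinct and
  form a basis of the quotient space \<open>V / W\<close>.\<close>

definition quotient_basis :: "('b \<Rightarrow> 'k::field) set \<Rightarrow> ('b \<Rightarrow> 'k) set \<Rightarrow> ('b \<Rightarrow> 'k) set \<Rightarrow> bool" where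
  "quotient_basis V W E \<longleftrightarrow>
     E \<subseteq> V \<and>
     (\<forall>T u. finite T \<and> T \<subseteq> E \<and> (\<Sum>v\<in>T. chain_scale (u v) v) \<in> W \<longrightarrow> (\<forall>v\<in>T. u v = 0)) \<and>
     (\<forall>x\<in>V. \<exists>T u. finite T \<and> T \<subseteq> E \<and> x - (\<Sum>v\<in>T. chain_scale (u v) v) \<in> W)"

definition quotient_dim :: "('b \<Rightarrow> 'k::field) set \<Rightarrow> ('b \<Rightarrow> 'k) set \<Rightarrow> nat" where
  "quotient_dim V W = card (SOME E. quotient_basis V W E)"

lemma independent_Un_quotient_basis:
  fixes V W :: "('b \<Rightarrow> 'k::field) set"
  assumes W: "chain.subspace W" and A: "A \<subseteq> W" "chain.independent A" and E: "quotient_basis V W E"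
  shows "A \<inter> E = {}" and "chain.independent (A \<union> E)"
proof -
  have ind: "\<And>T u v. finite T \<Longrightarrow> T \<subseteq> E \<Longrightarrow> (\<Sum>v\<in>T. chain_scale (u v) v) \<in> W \<Longrightarrow> v \<in> T \<Longrightarrow> u v = 0"
    using E unfolding quotient_basis_def by blast
  show "A \<inter> E = {}"
  proof (rule ccontr)
    assume "A \<inter> E \<noteq> {}"
    then obtain v where "v \<in> A" "v \<in> E" by blast
    then have "(1::'k) = 0" using ind[of "{v}" "\<lambda>_. 1" v] A by auto
    then show False by simp
  qed
  show "chain.independent (A \<union> E)"
  proof
    assume "chain.dependent (A \<union> E)"
    then obtain t u v where t: "finite t" "t \<subseteq> A \<union> E" "(\<Sum>v\<in>t. chain_scale (u v) v) = 0" "v \<in> t" "u v \<noteq> 0"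
      unfolding chain.dependent_explicit by blast
    have split: "(\<Sum>v\<in>t. chain_scale (u v) v) = (\<Sum>v\<in>t \<inter> E. chain_scale (u v) v) + (\<Sum>v\<in>t - E. chain_scale (u v) v)"
      using t(1) by (rule sum.Int_Diff)
    have tA: "t - E \<subseteq> A" using t(2) by blast
    have "(\<Sum>v\<in>t - E. chain_scale (u v) v) \<in> W"
      using tA A(1) W by (intro chain.subspace_sum chain.subspace_scale) auto
    moreover have "(\<Sum>v\<in>t \<inter> E. chain_scale (u v) v) = - (\<Sum>v\<in>t - E. chain_scale (u v) v)"
      using split t(3) by (simp add: eq_neg_iff_add_eq_0)
    ultimately have "(\<Sum>v\<in>t \<inter> E. chain_scale (u v) v) \<in> W"
      using chain.subspace_neg[OF W] by simp
    then have z: "\<And>w. w \<in> t \<inter> E \<Longrightarrow> u w = 0"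
      using ind[of "t \<inter> E" u] t(1) by blast
    then have "(\<Sum>v\<in>t \<inter> E. chain_scale (u v) v) = 0" by (simp add: sum.neutral)
    then have "(\<Sum>v\<in>t - E. chain_scale (u v) v) = 0" using split t(3) by simp
    then have "\<forall>w\<in>t - E. u w = 0"
      using A(2) tA t(1) unfolding chain.dependent_explicit by (meson finite_Diff)
    with z t(4,5) show False by blast
  qed
qed

lemma quotient_basis_exists:
  fixes V W :: "('b \<Rightarrow> 'k::field) set"
  assumes V: "chain.subspace V" and W: "chain.subspace W" "W \<subseteq> V"
  obtains E where "quotient_basis V W E"
proof -
  obtain A where A: "A \<subseteq> W" "chain.independent A" "W \<subseteq> chain.span A"
    using chain.maximal_independent_subset[of W] by blast
  obtain C where C: "A \<subseteq> C" "C \<subseteq> V" "chain.independent C" "V \<subseteq> chain.span C"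
    using chain.maximal_independent_subset_extend[of A V] A W(2) by blast
  have "quotient_basis V W (C - A)"
    unfolding quotient_basis_def
  proof (intro conjI allI impI ballI)
    show "C - A \<subseteq> V" using C by blast
  next
    fix T u v
    assume T: "finite T \<and> T \<subseteq> C - A \<and> (\<Sum>v\<in>T. chain_scale (u v) v) \<in> W" and v: "v \<in> T"
    then have "(\<Sum>v\<in>T. chain_scale (u v) v) \<in> chain.span A" using A by blast
    then obtain S r where S: "finite S" "S \<subseteq> A" "(\<Sum>v\<in>T. chain_scale (u v) v) = (\<Sum>a\<in>S. chain_scale (r a) a)"
      unfolding chain.span_explicit by auto
    define g where "g x = (if x \<in> T then u x else - r x)" for x
    have d: "T \<inter> S = {}" using T S(2) by blast
    have "(\<Sum>x\<in>T \<union> S. chain_scale (g x) x) = (\<Sum>x\<in>T. chain_scale (g x) x) + (\<Sum>x\<in>S. chain_scale (g x) x)"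
      using T S(1) d by (intro sum.union_disjoint) auto
    also have "(\<Sum>x\<in>T. chain_scale (g x) x) = (\<Sum>x\<in>T. chain_scale (u x) x)"
      by (rule sum.cong) (auto simp: g_def)
    also have "(\<Sum>x\<in>S. chain_scale (g x) x) = (\<Sum>x\<in>S. - (chain_scale (r x) x))"
      using d by (intro sum.cong) (auto simp: g_def)
    also have "(\<Sum>x\<in>T. chain_scale (u x) x) + (\<Sum>x\<in>S. - (chain_scale (r x) x)) = 0"
      by (simp add: S(3) sum_negf)
    finally have "(\<Sum>x\<in>T \<union> S. chain_scale (g x) x) = 0" .
    moreover have "finite (T \<union> S)" "T \<union> S \<subseteq> C" using T S C(1) by auto
    ultimately have "\<forall>x\<in>T \<union> S. g x = 0"
      using C(3) unfolding chain.dependent_explicit by blast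
    with v have "g v = 0" by blast
    with v show "u v = 0" by (simp add: g_def)
  next
    fix x assume "x \<in> V"
    then have "x \<in> chain.span C" using C by blast
    then obtain t r where t: "finite t" "t \<subseteq> C" "x = (\<Sum>a\<in>t. chain_scale (r a) a)"
      unfolding chain.span_explicit by auto
    have "x = (\<Sum>a\<in>t \<inter> A. chain_scale (r a) a) + (\<Sum>a\<in>t - A. chain_scale (r a) a)"
      unfolding t(3) using t(1) by (rule sum.Int_Diff)
    moreover have "(\<Sum>a\<in>t \<inter> A. chain_scale (r a) a) \<in> W"
      using A(1) W(1) by (intro chain.subspace_sum chain.subspace_scale) auto
    ultimately show "\<exists>T u. finite T \<and> T \<subseteq> C - A \<and> x - (\<Sum>v\<in>T. chain_scale (u v) v) \<in> W"
      using t by (intro exI[of _ "t - A"] exI[of _ r]) auto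
  qed
  then show thesis by (rule that)
qed

lemma quotient_dim_add:
  fixes V W :: "('b \<Rightarrow> 'k::field) set"
  assumes V: "chain.subspace V" and W: "chain.subspace W" "W \<subseteq> V" and fin: "finite F" "V \<subseteq> chain.span F"
  shows "quotient_dim V W + chain.dim W = chain.dim V"
proof -
  obtain A where A: "A \<subseteq> W" "chain.independent A" "W \<subseteq> chain.span A" "card A = chain.dim W"
    using chain.basis_exists[of W] by blast
  define E where "E = (SOME E. quotient_basis V W E)"
  obtain E' where "quotient_basis V W E'" using quotient_basis_exists[OF V W] by blast
  then have E: "quotient_basis V W E" unfolding E_def by (rule someI)
  note AE = independent_Un_quotient_basis[OF W(1) A(1,2) E]
  have "E \<subseteq> V" using E by (simp add: quotient_basis_def)
  then have sub: "A \<union> E \<subseteq> V" using A(1) W(2) by blast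
  have gen: "\<forall>x\<in>V. \<exists>T u. finite T \<and> T \<subseteq> E \<and> x - (\<Sum>v\<in>T. chain_scale (u v) v) \<in> W"
    using E unfolding quotient_basis_def by (elim conjE)
  have "x \<in> chain.span (A \<union> E)" if x: "x \<in> V" for x
  proof -
    obtain T u where T: "finite T" "T \<subseteq> E" "x - (\<Sum>v\<in>T. chain_scale (u v) v) \<in> W"
      using gen x by blast
    have "x - (\<Sum>v\<in>T. chain_scale (u v) v) \<in> chain.span (A \<union> E)"
      using T(3) A(3) chain.span_mono[of A "A \<union> E"] by blast
    moreover have "(\<Sum>v\<in>T. chain_scale (u v) v) \<in> chain.span (A \<union> E)"
      using T(2) by (intro chain.span_sum chain.span_scale chain.span_base) auto
    ultimately have "(x - (\<Sum>v\<in>T. chain_scale (u v) v)) + (\<Sum>v\<in>T. chain_scale (u v) v) \<in> chain.span (A \<union> E)"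
      by (rule chain.span_add)
    then show ?thesis by (simp only: diff_add_cancel)
  qed
  then have "chain.dim V = card (A \<union> E)"
    using chain.dim_unique[of "A \<union> E" V] sub AE(2) by blast
  moreover have "finite (A \<union> E)"
    using chain.independent_span_bound[OF fin(1) AE(2)] sub fin(2) by blast
  ultimately show ?thesis
    using AE(1) A(4) by (simp add: card_Un_disjoint quotient_dim_def E_def)
qed


subsection \<open>Reduced simplicial homology over a field\<close>

text \<open>An arbitrary total order of the vertices, used to orient the simplices. Another choice
  yields an isomorphic chain complex.\<close>

definition vertex_order :: "'v rel" where
  "vertex_order = (SOME r. linear_order r)"

lemma linear_order_vertex_order: "linear_order (vertex_order :: 'v rel)"
proof -
  obtain r :: "'v rel" where "well_order r" using well_order_on by blast
  then have "linear_order r" by (simp add: well_order_on_def)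
  then show ?thesis unfolding vertex_order_def by (rule someI)
qed

text \<open>A simplicial complex is given by the set of its faces, the empty face included. The index
  \<open>q\<close> of a chain group is the number of vertices, i.e. one more than the dimension; \<open>q = 0\<close> is the
  group of the empty face, so that the complex is the augmented one.\<close>

definition chain_space :: "'v set set \<Rightarrow> nat \<Rightarrow> ('v set \<Rightarrow> 'k::field) set" where
  "chain_space \<Gamma> q = {c. \<forall>\<sigma>. c \<sigma> \<noteq> 0 \<longrightarrow> \<sigma> \<in> \<Gamma> \<and> card \<sigma> = q}"

text \<open>The boundary of the simplex with vertices \<open>v\<^sub>0 < \<dots> < v\<^sub>p\<close> is the sum over \<open>i\<close> of
  \<open>(-1)\<^sup>i\<close> times the simplex without \<open>v\<^sub>i\<close>. Hence the coefficient at \<open>\<tau>\<close> of the boundary of a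
  chain \<open>c\<close> collects \<open>c\<close> on all \<open>insert v \<tau>\<close>, where the index of \<open>v\<close> in \<open>insert v \<tau>\<close> is the number
  of vertices of \<open>\<tau>\<close> below \<open>v\<close>.\<close>

definition boundary_map :: "'v set set \<Rightarrow> ('v set \<Rightarrow> 'k::field) \<Rightarrow> 'v set \<Rightarrow> 'k" where
  "boundary_map \<Gamma> c = (\<lambda>\<tau>. \<Sum>v\<in>\<Union>\<Gamma> - \<tau>. (-1) ^ card {u \<in> \<tau>. (u, v) \<in> vertex_order} * c (insert v \<tau>))"

definition cycle_space :: "'v set set \<Rightarrow> nat \<Rightarrow> ('v set \<Rightarrow> 'k::field) set" where
  "cycle_space \<Gamma> p = {c \<in> chain_space \<Gamma> (p + 1). boundary_map \<Gamma> c = 0}"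

definition boundary_space :: "'v set set \<Rightarrow> nat \<Rightarrow> ('v set \<Rightarrow> 'k::field) set" where
  "boundary_space \<Gamma> p = boundary_map \<Gamma> ` chain_space \<Gamma> (p + 2)"

definition reduced_betti :: "'k::field itself \<Rightarrow> nat \<Rightarrow> 'v set set \<Rightarrow> nat" where
  "reduced_betti _ p \<Gamma> =
     quotient_dim (cycle_space \<Gamma> p :: ('v set \<Rightarrow> 'k) set) (boundary_space \<Gamma> p)"


subsection \<open>Vietoris--Rips complexes\<close>

definition rips :: "'a::metric_space set \<Rightarrow> 'a set set" where
  "rips S = {\<sigma>. \<sigma> \<subseteq> S \<and> diameter \<sigma> \<le> 1}"

definition max_betti :: "'k::field itself \<Rightarrow> 'd::finite itself \<Rightarrow> nat \<Rightarrow> nat \<Rightarrow> nat" where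
  "max_betti k _ p n =
     Max {reduced_betti k p (rips S) | S :: (real ^ 'd) set. finite S \<and> card S \<le> n}"


subsection \<open>Well-definedness\<close>

lemma boundary_map_boundary_map:
  fixes c :: "'v set \<Rightarrow> 'k::field"
  assumes fin: "finite (\<Union>\<Gamma>)" and c: "c \<in> chain_space \<Gamma> q"
  shows "boundary_map \<Gamma> (boundary_map \<Gamma> c) = 0"
proof
  fix \<tau> :: "'v set"
  define V where "V = \<Union>\<Gamma>"
  define s :: "'v \<Rightarrow> 'v set \<Rightarrow> 'k" where "s v t = (-1) ^ card {u \<in> t. (u, v) \<in> vertex_order}" for v t
  define f where "f v w = s v \<tau> * (s w (insert v \<tau>) * c (insert w (insert v \<tau>)))" for v w
  have bb: "boundary_map \<Gamma> (boundary_map \<Gamma> c) \<tau> = (\<Sum>v\<in>V - \<tau>. \<Sum>w\<in>V - insert v \<tau>. f v w)"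
    unfolding boundary_map_def f_def s_def V_def by (simp add: sum_distrib_left)
  have finV: "finite V" using fin by (simp add: V_def)
  have lin: "linear_order (vertex_order :: 'v rel)" by (rule linear_order_vertex_order)
  then have total: "\<And>x y :: 'v. x \<noteq> y \<Longrightarrow> (x, y) \<in> vertex_order \<or> (y, x) \<in> vertex_order"
    and anti: "\<And>x y :: 'v. (x, y) \<in> vertex_order \<Longrightarrow> (y, x) \<in> vertex_order \<Longrightarrow> x = y"
    by (auto simp: linear_order_on_def partial_order_on_def total_on_def antisym_def)
  have swap: "f w v = - f v w" if vw: "(v, w) \<in> vertex_order" "v \<noteq> w" "v \<notin> \<tau>" "w \<notin> \<tau>" for v w
  proof (cases "finite \<tau>")
    case True
    have "{u \<in> insert v \<tau>. (u, w) \<in> vertex_order} = insert v {u \<in> \<tau>. (u, w) \<in> vertex_order}"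
      using vw by auto
    then have 1: "s w (insert v \<tau>) = - s w \<tau>"
      using True vw by (simp add: s_def)
    have "{u \<in> insert w \<tau>. (u, v) \<in> vertex_order} = {u \<in> \<tau>. (u, v) \<in> vertex_order}"
      using vw anti by auto
    then have 2: "s v (insert w \<tau>) = s v \<tau>" by (simp add: s_def)
    show ?thesis by (simp add: f_def 1 2 insert_commute[of v w])
  next
    case False
    have "\<not> insert w (insert v \<tau>) \<in> \<Gamma>"
      using False fin by (meson Sup_upper finite_insert finite_subset)
    then have "c (insert w (insert v \<tau>)) = 0" using c unfolding chain_space_def by blast
    then show ?thesis by (simp add: f_def insert_commute[of v w])
  qed
  define P where "P = {(v, w). v \<in> V - \<tau> \<and> w \<in> V - \<tau> \<and> v \<noteq> w \<and> (v, w) \<in> vertex_order}"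
  have finP: "finite P"
    by (rule finite_subset[of _ "V \<times> V"]) (use finV in \<open>auto simp: P_def\<close>)
  have "(\<Sum>v\<in>V - \<tau>. \<Sum>w\<in>V - insert v \<tau>. f v w) = (\<Sum>(v, w)\<in>Sigma (V - \<tau>) (\<lambda>v. V - insert v \<tau>). f v w)"
    using finV by (intro sum.Sigma) auto
  also have "Sigma (V - \<tau>) (\<lambda>v. V - insert v \<tau>) = P \<union> prod.swap ` P"
    by (auto simp: P_def image_iff dest: total)
  also have "(\<Sum>(v, w)\<in>P \<union> prod.swap ` P. f v w) = (\<Sum>(v, w)\<in>P. f v w) + (\<Sum>(v, w)\<in>prod.swap ` P. f v w)"
    using finP anti by (intro sum.union_disjoint) (auto simp: P_def)
  also have "(\<Sum>(v, w)\<in>prod.swap ` P. f v w) = (\<Sum>(v, w)\<in>P. f w v)"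
    by (subst sum.reindex) (auto simp: o_def case_prod_beta)
  also have "\<dots> = (\<Sum>(v, w)\<in>P. - f v w)"
    by (rule sum.cong) (auto simp: P_def swap)
  also have "(\<Sum>(v, w)\<in>P. f v w) + \<dots> = 0"
    by (simp add: case_prod_beta sum_negf)
  finally show "boundary_map \<Gamma> (boundary_map \<Gamma> c) \<tau> = (0 :: 'v set \<Rightarrow> 'k) \<tau>" using bb by simp
qed

lemma boundary_map_add: "boundary_map \<Gamma> (c + d) = boundary_map \<Gamma> c + boundary_map \<Gamma> d"
  by (simp add: boundary_map_def fun_eq_iff algebra_simps sum.distrib)

lemma boundary_map_scale: "boundary_map \<Gamma> (chain_scale a c) = chain_scale a (boundary_map \<Gamma> c)"
  by (simp add: boundary_map_def chain_scale_def fun_eq_iff algebra_simps sum_distrib_left)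

lemma boundary_map_zero: "boundary_map \<Gamma> 0 = 0"
  by (simp add: boundary_map_def fun_eq_iff)

lemma subspace_chain_space: "chain.subspace (chain_space \<Gamma> q :: ('v set \<Rightarrow> 'k::field) set)"
  unfolding chain.subspace_def chain_space_def chain_scale_def
proof (intro conjI ballI allI CollectI impI)
  fix x y :: "'v set \<Rightarrow> 'k" and \<sigma>
  assume "x \<in> {c. \<forall>\<sigma>. c \<sigma> \<noteq> 0 \<longrightarrow> \<sigma> \<in> \<Gamma> \<and> card \<sigma> = q}"
    and "y \<in> {c. \<forall>\<sigma>. c \<sigma> \<noteq> 0 \<longrightarrow> \<sigma> \<in> \<Gamma> \<and> card \<sigma> = q}" and "(x + y) \<sigma> \<noteq> 0"
  moreover from this have "x \<sigma> \<noteq> 0 \<or> y \<sigma> \<noteq> 0" by auto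
  ultimately show "\<sigma> \<in> \<Gamma>" "card \<sigma> = q" by auto
qed auto

lemma subspace_cycle_space: "chain.subspace (cycle_space \<Gamma> p)"
  using subspace_chain_space[of \<Gamma> "p + 1"]
  unfolding chain.subspace_def cycle_space_def
  by (auto simp: boundary_map_add boundary_map_scale boundary_map_zero)

lemma subspace_boundary_space: "chain.subspace (boundary_space \<Gamma> p)"
  unfolding chain.subspace_def boundary_space_def
proof (intro conjI ballI allI)
  note sub = subspace_chain_space[of \<Gamma> "p + 2"]
  show "0 \<in> boundary_map \<Gamma> ` chain_space \<Gamma> (p + 2)"
    using chain.subspace_0[OF sub] boundary_map_zero[of \<Gamma>] by (metis image_eqI)
  show "x + y \<in> boundary_map \<Gamma> ` chain_space \<Gamma> (p + 2)"
    if xy: "x \<in> boundary_map \<Gamma> ` chain_space \<Gamma> (p + 2)" "y \<in> boundary_map \<Gamma> ` chain_space \<Gamma> (p + 2)" for x y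
  proof -
    obtain c d where "c \<in> chain_space \<Gamma> (p + 2)" "d \<in> chain_space \<Gamma> (p + 2)"
      and "x = boundary_map \<Gamma> c" "y = boundary_map \<Gamma> d"
      using xy by blast
    then show ?thesis
      using imageI[OF chain.subspace_add[OF sub], of c d "boundary_map \<Gamma>"] by (simp only: boundary_map_add)
  qed
  show "chain_scale a x \<in> boundary_map \<Gamma> ` chain_space \<Gamma> (p + 2)"
    if xy: "x \<in> boundary_map \<Gamma> ` chain_space \<Gamma> (p + 2)" for a x
  proof -
    obtain c where "c \<in> chain_space \<Gamma> (p + 2)" and "x = boundary_map \<Gamma> c"
      using xy by blast
    then show ?thesis
      using imageI[OF chain.subspace_scale[OF sub], of c "boundary_map \<Gamma>" a] by (simp only: boundary_map_scale)
  qed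
qed

lemma boundary_map_in_chain_space:
  assumes fin: "finite (\<Union>\<Gamma>)" and down: "\<And>\<sigma> \<tau>. \<sigma> \<in> \<Gamma> \<Longrightarrow> \<tau> \<subseteq> \<sigma> \<Longrightarrow> \<tau> \<in> \<Gamma>"
    and c: "c \<in> chain_space \<Gamma> (Suc q)"
  shows "boundary_map \<Gamma> c \<in> chain_space \<Gamma> q"
  unfolding chain_space_def
proof (intro CollectI allI impI)
  fix \<tau> assume "boundary_map \<Gamma> c \<tau> \<noteq> 0"
  then obtain v where v: "v \<in> \<Union>\<Gamma> - \<tau>" "c (insert v \<tau>) \<noteq> 0"
    unfolding boundary_map_def by (metis (no_types, lifting) mult_zero_right sum.neutral)
  then have 1: "insert v \<tau> \<in> \<Gamma>" "card (insert v \<tau>) = Suc q" using c unfolding chain_space_def by blast+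
  then have "finite \<tau>" using fin by (meson Sup_upper finite_insert finite_subset)
  with 1 v down show "\<tau> \<in> \<Gamma> \<and> card \<tau> = q" by auto
qed

lemma chain_space_subset_span:
  assumes fin: "finite \<Gamma>"
  shows "(chain_space \<Gamma> q :: ('v set \<Rightarrow> 'k::field) set)
    \<subseteq> chain.span ((\<lambda>\<sigma> \<tau>. if \<tau> = \<sigma> then 1 else 0) ` {\<sigma> \<in> \<Gamma>. card \<sigma> = q})"
proof
  fix c :: "'v set \<Rightarrow> 'k" assume c: "c \<in> chain_space \<Gamma> q"
  let ?F = "{\<sigma> \<in> \<Gamma>. card \<sigma> = q}"
  let ?e = "\<lambda>\<sigma> \<tau>. if \<tau> = \<sigma> then 1 else (0::'k)"
  have app: "(\<Sum>\<sigma>\<in>A. g \<sigma>) \<tau> = (\<Sum>\<sigma>\<in>A. g \<sigma> \<tau>)" for A and g :: "'v set \<Rightarrow> 'v set \<Rightarrow> 'k" and \<tau>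
    by (induction A rule: infinite_finite_induct) auto
  have "c = (\<Sum>\<sigma>\<in>?F. chain_scale (c \<sigma>) (?e \<sigma>))"
  proof
    fix \<tau>
    have "(\<Sum>\<sigma>\<in>?F. c \<sigma> * ?e \<sigma> \<tau>) = (\<Sum>\<sigma>\<in>?F. if \<tau> = \<sigma> then c \<sigma> else 0)"
      by (rule sum.cong) auto
    also have "\<dots> = (if \<tau> \<in> ?F then c \<tau> else 0)"
      using fin by (subst sum.delta') auto
    also have "\<dots> = c \<tau>" using c unfolding chain_space_def by auto
    finally show "c \<tau> = (\<Sum>\<sigma>\<in>?F. chain_scale (c \<sigma>) (?e \<sigma>)) \<tau>" by (simp add: app chain_scale_def)
  qed
  also have "\<dots> \<in> chain.span (?e ` ?F)"
    by (intro chain.span_sum chain.span_scale chain.span_base) auto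
  finally show "c \<in> chain.span (?e ` ?F)" .
qed

lemma
  fixes \<Gamma> :: "'v set set"
  assumes fin: "finite \<Gamma>" "finite (\<Union>\<Gamma>)" and down: "\<And>\<sigma> \<tau>. \<sigma> \<in> \<Gamma> \<Longrightarrow> \<tau> \<subseteq> \<sigma> \<Longrightarrow> \<tau> \<in> \<Gamma>"
  shows reduced_betti_eq: "reduced_betti TYPE('k::field) p \<Gamma> =
      chain.dim (cycle_space \<Gamma> p :: ('v set \<Rightarrow> 'k) set) - chain.dim (boundary_space \<Gamma> p :: ('v set \<Rightarrow> 'k) set)"
    and reduced_betti_le: "reduced_betti TYPE('k) p \<Gamma> \<le> card {\<sigma> \<in> \<Gamma>. card \<sigma> = p + 1}"
proof -
  let ?Z = "cycle_space \<Gamma> p :: ('v set \<Rightarrow> 'k) set" and ?B = "boundary_space \<Gamma> p :: ('v set \<Rightarrow> 'k) set"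
  let ?E = "(\<lambda>\<sigma> \<tau>. if \<tau> = \<sigma> then 1 else (0::'k)) ` {\<sigma> \<in> \<Gamma>. card \<sigma> = p + 1}"
  have BZ: "?B \<subseteq> ?Z"
    unfolding boundary_space_def cycle_space_def
    using boundary_map_in_chain_space[OF fin(2) down, where q = "p + 1"] boundary_map_boundary_map[OF fin(2)] by auto
  have Z: "?Z \<subseteq> chain.span ?E"
    using chain_space_subset_span[OF fin(1), of "p + 1"] unfolding cycle_space_def by blast
  have add: "reduced_betti TYPE('k) p \<Gamma> + chain.dim ?B = chain.dim ?Z"
    unfolding reduced_betti_def
    by (rule quotient_dim_add[OF subspace_cycle_space subspace_boundary_space BZ _ Z]) (use fin in simp)
  then show "reduced_betti TYPE('k) p \<Gamma> = chain.dim ?Z - chain.dim ?B" by simp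
  have "chain.dim ?Z \<le> card ?E" by (rule chain.dim_le_card[OF Z]) (use fin in simp)
  also have "\<dots> \<le> card {\<sigma> \<in> \<Gamma>. card \<sigma> = p + 1}" by (rule card_image_le) (use fin in simp)
  finally show "reduced_betti TYPE('k) p \<Gamma> \<le> card {\<sigma> \<in> \<Gamma>. card \<sigma> = p + 1}" using add by simp
qed

lemma rips_complex:
  fixes S :: "'a::metric_space set"
  assumes "finite S"
  shows "finite (rips S)" "finite (\<Union>(rips S))" "\<sigma> \<in> rips S \<Longrightarrow> \<tau> \<subseteq> \<sigma> \<Longrightarrow> \<tau> \<in> rips S"
proof -
  have sub: "rips S \<subseteq> Pow S" by (auto simp: rips_def)
  show "finite (rips S)" by (rule finite_subset[OF sub]) (use assms in simp)
  show "finite (\<Union>(rips S))" by (rule finite_subset[OF _ assms]) (use sub in blast)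
  show "\<tau> \<in> rips S" if "\<sigma> \<in> rips S" "\<tau> \<subseteq> \<sigma>"
  proof -
    have "finite \<sigma>" using that assms by (auto simp: rips_def intro: finite_subset)
    then have "diameter \<tau> \<le> diameter \<sigma>"
      using that by (intro diameter_subset finite_imp_bounded)
    with that show ?thesis by (auto simp: rips_def)
  qed
qed

lemma finite_betti_values:
  "finite {reduced_betti TYPE('k::field) p (rips S) | S :: 'a::metric_space set. finite S \<and> card S \<le> n}"
proof (rule finite_subset)
  show "{reduced_betti TYPE('k) p (rips S) | S :: 'a set. finite S \<and> card S \<le> n} \<subseteq> {..2 ^ n}"
  proof
    fix b assume "b \<in> {reduced_betti TYPE('k) p (rips S) | S :: 'a set. finite S \<and> card S \<le> n}"
    then obtain S :: "'a set" where S: "finite S" "card S \<le> n" and b: "b = reduced_betti TYPE('k) p (rips S)"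
      by blast
    have "reduced_betti TYPE('k) p (rips S) \<le> card {\<sigma> \<in> rips S. card \<sigma> = p + 1}"
      by (rule reduced_betti_le) (use rips_complex[OF S(1)] in blast)+
    also have "\<dots> \<le> card (Pow S)"
      by (rule card_mono) (use S in \<open>auto simp: rips_def\<close>)
    also have "\<dots> \<le> 2 ^ n" using S by (simp add: card_Pow)
    finally show "b \<in> {..2 ^ n}" using b by simp
  qed
qed simp

end

theory Submission
  imports Defs "HOL-Real_Asymp.Real_Asymp"
begin

text \<open>
  Deleting a vertex \<open>v\<close> gives \<open>\<beta>\<^sub>p(\<Gamma>) \<le> \<beta>\<^sub>p(\<Gamma> - v) + \<beta>\<^sub>p\<^sub>-\<^sub>1(lk v)\<close>, and links in a Rips
  complex are Rips complexes again. Hence \<open>M\<^sub>p\<^sub>+\<^sub>1(n) \<le> n M\<^sub>p(n)\<close>, and only \<open>p = 2\<close> is left.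

  In dimension \<open>d\<close>, packing bounds \<open>\<beta>\<^sub>0\<close> of a link and hence \<open>\<beta>\<^sub>1 = O(n)\<close>. A greedy hitting set
  together with the Sauer--Shelah lemma splits the points into polylogarithmically many classes such
  that the neighbourhoods of two points \<open>v\<close>, \<open>w\<close> of one class differ by at most \<open>\<epsilon>n\<close> points. As long as
  \<open>w\<close> is present, the link of \<open>v\<close> is a cone with apex \<open>w\<close> up to \<open>\<epsilon>n\<close> further vertices, so \<open>v\<close> costs
  only \<open>O(\<epsilon>n)\<close>.

  In the plane, colour the points by the cells of a fine grid, modulo a large period. Modulo
  boundaries and two-coloured faces, a triangle with three colours may exchange a vertex for another
  one of the same colour, and representatives \<open>abv\<close> of the resulting classes are counted as follows:
  if \<open>abv\<close> and \<open>ab'v'\<close> are inequivalent, then \<open>|bv'|, |b'v| > 1\<close>, which for nearly equilateral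
  triangles forces the edge opposite to \<open>a\<close> to be strictly longest in one of the two. Two-coloured
  complexes are treated by inserting the vertices of one colour in the order of a coordinate in which
  unit circles around points of the other colour cross at most once.
\<close>

section \<open>Codimension\<close>

interpretation chain: vector_space_pair
  "chain_scale :: 'k::field \<Rightarrow> ('b \<Rightarrow> 'k) \<Rightarrow> _" "chain_scale :: 'k \<Rightarrow> ('c \<Rightarrow> 'k) \<Rightarrow> _"
  ..

definition codim_le :: "('b \<Rightarrow> 'k::field) set \<Rightarrow> ('b \<Rightarrow> 'k) set \<Rightarrow> nat \<Rightarrow> bool" where
  "codim_le V W k \<longleftrightarrow> (\<exists>F. finite F \<and> card F \<le> k \<and> V \<subseteq> chain.span (W \<union> F))"

lemma codim_leE:
  assumes "codim_le V W k"
  obtains F where "finite F" "card F \<le> k" "V \<subseteq> chain.span (W \<union> F)"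
  using assms unfolding codim_le_def by blast

lemma codim_le_mono:
  assumes "codim_le V W k" "V' \<subseteq> V" "W \<subseteq> W'" "k \<le> l"
  shows "codim_le V' W' l"
proof -
  obtain F where F: "finite F" "card F \<le> k" "V \<subseteq> chain.span (W \<union> F)"
    using assms(1) by (rule codim_leE)
  then have "V' \<subseteq> chain.span (W' \<union> F)"
    using assms(2,3) chain.span_mono[of "W \<union> F" "W' \<union> F"] by blast
  then show ?thesis
    using F(1,2) assms(4) unfolding codim_le_def by (intro exI[of _ F]) simp
qed

lemma codim_le_0_iff: "codim_le V W 0 \<longleftrightarrow> V \<subseteq> chain.span W"
proof
  assume "codim_le V W 0"
  then show "V \<subseteq> chain.span W" by (rule codim_leE) simp
next
  assume "V \<subseteq> chain.span W"
  then show "codim_le V W 0"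
    unfolding codim_le_def by (intro exI[of _ "{}"]) simp
qed

lemma codim_le_card: "finite F \<Longrightarrow> codim_le F W (card F)"
  unfolding codim_le_def by (intro exI[of _ F]) (auto intro: chain.span_base)

lemma codim_le_span_Un:
  assumes "codim_le X W k" "codim_le Y W l"
  shows "codim_le (chain.span (X \<union> Y)) W (k + l)"
proof -
  obtain F where F: "finite F" "card F \<le> k" "X \<subseteq> chain.span (W \<union> F)"
    using assms(1) by (rule codim_leE)
  obtain G where G: "finite G" "card G \<le> l" "Y \<subseteq> chain.span (W \<union> G)"
    using assms(2) by (rule codim_leE)
  have "X \<union> Y \<subseteq> chain.span (W \<union> (F \<union> G))"
    using F(3) G(3) chain.span_mono[of "W \<union> F" "W \<union> (F \<union> G)"] chain.span_mono[of "W \<union> G" "W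
        \<union> (F \<union> G)"]
    by blast
  then have "chain.span (X \<union> Y) \<subseteq> chain.span (W \<union> (F \<union> G))"
    by (intro chain.span_minimal chain.subspace_span)
  moreover have "card (F \<union> G) \<le> k + l"
    using card_Un_le[of F G] F(2) G(2) by linarith
  ultimately show ?thesis
    unfolding codim_le_def using F(1) G(1) by blast
qed

lemma codim_le_trans:
  assumes "codim_le V U k" "codim_le U W l"
  shows "codim_le V W (k + l)"
proof -
  obtain F where F: "finite F" "card F \<le> k" "V \<subseteq> chain.span (U \<union> F)"
    using assms(1) by (rule codim_leE)
  have "codim_le (chain.span (U \<union> F)) W (l + card F)"
    by (rule codim_le_span_Un[OF assms(2) codim_le_card[OF F(1)]])
  then show ?thesis
    by (rule codim_le_mono) (use F in simp_all)
qed

lemma mem_span_insert_subspaceE: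
  assumes "x \<in> chain.span (insert f W)" "chain.subspace W"
  obtains c where "x - chain_scale c f \<in> W"
  using assms(1) chain.span_eq_iff[THEN iffD2, OF assms(2)] that
  by (auto simp: chain.span_breakdown_eq)

lemma codim_le_preimage_insert:
  assumes \<phi>: "Vector_Spaces.linear chain_scale chain_scale \<phi>"
    and V: "chain.subspace V" and W: "chain.subspace W"
  shows "codim_le {z \<in> V. \<phi> z \<in> chain.span (insert f W)} {z \<in> V. \<phi> z \<in> W} 1"
proof (cases "{z \<in> V. \<phi> z \<in> chain.span (insert f W)} \<subseteq> {z \<in> V. \<phi> z \<in> W}")
  case True
  then have "codim_le {z \<in> V. \<phi> z \<in> chain.span (insert f W)} {z \<in> V. \<phi> z \<in> W} 0"
    unfolding codim_le_0_iff using chain.span_superset by (rule order_trans)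
  then show ?thesis by (rule codim_le_mono) simp_all
next
  case False
  let ?U = "{z \<in> V. \<phi> z \<in> W}"
  obtain z\<^sub>0 where z\<^sub>0: "z\<^sub>0 \<in> V" "\<phi> z\<^sub>0 \<in> chain.span (insert f W)" "\<phi> z\<^sub>0 \<notin> W"
    using False by blast
  obtain c\<^sub>0 where c\<^sub>0: "\<phi> z\<^sub>0 - chain_scale c\<^sub>0 f \<in> W"
    using mem_span_insert_subspaceE[OF z\<^sub>0(2) W] .
  have "c\<^sub>0 \<noteq> 0" using c\<^sub>0 z\<^sub>0(3) by auto
  have "z \<in> chain.span (insert z\<^sub>0 ?U)" if z: "z \<in> V" "\<phi> z \<in> chain.span (insert f W)" for z
  proof -
    obtain c where c: "\<phi> z - chain_scale c f \<in> W"
      using mem_span_insert_subspaceE[OF z(2) W] .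
    define y where "y = z - chain_scale (c / c\<^sub>0) z\<^sub>0"
    have "\<phi> y = (\<phi> z - chain_scale c f) - chain_scale (c / c\<^sub>0) (\<phi> z\<^sub>0 - chain_scale c\<^sub>0 f)"
      unfolding y_def chain.linear_diff[OF \<phi>] chain.linear_scale[OF \<phi>]
      using \<open>c\<^sub>0 \<noteq> 0\<close> by (simp add: chain_scale_def fun_eq_iff field_simps)
    also have "\<dots> \<in> W"
      by (intro chain.subspace_diff chain.subspace_scale W c c\<^sub>0)
    finally have "y \<in> ?U"
      using V z(1) z\<^sub>0(1) unfolding y_def by (simp add: chain.subspace_diff chain.subspace_scale)
    then have "y + chain_scale (c / c\<^sub>0) z\<^sub>0 \<in> chain.span (insert z\<^sub>0 ?U)"
      by (intro chain.span_add chain.span_scale chain.span_base) simp_all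
    then show ?thesis by (simp add: y_def)
  qed
  then show ?thesis
    unfolding codim_le_def by (intro exI[of _ "{z\<^sub>0}"]) auto
qed

lemma codim_le_preimage:
  assumes \<phi>: "Vector_Spaces.linear chain_scale chain_scale \<phi>"
    and V: "chain.subspace V" and W: "chain.subspace W" and codim: "codim_le (\<phi> ` V) W k"
  shows "codim_le V {z \<in> V. \<phi> z \<in> W} k"
proof -
  obtain F where F: "finite F" "card F \<le> k" "\<phi> ` V \<subseteq> chain.span (W \<union> F)"
    using codim by (rule codim_leE)
  have "codim_le V {z \<in> V. \<phi> z \<in> W} (card F)"
    using F(1,3) W
  proof (induction F arbitrary: W rule: finite_induct)
    case empty
    then have "V \<subseteq> {z \<in> V. \<phi> z \<in> W}"
      using chain.span_eq_iff[THEN iffD2, OF empty(2)] by auto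
    then show ?case
      unfolding card.empty codim_le_0_iff using chain.span_superset by (rule order_trans)
  next
    case (insert f F)
    let ?W = "chain.span (insert f W)"
    have "W \<union> insert f F \<subseteq> chain.span (?W \<union> F)"
      using chain.span_superset[of "insert f W"] chain.span_superset[of "?W \<union> F"] by blast
    then have "\<phi> ` V \<subseteq> chain.span (?W \<union> F)"
      using insert.prems(1) chain.span_minimal[OF _ chain.subspace_span] by blast
    then have "codim_le V {z \<in> V. \<phi> z \<in> ?W} (card F)"
      by (intro insert.IH chain.subspace_span)
    from codim_le_trans[OF this codim_le_preimage_insert[OF \<phi> V insert.prems(2)]]
    show ?case using insert.hyps by simp
  qed
  then show ?thesis by (rule codim_le_mono) (use F(2) in simp_all)
qed

lemma quotient_dim_le_iff_codim_le:
  fixes V W :: "('b \<Rightarrow> 'k::field) set"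
  assumes V: "chain.subspace V" and W: "chain.subspace W" "W \<subseteq> V"
    and G: "finite G" "V \<subseteq> chain.span G"
  shows "quotient_dim V W \<le> k \<longleftrightarrow> codim_le V W k"
proof -
  have finite_if_independent: "finite A" if "chain.independent A" "A \<subseteq> V" for A
    using chain.independent_span_bound[OF G(1) that(1)] that(2) G(2) by blast
  obtain A where A: "A \<subseteq> W" "chain.independent A" "W \<subseteq> chain.span A" "card A = chain.dim W"
    using chain.basis_exists[of W] by blast
  have "finite A" by (rule finite_if_independent) (use A(1,2) W(2) in auto)
  note dim_V = quotient_dim_add[OF V W G]
  show ?thesis
  proof
    assume "quotient_dim V W \<le> k"
    obtain B where B: "A \<subseteq> B" "B \<subseteq> V" "chain.independent B" "V \<subseteq> chain.span B"
      using chain.maximal_independent_subset_extend[of A V] A(1,2) W(2) by blast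
    have "finite B" by (rule finite_if_independent) (use B(2,3) in auto)
    moreover have "card B = chain.dim V"
      using B by (intro chain.dim_unique[symmetric]) auto
    ultimately have "card (B - A) \<le> k"
      using dim_V A(4) B(1) \<open>finite A\<close> \<open>quotient_dim V W \<le> k\<close> by (simp add: card_Diff_subset)
    moreover have "V \<subseteq> chain.span (W \<union> (B - A))"
      using B(4) A(1) chain.span_mono[of B "W \<union> (B - A)"] by blast
    ultimately show "codim_le V W k"
      unfolding codim_le_def using \<open>finite B\<close> by blast
  next
    assume "codim_le V W k"
    then obtain F where F: "finite F" "card F \<le> k" "V \<subseteq> chain.span (W \<union> F)"
      by (rule codim_leE)
    have "W \<union> F \<subseteq> chain.span (A \<union> F)"
      using A(3) chain.span_mono[of A "A \<union> F"] chain.span_superset[of "A \<union> F"] by blast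
    then have "V \<subseteq> chain.span (A \<union> F)"
      using F(3) chain.span_minimal[OF _ chain.subspace_span] by blast
    then have "chain.dim V \<le> card (A \<union> F)"
      using \<open>finite A\<close> F(1) by (intro chain.dim_le_card) auto
    also have "\<dots> \<le> chain.dim W + k"
      using card_Un_le[of A F] A(4) F(2) by linarith
    finally show "quotient_dim V W \<le> k" using dim_V by simp
  qed
qed

section \<open>Homology of finite complexes\<close>

lemma linear_boundary_map: "Vector_Spaces.linear chain_scale chain_scale (boundary_map \<Gamma>)"
  unfolding Vector_Spaces.linear_iff
  using chain.vector_space_axioms by (simp add: boundary_map_add boundary_map_scale)

lemma chain_spaceD: "c \<in> chain_space \<Gamma> q \<Longrightarrow> c \<sigma> \<noteq> 0 \<Longrightarrow> \<sigma> \<in> \<Gamma> \<and> card \<sigma> = q"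
  unfolding chain_space_def by blast

lemma chain_space_mono: "\<Gamma> \<subseteq> \<Delta> \<Longrightarrow> chain_space \<Gamma> q \<subseteq> chain_space \<Delta> q"
  unfolding chain_space_def by blast

lemma boundary_map_subcomplex:
  assumes "finite (\<Union>\<Gamma>)" "\<Delta> \<subseteq> \<Gamma>" "c \<in> chain_space \<Delta> q"
  shows "boundary_map \<Delta> c = boundary_map \<Gamma> c"
proof
  fix \<tau>
  show "boundary_map \<Delta> c \<tau> = boundary_map \<Gamma> c \<tau>"
    unfolding boundary_map_def
    using assms(1,2) chain_spaceD[OF assms(3)] by (intro sum.mono_neutral_left) auto
qed

text \<open>As for \<^const>\<open>chain_space\<close>, the index is the number of vertices of the faces, which is one more
  than the dimension.\<close>

definition cycles :: "'v set set \<Rightarrow> nat \<Rightarrow> ('v set \<Rightarrow> 'k::field) set" where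
  "cycles \<Gamma> q = {c \<in> chain_space \<Gamma> q. boundary_map \<Gamma> c = 0}"

definition boundaries :: "'v set set \<Rightarrow> nat \<Rightarrow> ('v set \<Rightarrow> 'k::field) set" where
  "boundaries \<Gamma> q = boundary_map \<Gamma> ` chain_space \<Gamma> (Suc q)"

definition betti :: "'k::field itself \<Rightarrow> nat \<Rightarrow> 'v set set \<Rightarrow> nat" where
  "betti _ q \<Gamma> = quotient_dim (cycles \<Gamma> q :: ('v set \<Rightarrow> 'k) set) (boundaries \<Gamma> q)"

lemma reduced_betti_eq_betti: "reduced_betti TYPE('k::field) p \<Gamma> = betti TYPE('k) (Suc p) \<Gamma>"
  unfolding reduced_betti_def betti_def cycle_space_def cycles_def boundary_space_def boundaries_def
  by simp

lemma subspace_cycles: "chain.subspace (cycles \<Gamma> q)"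
proof -
  have "cycles \<Gamma> q = chain_space \<Gamma> q \<inter> {c. boundary_map \<Gamma> c = 0}"
    by (auto simp: cycles_def)
  then show ?thesis
    using chain.subspace_inter[OF subspace_chain_space
        chain.linear_subspace_kernel[OF linear_boundary_map]] by metis
qed

lemma subspace_boundaries: "chain.subspace (boundaries \<Gamma> q)"
  unfolding boundaries_def
  by (rule chain.linear_subspace_image[OF linear_boundary_map subspace_chain_space])

lemma cycles_subcomplex:
  assumes "finite (\<Union>\<Gamma>)" "\<Delta> \<subseteq> \<Gamma>"
  shows "cycles \<Delta> q = {c \<in> chain_space \<Delta> q. boundary_map \<Gamma> c = 0}"
  by (auto simp: cycles_def boundary_map_subcomplex[OF assms])

lemma boundaries_subcomplex:
  assumes "finite (\<Union>\<Gamma>)" "\<Delta> \<subseteq> \<Gamma>"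
  shows "boundaries \<Delta> q = boundary_map \<Gamma> ` chain_space \<Delta> (Suc q)"
  unfolding boundaries_def by (rule image_cong[OF refl boundary_map_subcomplex[OF assms]])

lemma boundaries_mono:
  assumes "finite (\<Union>\<Gamma>)" "\<Delta> \<subseteq> \<Gamma>"
  shows "boundaries \<Delta> q \<subseteq> boundaries \<Gamma> q"
  unfolding boundaries_subcomplex[OF assms] unfolding boundaries_def
  by (rule image_mono[OF chain_space_mono[OF assms(2)]])

locale finite_complex =
  fixes \<Gamma> :: "'v set set"
  assumes finite_vertices: "finite (\<Union>\<Gamma>)"
    and face_closed: "\<sigma> \<in> \<Gamma> \<Longrightarrow> \<tau> \<subseteq> \<sigma> \<Longrightarrow> \<tau> \<in> \<Gamma>"
begin

lemma finite_faces: "finite \<Gamma>"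
  using finite_vertices by (rule finite_UnionD)

lemma finite_face: "\<sigma> \<in> \<Gamma> \<Longrightarrow> finite \<sigma>"
  using finite_vertices by (meson Sup_upper finite_subset)

lemma boundary_map_in_chain_space: "c \<in> chain_space \<Gamma> (Suc q) \<Longrightarrow> boundary_map \<Gamma> c \<in> chain_space \<Gamma> q"
  using finite_vertices face_closed by (rule boundary_map_in_chain_space)

lemma boundaries_subset_cycles: "boundaries \<Gamma> q \<subseteq> cycles \<Gamma> q"
  using boundary_map_in_chain_space boundary_map_boundary_map[OF finite_vertices]
  by (auto simp: boundaries_def cycles_def)

lemma cycles_subset_span_simplices:
  "cycles \<Gamma> q \<subseteq> chain.span ((\<lambda>\<sigma> \<tau>. if \<tau> = \<sigma> then 1 else 0) ` {\<sigma> \<in> \<Gamma>. card \<sigma> = q})"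
  using chain_space_subset_span[OF finite_faces] by (auto simp: cycles_def)

lemma betti_le_iff:
  "betti TYPE('k::field) q \<Gamma> \<le> m \<longleftrightarrow> codim_le (cycles \<Gamma> q :: ('v set \<Rightarrow> 'k) set) (boundaries \<Gamma> q) m"
  unfolding betti_def
  by (rule quotient_dim_le_iff_codim_le[OF subspace_cycles subspace_boundaries boundaries_subset_cycles
        _ cycles_subset_span_simplices]) (use finite_faces in simp)

lemma codim_le_betti:
  "codim_le (cycles \<Gamma> q :: ('v set \<Rightarrow> 'k::field) set) (boundaries \<Gamma> q) (betti TYPE('k) q \<Gamma>)"
  by (rule betti_le_iff[THEN iffD1, OF order_refl])

lemma betti_eq_0_iff:
  "betti TYPE('k::field) q \<Gamma> = 0 \<longleftrightarrow> cycles \<Gamma> q \<subseteq> (boundaries \<Gamma> q :: ('v set \<Rightarrow> 'k) set)"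
proof -
  have "betti TYPE('k) q \<Gamma> = 0 \<longleftrightarrow> cycles \<Gamma> q \<subseteq> chain.span (boundaries \<Gamma> q :: ('v set \<Rightarrow> 'k) set)"
    using betti_le_iff[of q 0, where 'k = 'k] by (simp add: codim_le_0_iff)
  then show ?thesis by (simp only: chain.span_eq_iff[THEN iffD2, OF subspace_boundaries])
qed

lemma betti_le_card_faces: "betti TYPE('k::field) q \<Gamma> \<le> card {\<sigma> \<in> \<Gamma>. card \<sigma> = q}"
proof -
  let ?simplices = "(\<lambda>\<sigma> \<tau>. if \<tau> = \<sigma> then 1 else 0) ` {\<sigma> \<in> \<Gamma>. card \<sigma> = q} :: ('v set \<Rightarrow> 'k) set"
  have "codim_le (cycles \<Gamma> q) ?simplices 0"
    unfolding codim_le_0_iff by (rule cycles_subset_span_simplices)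
  moreover have "codim_le ?simplices (boundaries \<Gamma> q) (card ?simplices)"
    using finite_faces by (intro codim_le_card) simp
  ultimately have
    "codim_le (cycles \<Gamma> q :: ('v set \<Rightarrow> 'k) set) (boundaries \<Gamma> q) (0 + card ?simplices)"
    by (rule codim_le_trans)
  then have "betti TYPE('k) q \<Gamma> \<le> card ?simplices" by (simp add: betti_le_iff)
  also have "\<dots> \<le> card {\<sigma> \<in> \<Gamma>. card \<sigma> = q}"
    using finite_faces by (intro card_image_le) simp
  finally show ?thesis .
qed

lemma betti_0_le_1: "betti TYPE('k::field) 0 \<Gamma> \<le> 1"
proof -
  have "{\<sigma> \<in> \<Gamma>. card \<sigma> = 0} \<subseteq> {{}}" using finite_face by auto
  then have "card {\<sigma> \<in> \<Gamma>. card \<sigma> = 0} \<le> 1"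
    using card_mono[of "{{}}" "{\<sigma> \<in> \<Gamma>. card \<sigma> = 0}"] by simp
  then show ?thesis using betti_le_card_faces[of 0, where 'k = 'k] by linarith
qed

end

lemma finite_complex_Un: "finite_complex X \<Longrightarrow> finite_complex Y \<Longrightarrow> finite_complex (X \<union> Y)"
  unfolding finite_complex_def Union_Un_distrib finite_Un Un_iff by meson

lemma finite_complex_Int: "finite_complex X \<Longrightarrow> finite_complex Y \<Longrightarrow> finite_complex (X \<inter> Y)"
  unfolding finite_complex_def by (auto intro: finite_subset[of "\<Union>(X \<inter> Y)" "\<Union>X"])

section \<open>Deleting a vertex\<close>

definition face_sign :: "'v \<Rightarrow> 'v set \<Rightarrow> 'k::field" where
  "face_sign v \<tau> = (-1) ^ card {u \<in> \<tau>. (u, v) \<in> vertex_order}"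

lemma face_sign_square [simp]: "face_sign v \<tau> * face_sign v \<tau> = (1 :: 'k::field)"
  unfolding face_sign_def by (simp flip: power_mult_distrib)

lemma face_sign_involution [simp]: "face_sign v \<tau> * (face_sign v \<tau> * x) = (x :: 'k::field)"
  by (simp flip: mult.assoc)

lemma face_sign_swap:
  assumes "v \<noteq> w" "v \<notin> \<tau>" "w \<notin> \<tau>" "finite \<tau>"
  shows "face_sign w (insert v \<tau>) * face_sign v (insert w \<tau>)
      = - (face_sign v \<tau> * face_sign w \<tau> :: 'k::field)"
proof -
  have order: "linear_order (vertex_order :: 'a rel)" by (rule linear_order_vertex_order)
  have insert_below: "face_sign y (insert x \<tau>) = - (face_sign y \<tau> :: 'k)"
    and insert_above: "face_sign x (insert y \<tau>) = (face_sign x \<tau> :: 'k)"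
    if "(x, y) \<in> vertex_order" "x \<noteq> y" "x \<notin> \<tau>" "y \<notin> \<tau>" for x y
  proof -
    have "{u \<in> insert x \<tau>. (u, y) \<in> vertex_order} = insert x {u \<in> \<tau>. (u, y) \<in> vertex_order}"
      using that by auto
    then show "face_sign y (insert x \<tau>) = - (face_sign y \<tau> :: 'k)"
      using that assms(4) by (simp add: face_sign_def)
    have "(y, x) \<notin> vertex_order"
      using that order by (auto simp: linear_order_on_def partial_order_on_def antisym_def)
    then have "{u \<in> insert y \<tau>. (u, x) \<in> vertex_order} = {u \<in> \<tau>. (u, x) \<in> vertex_order}" by auto
    then show "face_sign x (insert y \<tau>) = (face_sign x \<tau> :: 'k)" by (simp add: face_sign_def)
  qed
  have "(v, w) \<in> vertex_order \<or> (w, v) \<in> vertex_order"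
    using order assms(1) by (auto simp: linear_order_on_def total_on_def)
  then show ?thesis
    using insert_below[of v w] insert_above[of v w] insert_below[of w v] insert_above[of w v] assms
    by auto
qed

lemma boundary_map_face_sign: "boundary_map \<Gamma> c \<tau> = (\<Sum>v\<in>\<Union>\<Gamma> - \<tau>. face_sign v \<tau> * c (insert v \<tau>))"
  unfolding boundary_map_def face_sign_def by simp

definition delete_vertex :: "'v \<Rightarrow> 'v set set \<Rightarrow> 'v set set" where
  "delete_vertex v \<Gamma> = {\<sigma> \<in> \<Gamma>. v \<notin> \<sigma>}"

definition link :: "'v \<Rightarrow> 'v set set \<Rightarrow> 'v set set" where
  "link v \<Gamma> = {\<sigma>. v \<notin> \<sigma> \<and> insert v \<sigma> \<in> \<Gamma>}"

definition delete_part :: "'v \<Rightarrow> ('v set \<Rightarrow> 'k::field) \<Rightarrow> 'v set \<Rightarrow> 'k" where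
  "delete_part v z \<tau> = (if v \<in> \<tau> then 0 else z \<tau>)"

definition link_part :: "'v \<Rightarrow> ('v set \<Rightarrow> 'k::field) \<Rightarrow> 'v set \<Rightarrow> 'k" where
  "link_part v z \<tau> = (if v \<in> \<tau> then 0 else face_sign v \<tau> * z (insert v \<tau>))"

definition cone_chain :: "'v \<Rightarrow> ('v set \<Rightarrow> 'k::field) \<Rightarrow> 'v set \<Rightarrow> 'k" where
  "cone_chain v e \<sigma> = (if v \<in> \<sigma> then face_sign v (\<sigma> - {v}) * e (\<sigma> - {v}) else 0)"

lemma delete_part_plus_cone_link_part: "delete_part v z + cone_chain v (link_part v z) = z"
proof
  fix \<sigma>
  show "(delete_part v z + cone_chain v (link_part v z)) \<sigma> = z \<sigma>"
    by (cases "v \<in> \<sigma>") (simp_all add: delete_part_def link_part_def cone_chain_def insert_absorb)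
qed

lemma link_part_cone_chain: "v \<notin> \<tau> \<Longrightarrow> link_part v (cone_chain v e) \<tau> = e \<tau>"
  by (simp add: link_part_def cone_chain_def)

lemma delete_part_cone_chain: "delete_part v (cone_chain v e) = 0"
  by (simp add: delete_part_def cone_chain_def fun_eq_iff)

lemma cone_chain_uminus: "cone_chain v (- e) = - cone_chain v e"
  by (simp add: cone_chain_def fun_eq_iff)

lemma linear_link_part: "Vector_Spaces.linear chain_scale chain_scale (link_part v)"
  unfolding Vector_Spaces.linear_iff using chain.vector_space_axioms
  by (simp add: link_part_def chain_scale_def fun_eq_iff algebra_simps)

lemma delete_part_in_chain_space:
  "z \<in> chain_space \<Gamma> q \<Longrightarrow> delete_part v z \<in> chain_space (delete_vertex v \<Gamma>) q"
  unfolding chain_space_def delete_part_def delete_vertex_def by auto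

lemma link_part_in_chain_space:
  assumes "z \<in> chain_space \<Gamma> (Suc q)"
  shows "link_part v z \<in> chain_space (link v \<Gamma>) q"
  unfolding chain_space_def
proof (intro CollectI allI impI)
  fix \<tau> assume "link_part v z \<tau> \<noteq> 0"
  then have "v \<notin> \<tau>" "z (insert v \<tau>) \<noteq> 0" by (auto simp: link_part_def split: if_splits)
  moreover from this have "insert v \<tau> \<in> \<Gamma>" "card (insert v \<tau>) = Suc q"
    using chain_spaceD[OF assms] by blast+
  moreover from this have "finite \<tau>" using card_ge_0_finite[of "insert v \<tau>"] by simp
  ultimately show "\<tau> \<in> link v \<Gamma> \<and> card \<tau> = q" by (simp add: link_def)
qed

lemma cone_chain_in_chain_space:
  assumes e: "e \<in> chain_space \<Delta> q" and cone: "\<And>\<sigma>. \<sigma> \<in> \<Delta> \<Longrightarrow> card \<sigma> = q \<Longrightarrow> finite \<sigma> \<and> insert v \<sigma> \<in> \<Gamma>"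
  shows "cone_chain v e \<in> chain_space \<Gamma> (Suc q)"
  unfolding chain_space_def
proof (intro CollectI allI impI)
  fix \<tau> assume "cone_chain v e \<tau> \<noteq> 0"
  then have v: "v \<in> \<tau>" and "e (\<tau> - {v}) \<noteq> 0" by (auto simp: cone_chain_def split: if_splits)
  then have "\<tau> - {v} \<in> \<Delta>" "card (\<tau> - {v}) = q" using chain_spaceD[OF e] by blast+
  moreover from this have "finite (\<tau> - {v})" "insert v (\<tau> - {v}) \<in> \<Gamma>" using cone by blast+
  ultimately show "\<tau> \<in> \<Gamma> \<and> card \<tau> = Suc q"
    using v card.insert_remove[of "\<tau> - {v}" v] by (simp add: insert_absorb)
qed

lemma face_sign_mult_cone_chain_insert:
  fixes e :: "'v set \<Rightarrow> 'k::field"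
  assumes "v \<notin> \<rho>" "w \<notin> insert v \<rho>" and supp: "e (insert w \<rho>) \<noteq> 0 \<Longrightarrow> finite \<rho>"
  shows "face_sign w (insert v \<rho>) * cone_chain v e (insert w (insert v \<rho>))
    = - (face_sign v \<rho> * (face_sign w \<rho> * e (insert w \<rho>)))"
proof -
  have "insert w (insert v \<rho>) - {v} = insert w \<rho>" using assms(1,2) by auto
  then have eq: "face_sign w (insert v \<rho>) * cone_chain v e (insert w (insert v \<rho>))
      = (face_sign w (insert v \<rho>) * face_sign v (insert w \<rho>)) * e (insert w \<rho>)"
    by (simp add: cone_chain_def)
  show ?thesis
  proof (cases "finite \<rho>")
    case True
    have "face_sign w (insert v \<rho>) * face_sign v (insert w \<rho>)
        = - (face_sign v \<rho> * face_sign w \<rho> :: 'k)"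
      by (rule face_sign_swap) (use assms(1,2) True in auto)
    with eq show ?thesis by (simp add: mult.assoc)
  next
    case False
    then have "e (insert w \<rho>) = 0" using supp by blast
    with eq show ?thesis by simp
  qed
qed

context finite_complex
begin

lemma finite_complex_delete_vertex: "finite_complex (delete_vertex v \<Gamma>)"
proof
  show "finite (\<Union>(delete_vertex v \<Gamma>))"
    by (rule finite_subset[OF _ finite_vertices]) (auto simp: delete_vertex_def)
qed (auto simp: delete_vertex_def intro: face_closed)

lemma delete_vertex_subset: "delete_vertex v \<Gamma> \<subseteq> \<Gamma>"
  by (auto simp: delete_vertex_def)

lemma link_subset: "link v \<Gamma> \<subseteq> \<Gamma>"
  using face_closed by (auto simp: link_def)

lemma link_subset_delete_vertex: "link v \<Gamma> \<subseteq> delete_vertex v \<Gamma>"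
  using face_closed by (auto simp: link_def delete_vertex_def)

lemma finite_complex_link: "finite_complex (link v \<Gamma>)"
proof
  show "finite (\<Union>(link v \<Gamma>))"
    by (rule finite_subset[OF _ finite_vertices]) (auto simp: link_def)
  show "\<tau> \<in> link v \<Gamma>" if "\<sigma> \<in> link v \<Gamma>" "\<tau> \<subseteq> \<sigma>" for \<sigma> \<tau>
    using that face_closed[of "insert v \<sigma>" "insert v \<tau>"] by (auto simp: link_def)
qed

lemma boundary_map_off_vertex:
  assumes "v \<in> \<Union>\<Gamma>" "v \<notin> \<tau>"
  shows "boundary_map \<Gamma> z \<tau> = link_part v z \<tau> + boundary_map \<Gamma> (delete_part v z) \<tau>"
proof -
  have v: "v \<in> \<Union>\<Gamma> - \<tau>" and fin: "finite (\<Union>\<Gamma> - \<tau>)" using assms finite_vertices by auto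
  have "boundary_map \<Gamma> (delete_part v z) \<tau> = (\<Sum>w\<in>\<Union>\<Gamma> - \<tau> - {v}. face_sign w \<tau> * z (insert w \<tau>))"
    unfolding boundary_map_face_sign sum.remove[OF fin v]
    using assms(2) by (auto simp: delete_part_def split: if_splits intro!: sum.cong)
  then show ?thesis
    unfolding boundary_map_face_sign[of \<Gamma> z] sum.remove[OF fin v] using assms(2)
    by (simp add: link_part_def)
qed

lemma link_part_of_cycle:
  assumes "v \<in> \<Union>\<Gamma>" "boundary_map \<Gamma> z = 0"
  shows "link_part v z = - boundary_map \<Gamma> (delete_part v z)"
proof
  fix \<tau>
  show "link_part v z \<tau> = (- boundary_map \<Gamma> (delete_part v z)) \<tau>"
  proof (cases "v \<in> \<tau>")
    case True
    then show ?thesis by (simp add: boundary_map_face_sign link_part_def delete_part_def)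
  next
    case False
    then show ?thesis
      using boundary_map_off_vertex[OF assms(1) False, of z] assms(2)
      by (simp add: eq_neg_iff_add_eq_0)
  qed
qed

lemma boundary_map_cone_chain:
  fixes e :: "'v set \<Rightarrow> 'k::field"
  assumes v: "v \<in> \<Union>\<Gamma>" and supp: "\<And>\<sigma>. e \<sigma> \<noteq> 0 \<Longrightarrow> finite \<sigma> \<and> v \<notin> \<sigma>"
  shows "boundary_map \<Gamma> (cone_chain v e) = e - cone_chain v (boundary_map \<Gamma> e)"
proof
  fix \<tau>
  show "boundary_map \<Gamma> (cone_chain v e) \<tau> = (e - cone_chain v (boundary_map \<Gamma> e)) \<tau>"
  proof (cases "v \<in> \<tau>")
    case False
    then show ?thesis
      using boundary_map_off_vertex[OF v False, of "cone_chain v e"]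
      by (simp add: boundary_map_zero link_part_cone_chain delete_part_cone_chain cone_chain_def)
  next
    case True
    define \<rho> where "\<rho> = \<tau> - {v}"
    have \<tau>: "\<tau> = insert v \<rho>" "v \<notin> \<rho>" using True by (auto simp: \<rho>_def)
    have coface: "face_sign w \<tau> * cone_chain v e (insert w \<tau>)
        = - (face_sign v \<rho> * (face_sign w \<rho> * e (insert w \<rho>)))"
      if "w \<in> \<Union>\<Gamma> - \<tau>" for w
      unfolding \<tau>(1) using that \<tau> supp[of "insert w \<rho>"]
      by (intro face_sign_mult_cone_chain_insert) auto
    have "boundary_map \<Gamma> (cone_chain v e) \<tau>
        = - (face_sign v \<rho> * (\<Sum>w\<in>\<Union>\<Gamma> - \<tau>. face_sign w \<rho> * e (insert w \<rho>)))"
      unfolding boundary_map_face_sign by (simp add: coface sum_negf sum_distrib_left)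
    also have "(\<Sum>w\<in>\<Union>\<Gamma> - \<tau>. face_sign w \<rho> * e (insert w \<rho>)) = boundary_map \<Gamma> e \<rho>"
      unfolding boundary_map_face_sign
      using finite_vertices supp \<tau> by (intro sum.mono_neutral_left) auto
    finally show ?thesis
      using True supp[of \<tau>] by (auto simp: cone_chain_def[of v "boundary_map \<Gamma> e"] \<rho>_def)
  qed
qed

lemma link_part_in_cycles:
  assumes v: "v \<in> \<Union>\<Gamma>" and z: "z \<in> cycles \<Gamma> (Suc q)"
  shows "link_part v z \<in> cycles (link v \<Gamma>) q"
proof -
  have z: "z \<in> chain_space \<Gamma> (Suc q)" "boundary_map \<Gamma> z = 0" using z by (auto simp: cycles_def)
  have "delete_part v z \<in> chain_space \<Gamma> (Suc q)"
    using delete_part_in_chain_space[OF z(1)] chain_space_mono[OF delete_vertex_subset] by blast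
  then have "boundary_map \<Gamma> (link_part v z) = 0"
    unfolding link_part_of_cycle[OF v z(2)] chain.linear_neg[OF linear_boundary_map]
    using boundary_map_boundary_map[OF finite_vertices] by simp
  then show ?thesis
    using link_part_in_chain_space[OF z(1)]
    by (simp add: cycles_subcomplex[OF finite_vertices link_subset])
qed

lemma cycle_in_span_if_link_part_boundary:
  assumes v: "v \<in> \<Union>\<Gamma>" and z: "z \<in> cycles \<Gamma> (Suc q)"
    and link: "link_part v z \<in> boundaries (link v \<Gamma>) q"
  shows "z \<in> chain.span (boundaries \<Gamma> (Suc q) \<union> cycles (delete_vertex v \<Gamma>) (Suc q))"
proof -
  obtain e where e: "e \<in> chain_space (link v \<Gamma>) (Suc q)" "link_part v z = boundary_map \<Gamma> e"
    using link unfolding boundaries_subcomplex[OF finite_vertices link_subset] by blast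
  let ?b = "boundary_map \<Gamma> (cone_chain v e)"
  have "?b = e - cone_chain v (link_part v z)"
    unfolding e(2) using chain_spaceD[OF e(1)] link_subset finite_face
    by (intro boundary_map_cone_chain[OF v]) (auto simp: link_def)
  then have sum_eq: "z + ?b = delete_part v z + e"
    by (subst delete_part_plus_cone_link_part[of v z, symmetric]) simp
  have cone: "cone_chain v e \<in> chain_space \<Gamma> (Suc (Suc q))"
    using link_subset finite_face
    by (intro cone_chain_in_chain_space[OF e(1)]) (auto simp: link_def)
  have "boundary_map \<Gamma> (z + ?b) = 0"
    using z boundary_map_boundary_map[OF finite_vertices cone]
    by (simp add: cycles_def boundary_map_add)
  moreover have "z + ?b \<in> chain_space (delete_vertex v \<Gamma>) (Suc q)"
    unfolding sum_eq
    using z e(1)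
    by (intro chain.subspace_add[OF subspace_chain_space] delete_part_in_chain_space
        subsetD[OF chain_space_mono[OF link_subset_delete_vertex]]) (auto simp: cycles_def)
  ultimately have "z + ?b \<in> cycles (delete_vertex v \<Gamma>) (Suc q)"
    by (simp add: cycles_subcomplex[OF finite_vertices delete_vertex_subset])
  moreover have "?b \<in> boundaries \<Gamma> (Suc q)" unfolding boundaries_def using cone by blast
  ultimately have "(z + ?b) - ?b \<in> chain.span (boundaries \<Gamma> (Suc q)
      \<union> cycles (delete_vertex v \<Gamma>) (Suc q))"
    by (intro chain.span_diff chain.span_base) auto
  then show ?thesis by simp
qed

theorem betti_Suc_le_delete_plus_link:
  "betti TYPE('k::field) (Suc q) \<Gamma>
    \<le> betti TYPE('k) (Suc q) (delete_vertex v \<Gamma>) + betti TYPE('k) q (link v \<Gamma>)"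
proof (cases "v \<in> \<Union>\<Gamma>")
  case False
  then have "delete_vertex v \<Gamma> = \<Gamma>" by (auto simp: delete_vertex_def)
  then show ?thesis by simp
next
  case True
  interpret del: finite_complex "delete_vertex v \<Gamma>" by (rule finite_complex_delete_vertex)
  interpret lnk: finite_complex "link v \<Gamma>" by (rule finite_complex_link)
  let ?Z = "cycles \<Gamma> (Suc q) :: ('v set \<Rightarrow> 'k) set"
    and ?B = "boundaries \<Gamma> (Suc q) :: ('v set \<Rightarrow> 'k) set"
  let ?Z\<^sub>d = "cycles (delete_vertex v \<Gamma>) (Suc q) :: ('v set \<Rightarrow> 'k) set"
  let ?U = "{z \<in> ?Z. link_part v z \<in> boundaries (link v \<Gamma>) q}"
  have "codim_le (link_part v ` ?Z) (boundaries (link v \<Gamma>) q) (betti TYPE('k) q (link v \<Gamma>))"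
    using link_part_in_cycles[OF True] by (intro codim_le_mono[OF lnk.codim_le_betti]) auto
  then have "codim_le ?Z ?U (betti TYPE('k) q (link v \<Gamma>))"
    by (rule codim_le_preimage[OF linear_link_part subspace_cycles subspace_boundaries])
  moreover have "codim_le ?U ?B (betti TYPE('k) (Suc q) (delete_vertex v \<Gamma>))"
  proof -
    have "codim_le ?B ?B 0" unfolding codim_le_0_iff by (rule chain.span_superset)
    moreover have "codim_le ?Z\<^sub>d ?B (betti TYPE('k) (Suc q) (delete_vertex v \<Gamma>))"
      by (rule codim_le_mono[OF del.codim_le_betti[of "Suc q"]])
        (simp_all add: boundaries_mono[OF finite_vertices delete_vertex_subset])
    ultimately have
      "codim_le (chain.span (?B \<union> ?Z\<^sub>d)) ?B (0 + betti TYPE('k) (Suc q) (delete_vertex v \<Gamma>))"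
      by (rule codim_le_span_Un)
    then show ?thesis
      by (rule codim_le_mono) (use cycle_in_span_if_link_part_boundary[OF True] in auto)
  qed
  ultimately show ?thesis unfolding betti_le_iff add.commute[of "betti _ (Suc q) _"]
    by (rule codim_le_trans)
qed

text \<open>For \<open>q = 0\<close> this says that a nonempty complex has no reduced homology in degree \<open>- 1\<close>.\<close>

lemma betti_eq_0_if_cone:
  assumes cone: "\<And>\<sigma>. \<sigma> \<in> \<Gamma> \<Longrightarrow> card \<sigma> = q \<Longrightarrow> insert v \<sigma> \<in> \<Gamma>"
  shows "betti TYPE('k::field) q \<Gamma> = 0"
proof (rule betti_eq_0_iff[THEN iffD2, OF subsetI])
  fix z :: "'v set \<Rightarrow> 'k" assume "z \<in> cycles \<Gamma> q"
  then have z: "z \<in> chain_space \<Gamma> q" "boundary_map \<Gamma> z = 0" by (auto simp: cycles_def)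
  show "z \<in> boundaries \<Gamma> q"
  proof (cases "v \<in> \<Union>\<Gamma>")
    case True
    let ?d = "delete_part v z"
    have d: "?d \<in> chain_space (delete_vertex v \<Gamma>) q" by (rule delete_part_in_chain_space[OF z(1)])
    then have "boundary_map \<Gamma> (cone_chain v ?d) = ?d - cone_chain v (boundary_map \<Gamma> ?d)"
      using chain_spaceD[OF d] finite_face
      by (intro boundary_map_cone_chain[OF True]) (auto simp: delete_vertex_def)
    also have "\<dots> = ?d + cone_chain v (link_part v z)"
      unfolding link_part_of_cycle[OF True z(2)] cone_chain_uminus by simp
    also have "\<dots> = z" by (rule delete_part_plus_cone_link_part)
    finally have "z = boundary_map \<Gamma> (cone_chain v ?d)" by simp
    moreover have "cone_chain v ?d \<in> chain_space \<Gamma> (Suc q)"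
      using cone finite_face
      by (intro cone_chain_in_chain_space[OF d]) (auto simp: delete_vertex_def)
    ultimately show ?thesis unfolding boundaries_def by blast
  next
    case False
    have "z \<sigma> = 0" for \<sigma>
    proof (rule ccontr)
      assume "z \<sigma> \<noteq> 0"
      then have "insert v \<sigma> \<in> \<Gamma>" using chain_spaceD[OF z(1)] cone by blast
      then show False using False by blast
    qed
    then have "z = 0" by (simp add: fun_eq_iff)
    then show ?thesis using chain.subspace_0[OF subspace_boundaries] by simp
  qed
qed

end

section \<open>Unions\<close>

lemma cycles_Un_subset_span:
  fixes X Y :: "'v set set"
  assumes X: "finite_complex X" and Y: "finite_complex Y"
    and int: "betti TYPE('k::field) q (X \<inter> Y) = 0"
  shows "(cycles (X \<union> Y) (Suc q) :: ('v set \<Rightarrow> 'k) set)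
      \<subseteq> chain.span (cycles X (Suc q) \<union> cycles Y (Suc q))"
proof
  interpret X: finite_complex X by (rule X)
  interpret Y: finite_complex Y by (rule Y)
  interpret XY: finite_complex "X \<union> Y" by (rule finite_complex_Un[OF X Y])
  interpret int: finite_complex "X \<inter> Y" by (rule finite_complex_Int[OF X Y])
  let ?bd = "boundary_map (X \<union> Y) :: _ \<Rightarrow> 'v set \<Rightarrow> 'k"
  note boundary_diff = chain.linear_diff[OF linear_boundary_map]
    and boundary_add = chain.linear_add[OF linear_boundary_map]
  note boundary_eq = boundary_map_subcomplex[OF XY.finite_vertices]
  note cycles_sub = cycles_subcomplex[OF XY.finite_vertices]
  have inter_sub: "X \<inter> Y \<subseteq> X \<union> Y" by blast
  fix z :: "'v set \<Rightarrow> 'k" assume "z \<in> cycles (X \<union> Y) (Suc q)"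
  then have z: "z \<in> chain_space (X \<union> Y) (Suc q)" "?bd z = 0" by (auto simp: cycles_def)
  define x y where "x = (\<lambda>\<sigma>. if \<sigma> \<in> X then z \<sigma> else 0)" and "y = z - x"
  have x: "x \<in> chain_space X (Suc q)" and y: "y \<in> chain_space Y (Suc q)"
    using z(1) unfolding chain_space_def x_def y_def by (auto split: if_splits)
  have bd_y: "?bd y = - ?bd x" using z(2) by (simp add: y_def boundary_diff)
  have "?bd x \<in> chain_space X q"
    using X.boundary_map_in_chain_space[OF x] by (simp add: boundary_eq[OF _ x])
  moreover have "?bd x \<in> chain_space Y q"
    using chain.subspace_neg[OF subspace_chain_space Y.boundary_map_in_chain_space[OF y]]
    by (simp add: boundary_eq[OF _ y] bd_y)
  ultimately have "?bd x \<in> chain_space (X \<inter> Y) q" unfolding chain_space_def by auto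
  moreover have "?bd (?bd x) = 0"
    by (rule boundary_map_boundary_map[OF XY.finite_vertices subsetD[OF chain_space_mono x]]) simp
  ultimately have "?bd x \<in> cycles (X \<inter> Y) q" unfolding cycles_sub[OF inter_sub] by blast
  then have "?bd x \<in> boundaries (X \<inter> Y) q" using int int.betti_eq_0_iff by blast
  then obtain w where w: "w \<in> chain_space (X \<inter> Y) (Suc q)" "?bd x = ?bd w"
    using boundaries_subcomplex[OF XY.finite_vertices, of "X \<inter> Y"] by auto
  have wX: "w \<in> chain_space X (Suc q)" and wY: "w \<in> chain_space Y (Suc q)"
    using w(1) unfolding chain_space_def by auto
  have "x - w \<in> cycles X (Suc q)"
    using chain.subspace_diff[OF subspace_chain_space x wX] w(2)
    by (simp add: cycles_sub boundary_diff)
  moreover have "y + w \<in> cycles Y (Suc q)"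
    using chain.subspace_add[OF subspace_chain_space y wY] w(2) bd_y
    by (simp add: cycles_sub boundary_add)
  ultimately have "(x - w) + (y + w) \<in> chain.span (cycles X (Suc q) \<union> cycles Y (Suc q))"
    by (intro chain.span_add chain.span_base) auto
  then show "z \<in> chain.span (cycles X (Suc q) \<union> cycles Y (Suc q))" by (simp add: y_def)
qed

lemma betti_Un_le:
  fixes X Y :: "'v set set"
  assumes X: "finite_complex X" and Y: "finite_complex Y"
    and int: "betti TYPE('k::field) q (X \<inter> Y) = 0"
  shows "betti TYPE('k) (Suc q) (X \<union> Y) \<le> betti TYPE('k) (Suc q) X + betti TYPE('k) (Suc q) Y"
proof -
  interpret XY: finite_complex "X \<union> Y" by (rule finite_complex_Un[OF X Y])
  have codim: "codim_le (cycles Z (Suc q) :: ('v set \<Rightarrow> 'k) set) (boundaries (X \<union> Y) (Suc q))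
      (betti TYPE('k) (Suc q) Z)"
    if "finite_complex Z" "Z \<subseteq> X \<union> Y" for Z
    using finite_complex.codim_le_betti[OF that(1), of "Suc q"]
    by (rule codim_le_mono) (simp_all add: boundaries_mono[OF XY.finite_vertices that(2)])
  have "codim_le (chain.span (cycles X (Suc q) \<union> cycles Y (Suc q)) :: ('v set \<Rightarrow> 'k) set)
      (boundaries (X \<union> Y) (Suc q)) (betti TYPE('k) (Suc q) X + betti TYPE('k) (Suc q) Y)"
    by (intro codim_le_span_Un codim X Y) auto
  then show ?thesis
    unfolding XY.betti_le_iff
    by (rule codim_le_mono) (simp_all add: cycles_Un_subset_span[OF X Y int])
qed

lemma betti_Un_UN_le:
  fixes X :: "'i \<Rightarrow> 'v set set"
  assumes "finite I" and X\<^sub>0: "finite_complex X\<^sub>0" and X: "\<And>i. i \<in> I \<Longrightarrow> finite_complex (X i)"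
    and int: "\<And>i J. i \<in> I \<Longrightarrow> J \<subseteq> I - {i} \<Longrightarrow> betti TYPE('k::field) q ((X\<^sub>0 \<union> (\<Union>j\<in>J. X j)) \<inter> X i) = 0"
  shows "betti TYPE('k) (Suc q) (X\<^sub>0 \<union> (\<Union>i\<in>I. X i))
      \<le> betti TYPE('k) (Suc q) X\<^sub>0 + (\<Sum>i\<in>I. betti TYPE('k) (Suc q) (X i))"
proof -
  have "finite_complex (X\<^sub>0 \<union> (\<Union>j\<in>J. X j)) \<and>
      betti TYPE('k) (Suc q) (X\<^sub>0 \<union> (\<Union>j\<in>J. X j))
        \<le> betti TYPE('k) (Suc q) X\<^sub>0 + (\<Sum>j\<in>J. betti TYPE('k) (Suc q) (X j))"
    if "J \<subseteq> I" for J
    using finite_subset[OF that \<open>finite I\<close>] that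
  proof (induction J rule: finite_induct)
    case empty
    then show ?case using X\<^sub>0 by simp
  next
    case (insert i J)
    let ?U = "X\<^sub>0 \<union> (\<Union>j\<in>J. X j)"
    have U: "finite_complex ?U" "finite_complex (X i)"
      "betti TYPE('k) (Suc q) ?U
        \<le> betti TYPE('k) (Suc q) X\<^sub>0 + (\<Sum>j\<in>J. betti TYPE('k) (Suc q) (X j))"
      using insert X by auto
    have "betti TYPE('k) (Suc q) (?U \<union> X i)
        \<le> betti TYPE('k) (Suc q) ?U + betti TYPE('k) (Suc q) (X i)"
      using insert.hyps insert.prems by (intro betti_Un_le U int) auto
    moreover have "X\<^sub>0 \<union> (\<Union>j\<in>insert i J. X j) = ?U \<union> X i" by auto
    ultimately show ?case
      using finite_complex_Un[OF U(1,2)] U(3) insert.hyps by simp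
  qed
  then show ?thesis by blast
qed

section \<open>Rainbow faces\<close>

definition rainbow :: "'v set set \<Rightarrow> ('v \<Rightarrow> 'c) \<Rightarrow> nat \<Rightarrow> 'v set set" where
  "rainbow \<Gamma> \<kappa> n = {\<tau> \<in> \<Gamma>. card \<tau> = n \<and> inj_on \<kappa> \<tau>}"

definition colour_skeleton :: "'v set set \<Rightarrow> ('v \<Rightarrow> 'c) \<Rightarrow> nat \<Rightarrow> 'v set set" where
  "colour_skeleton \<Gamma> \<kappa> k = {\<sigma> \<in> \<Gamma>. card (\<kappa> ` \<sigma>) \<le> k}"

definition vertex_exchange :: "'v set set \<Rightarrow> ('v \<Rightarrow> 'c) \<Rightarrow> 'v set rel" where
  "vertex_exchange \<Gamma> \<kappa> = {(insert x \<sigma>, insert y \<sigma>) | x y \<sigma>.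
     insert x (insert y \<sigma>) \<in> \<Gamma> \<and> x \<notin> \<sigma> \<and> y \<notin> \<sigma> \<and> \<kappa> x = \<kappa> y \<and> inj_on \<kappa> (insert x \<sigma>)}"

definition simplex_chain :: "'v set \<Rightarrow> 'v set \<Rightarrow> 'k::field" where
  "simplex_chain \<sigma> \<tau> = (if \<tau> = \<sigma> then 1 else 0)"

lemma face_sign_nonzero: "face_sign v \<tau> \<noteq> (0 :: 'k::field)"
  by (simp add: face_sign_def)

lemma sym_vertex_exchange: "sym (vertex_exchange \<Gamma> \<kappa>)"
proof (rule symI)
  fix \<tau> \<tau>' assume "(\<tau>, \<tau>') \<in> vertex_exchange \<Gamma> \<kappa>"
  then obtain x y \<sigma> where "\<tau> = insert x \<sigma>" "\<tau>' = insert y \<sigma>" "insert x (insert y \<sigma>) \<in> \<Gamma>"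
    "x \<notin> \<sigma>" "y \<notin> \<sigma>" "\<kappa> x = \<kappa> y" "inj_on \<kappa> (insert x \<sigma>)"
    unfolding vertex_exchange_def by blast
  then show "(\<tau>', \<tau>) \<in> vertex_exchange \<Gamma> \<kappa>"
    unfolding vertex_exchange_def
    by (intro CollectI exI[of _ y] exI[of _ x] exI[of _ \<sigma>]) (simp add: insert_commute)
qed

lemma card_vertex_exchange: "(\<tau>, \<tau>') \<in> vertex_exchange \<Gamma> \<kappa> \<Longrightarrow> card \<tau>' = card \<tau>"
proof -
  have "card (insert y \<sigma>) = card (insert x \<sigma>)" if "x \<notin> \<sigma>" "y \<notin> \<sigma>" for x y :: 'a and \<sigma>
    using that by (cases "finite \<sigma>") simp_all
  then show "(\<tau>, \<tau>') \<in> vertex_exchange \<Gamma> \<kappa> \<Longrightarrow> card \<tau>' = card \<tau>"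
    unfolding vertex_exchange_def by blast
qed

lemma representatives_exist:
  assumes "sym r"
  obtains F where "F \<subseteq> R" "\<And>x. x \<in> R \<Longrightarrow> \<exists>y\<in>F. (x, y) \<in> r\<^sup>*"
    "\<And>x y. x \<in> F \<Longrightarrow> y \<in> F \<Longrightarrow> (x, y) \<in> r\<^sup>* \<Longrightarrow> x = y"
proof -
  define rep where "rep x = (SOME y. y \<in> R \<and> (x, y) \<in> r\<^sup>*)" for x
  have rep: "rep x \<in> R" "(x, rep x) \<in> r\<^sup>*" if "x \<in> R" for x
    using someI[of "\<lambda>y. y \<in> R \<and> (x, y) \<in> r\<^sup>*" x] that by (auto simp: rep_def)
  have rep_eq: "rep x = rep y" if "(x, y) \<in> r\<^sup>*" for x y
  proof -
    have "(y, x) \<in> r\<^sup>*" by (rule symD[OF sym_rtrancl[OF assms] that])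
    then have "(x, z) \<in> r\<^sup>* \<longleftrightarrow> (y, z) \<in> r\<^sup>*" for z
      using rtrancl_trans[OF that, of z] rtrancl_trans[of y x r z] by blast
    then show ?thesis by (simp add: rep_def)
  qed
  show thesis
  proof
    show "rep ` R \<subseteq> R" using rep(1) by blast
    show "\<exists>y\<in>rep ` R. (x, y) \<in> r\<^sup>*" if "x \<in> R" for x using rep(2)[OF that] that by blast
    show "x = y" if "x \<in> rep ` R" "y \<in> rep ` R" "(x, y) \<in> r\<^sup>*" for x y
    proof -
      have "rep x = x" if "x \<in> rep ` R" for x
        using that by (metis imageE rep(2) rep_eq)
      then show ?thesis using that rep_eq by metis
    qed
  qed
qed

context finite_complex
begin

lemma finite_complex_colour_skeleton: "finite_complex (colour_skeleton \<Gamma> \<kappa> k)"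
proof
  show "finite (\<Union>(colour_skeleton \<Gamma> \<kappa> k))"
    by (rule finite_subset[OF _ finite_vertices]) (auto simp: colour_skeleton_def)
  show "\<tau> \<in> colour_skeleton \<Gamma> \<kappa> k" if "\<sigma> \<in> colour_skeleton \<Gamma> \<kappa> k" "\<tau> \<subseteq> \<sigma>" for \<sigma> \<tau>
  proof -
    have \<sigma>: "\<sigma> \<in> \<Gamma>" "card (\<kappa> ` \<sigma>) \<le> k" using that(1) by (auto simp: colour_skeleton_def)
    then have "card (\<kappa> ` \<tau>) \<le> card (\<kappa> ` \<sigma>)" using finite_face that(2) by (intro card_mono) auto
    then show ?thesis using \<sigma> face_closed[OF \<sigma>(1) that(2)] by (simp add: colour_skeleton_def)
  qed
qed

lemma colour_skeleton_if_not_inj_on: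
  assumes "\<sigma> \<in> \<Gamma>" "card \<sigma> = Suc k" "\<not> inj_on \<kappa> \<sigma>"
  shows "\<sigma> \<in> colour_skeleton \<Gamma> \<kappa> k"
proof -
  have "card (\<kappa> ` \<sigma>) \<noteq> card \<sigma>"
    using assms(3) eq_card_imp_inj_on[OF finite_face[OF assms(1)]] by blast
  then show ?thesis
    using assms(1,2) card_image_le[OF finite_face[OF assms(1)], of \<kappa>]
    by (simp add: colour_skeleton_def)
qed

lemma boundary_map_simplex_chain_facet:
  assumes "insert x \<tau> \<in> \<Gamma>" "x \<notin> \<tau>"
  shows "boundary_map \<Gamma> (simplex_chain (insert x \<tau>)) \<tau> = face_sign x \<tau>"
proof -
  have "boundary_map \<Gamma> (simplex_chain (insert x \<tau>)) \<tau>
      = (\<Sum>v\<in>{x}. face_sign v \<tau> * simplex_chain (insert x \<tau>) (insert v \<tau>))"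
    unfolding boundary_map_face_sign
    using finite_vertices assms by (intro sum.mono_neutral_right) (auto simp: simplex_chain_def)
  then show ?thesis by (simp add: simplex_chain_def)
qed

lemma boundary_map_simplex_chain_nonzeroE:
  assumes "boundary_map \<Gamma> (simplex_chain \<rho>) \<tau> \<noteq> (0 :: 'k::field)"
  obtains v where "v \<notin> \<tau>" "\<rho> = insert v \<tau>"
proof -
  obtain v where "v \<in> \<Union>\<Gamma> - \<tau>" "face_sign v \<tau> * simplex_chain \<rho> (insert v \<tau>) \<noteq> (0 :: 'k)"
    using assms unfolding boundary_map_face_sign by (metis (no_types, lifting) sum.neutral)
  then show thesis using that[of v] by (auto simp: simplex_chain_def split: if_splits)
qed

text \<open>The remaining facets contain both \<open>x\<close> and \<open>y\<close> and hence repeat a colour.\<close>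

lemma boundary_map_simplex_chain_minus_rainbow_facets:
  fixes b :: "'v set \<Rightarrow> 'k::field"
  assumes \<rho>: "insert x (insert y \<sigma>) \<in> \<Gamma>" and neq: "x \<notin> \<sigma>" "y \<notin> \<sigma>" "x \<noteq> y"
    and "\<kappa> x = \<kappa> y" "card \<sigma> = k"
  defines "b \<equiv> boundary_map \<Gamma> (simplex_chain (insert x (insert y \<sigma>)))"
  shows "b \<in> boundaries \<Gamma> (Suc k)"
    and "b - chain_scale (b (insert x \<sigma>)) (simplex_chain (insert x \<sigma>))
      - chain_scale (b (insert y \<sigma>)) (simplex_chain (insert y \<sigma>))
      \<in> chain_space (colour_skeleton \<Gamma> \<kappa> k) (Suc k)"
      (is "?r \<in> _")
proof -
  have "finite \<sigma>" using finite_face[OF \<rho>] by simp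
  then have "simplex_chain (insert x (insert y \<sigma>)) \<in> chain_space \<Gamma> (Suc (Suc k))"
    using assms by (auto simp: chain_space_def simplex_chain_def)
  then have b: "b \<in> boundaries \<Gamma> (Suc k)" "b \<in> chain_space \<Gamma> (Suc k)"
    unfolding b_def boundaries_def using boundary_map_in_chain_space by blast+
  have "\<phi> \<in> colour_skeleton \<Gamma> \<kappa> k \<and> card \<phi> = Suc k" if "?r \<phi> \<noteq> 0" for \<phi>
  proof -
    have \<phi>: "b \<phi> \<noteq> 0" "\<phi> \<noteq> insert x \<sigma>" "\<phi> \<noteq> insert y \<sigma>"
      using that neq by (auto simp: chain_scale_def simplex_chain_def split: if_splits)
    then obtain v where v: "v \<notin> \<phi>" "insert x (insert y \<sigma>) = insert v \<phi>"
      unfolding b_def by (elim boundary_map_simplex_chain_nonzeroE)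
    then have "v \<noteq> x" "v \<noteq> y" using neq \<phi>(2,3) by (auto simp: insert_eq_iff)
    then have "x \<in> \<phi>" "y \<in> \<phi>" using v by auto
    then have "\<not> inj_on \<kappa> \<phi>" using \<open>\<kappa> x = \<kappa> y\<close> neq(3) by (auto dest: inj_onD)
    then show ?thesis using chain_spaceD[OF b(2) \<phi>(1)] colour_skeleton_if_not_inj_on by blast
  qed
  then show "?r \<in> chain_space (colour_skeleton \<Gamma> \<kappa> k) (Suc k)" by (simp add: chain_space_def)
  show "b \<in> boundaries \<Gamma> (Suc k)" by (rule b(1))
qed

lemma simplex_chain_vertex_exchange:
  assumes exch: "(\<tau>, \<tau>') \<in> vertex_exchange \<Gamma> \<kappa>" and card: "card \<tau> = Suc k"
  shows "(simplex_chain \<tau> :: 'v set \<Rightarrow> 'k::field) \<in> chain.span (insert (simplex_chain \<tau>')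
    (chain_space (colour_skeleton \<Gamma> \<kappa> k) (Suc k) \<union> boundaries \<Gamma> (Suc k)))"
    (is "_ \<in> chain.span (insert _ ?W)")
proof -
  obtain x y \<sigma> where \<tau>: "\<tau> = insert x \<sigma>" "\<tau>' = insert y \<sigma>" "x \<notin> \<sigma>" "y \<notin> \<sigma>"
    and \<rho>: "insert x (insert y \<sigma>) \<in> \<Gamma>" and col: "\<kappa> x = \<kappa> y"
    using exch unfolding vertex_exchange_def by blast
  show ?thesis
  proof (cases "x = y")
    case True
    then show ?thesis using \<tau> by (intro chain.span_base) simp
  next
    case False
    define b where "b = (boundary_map \<Gamma> (simplex_chain (insert x (insert y \<sigma>))) :: 'v set \<Rightarrow> 'k)"
    define r
      where "r = b - chain_scale (b \<tau>) (simplex_chain \<tau>) - chain_scale (b \<tau>') (simplex_chain \<tau>')"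
    have "card \<sigma> = k" using card finite_face[OF \<rho>] \<tau> by simp
    from boundary_map_simplex_chain_minus_rainbow_facets[OF \<rho> \<tau>(3,4) False col this, where 'k = 'k]
    have W: "b \<in> ?W" "r \<in> ?W" unfolding r_def b_def \<tau>(1,2) by simp_all
    have "b \<tau> = face_sign y \<tau>"
      unfolding b_def insert_commute[of x y] \<tau>(1) using \<rho> \<tau>(4) False
      by (intro boundary_map_simplex_chain_facet) (auto simp: insert_commute)
    then have "b \<tau> \<noteq> 0" by (simp add: face_sign_nonzero)
    then have "simplex_chain \<tau>
        = chain_scale (inverse (b \<tau>)) (b - chain_scale (b \<tau>') (simplex_chain \<tau>') - r)"
      by (simp add: r_def chain_scale_def fun_eq_iff)
    also have "\<dots> \<in> chain.span (insert (simplex_chain \<tau>') ?W)"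
      using W by (intro chain.span_scale chain.span_diff chain.span_base) auto
    finally show ?thesis .
  qed
qed

lemma simplex_chain_vertex_exchange_rtrancl:
  assumes "(\<tau>, \<tau>') \<in> (vertex_exchange \<Gamma> \<kappa>)\<^sup>*" "card \<tau> = Suc k"
  shows "(simplex_chain \<tau> :: 'v set \<Rightarrow> 'k::field) \<in> chain.span (insert (simplex_chain \<tau>')
    (chain_space (colour_skeleton \<Gamma> \<kappa> k) (Suc k) \<union> boundaries \<Gamma> (Suc k)))"
    (is "_ \<in> chain.span (insert _ ?W)")
  using assms
proof (induction rule: converse_rtrancl_induct)
  case base
  show ?case by (intro chain.span_base) simp
next
  case (step \<tau> \<rho>)
  have "simplex_chain \<rho> \<in> chain.span (insert (simplex_chain \<tau>') ?W)"
    using step.IH card_vertex_exchange[OF step.hyps(1)] step.prems by simp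
  moreover have "?W \<subseteq> chain.span (insert (simplex_chain \<tau>') ?W)"
    by (auto intro: chain.span_base)
  ultimately have "chain.span (insert (simplex_chain \<rho>) ?W)
      \<subseteq> chain.span (insert (simplex_chain \<tau>') ?W)"
    by (intro chain.span_minimal chain.subspace_span) simp
  then show ?case using simplex_chain_vertex_exchange[OF step.hyps(1) step.prems] by blast
qed

lemma chain_space_codim_le_rainbow_representatives:
  assumes F: "finite F" "\<And>\<tau>. \<tau> \<in> rainbow \<Gamma> \<kappa> (Suc k) \<Longrightarrow> \<exists>\<tau>'\<in>F. (\<tau>, \<tau>') \<in> (vertex_exchange \<Gamma> \<kappa>)\<^sup>*"
  shows "codim_le (chain_space \<Gamma> (Suc k) :: ('v set \<Rightarrow> 'k::field) set)
    (chain_space (colour_skeleton \<Gamma> \<kappa> k) (Suc k) \<union> boundaries \<Gamma> (Suc k)) (card F)"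
    (is "codim_le _ ?W _")
proof -
  let ?S = "chain.span (?W \<union> simplex_chain ` F)"
  have "simplex_chain \<sigma> \<in> ?S" if \<sigma>: "\<sigma> \<in> \<Gamma>" "card \<sigma> = Suc k" for \<sigma>
  proof (cases "inj_on \<kappa> \<sigma>")
    case True
    then have "\<sigma> \<in> rainbow \<Gamma> \<kappa> (Suc k)" using \<sigma> by (simp add: rainbow_def)
    then obtain \<tau> where \<tau>: "\<tau> \<in> F" "(\<sigma>, \<tau>) \<in> (vertex_exchange \<Gamma> \<kappa>)\<^sup>*" using F(2) by blast
    have "chain.span (insert (simplex_chain \<tau>) ?W) \<subseteq> ?S"
      using \<tau>(1) by (intro chain.span_mono) auto
    then show ?thesis using simplex_chain_vertex_exchange_rtrancl[OF \<tau>(2) \<sigma>(2)] by blast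
  next
    case False
    then have "\<sigma> \<in> colour_skeleton \<Gamma> \<kappa> k" using \<sigma> by (intro colour_skeleton_if_not_inj_on)
    then show ?thesis
      using \<sigma>(2) by (intro chain.span_base UnI1) (auto simp: chain_space_def simplex_chain_def)
  qed
  then have "(\<lambda>\<sigma> \<tau>. if \<tau> = \<sigma> then 1 else (0::'k)) ` {\<sigma> \<in> \<Gamma>. card \<sigma> = Suc k} \<subseteq> ?S"
    unfolding simplex_chain_def by auto
  then have "chain_space \<Gamma> (Suc k) \<subseteq> ?S"
    by (intro order_trans[OF chain_space_subset_span[OF finite_faces] chain.span_minimal]
        chain.subspace_span)
  then show ?thesis
    using F(1) card_image_le[OF F(1)] unfolding codim_le_def
    by (intro exI[of _ "simplex_chain ` F"]) simp
qed

lemma betti_le_rainbow_plus_colour_skeleton: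
  assumes F: "finite F" "\<And>\<tau>. \<tau> \<in> rainbow \<Gamma> \<kappa> (Suc k) \<Longrightarrow> \<exists>\<tau>'\<in>F. (\<tau>, \<tau>') \<in> (vertex_exchange \<Gamma> \<kappa>)\<^sup>*"
  shows "betti TYPE('k::field) (Suc k) \<Gamma> \<le> card F + betti TYPE('k) (Suc k) (colour_skeleton \<Gamma> \<kappa> k)"
proof -
  let ?L = "colour_skeleton \<Gamma> \<kappa> k"
  interpret L: finite_complex ?L by (rule finite_complex_colour_skeleton)
  have L: "?L \<subseteq> \<Gamma>" by (auto simp: colour_skeleton_def)
  let ?C = "chain_space ?L (Suc k) :: ('v set \<Rightarrow> 'k) set"
    and ?B = "boundaries \<Gamma> (Suc k) :: ('v set \<Rightarrow> 'k) set"
  let ?Z = "cycles \<Gamma> (Suc k) :: ('v set \<Rightarrow> 'k) set"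
    and ?Z\<^sub>L = "cycles ?L (Suc k) :: ('v set \<Rightarrow> 'k) set"
  have "codim_le ?Z (?C \<union> ?B) (card F)"
    by (rule codim_le_mono[OF chain_space_codim_le_rainbow_representatives[OF F]])
      (auto simp: cycles_def)
  then have "codim_le (id ` ?Z) (chain.span (?C \<union> ?B)) (card F)"
    by (rule codim_le_mono) (auto intro: chain.span_base)
  then have Z_le: "codim_le ?Z {z \<in> ?Z. id z \<in> chain.span (?C \<union> ?B)} (card F)"
    by (intro codim_le_preimage chain.linear_id subspace_cycles chain.subspace_span)
  have sub: "{z \<in> ?Z. id z \<in> chain.span (?C \<union> ?B)} \<subseteq> chain.span (?Z\<^sub>L \<union> ?B)"
  proof clarify
    fix z assume z: "z \<in> ?Z" "id z \<in> chain.span (?C \<union> ?B)"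
    then obtain c b where split: "z = c + b" "c \<in> ?C" "b \<in> ?B"
      unfolding chain.span_Un chain.span_eq_iff[THEN iffD2, OF subspace_chain_space]
        chain.span_eq_iff[THEN iffD2, OF subspace_boundaries] by auto
    have "boundary_map \<Gamma> b = 0" using split(3) boundaries_subset_cycles by (auto simp: cycles_def)
    then have "c \<in> ?Z\<^sub>L"
      using z(1) split(1,2)
      by (simp add: cycles_def[of \<Gamma>] cycles_subcomplex[OF finite_vertices L] boundary_map_add)
    then show "z \<in> chain.span (?Z\<^sub>L \<union> ?B)"
      unfolding split(1) using split(3) by (intro chain.span_add chain.span_base) auto
  qed
  have "codim_le (chain.span (?Z\<^sub>L \<union> ?B)) ?B (betti TYPE('k) (Suc k) ?L + 0)"
  proof (rule codim_le_span_Un)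
    show "codim_le ?Z\<^sub>L ?B (betti TYPE('k) (Suc k) ?L)"
      by (rule codim_le_mono[OF L.codim_le_betti[of "Suc k"]])
        (simp_all add: boundaries_mono[OF finite_vertices L])
    show "codim_le ?B ?B 0" unfolding codim_le_0_iff by (rule chain.span_superset)
  qed
  then have "codim_le {z \<in> ?Z. id z \<in> chain.span (?C \<union> ?B)} ?B (betti TYPE('k) (Suc k) ?L)"
    by (rule codim_le_mono[OF _ sub order_refl]) simp
  with Z_le show ?thesis unfolding betti_le_iff by (rule codim_le_trans)
qed

end

section \<open>Clique complexes\<close>

definition clique_complex :: "('v \<Rightarrow> 'v \<Rightarrow> bool) \<Rightarrow> 'v set \<Rightarrow> 'v set set" where
  "clique_complex E T = {\<sigma>. \<sigma> \<subseteq> T \<and> (\<forall>x\<in>\<sigma>. \<forall>y\<in>\<sigma>. E x y)}"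

lemma finite_complex_clique_complex:
  assumes "finite T"
  shows "finite_complex (clique_complex E T)"
proof
  show "finite (\<Union>(clique_complex E T))"
    by (rule finite_subset[OF _ assms]) (auto simp: clique_complex_def)
qed (auto simp: clique_complex_def)

lemma delete_vertex_clique_complex: "delete_vertex v (clique_complex E T)
    = clique_complex E (T - {v})"
  unfolding delete_vertex_def clique_complex_def by auto

lemma betti_clique_empty: "betti TYPE('k::field) (Suc q) (clique_complex E {}) = 0"
  by (rule finite_complex.betti_eq_0_if_cone[OF finite_complex_clique_complex])
    (auto simp: clique_complex_def)

locale reflexive_graph =
  fixes E :: "'v \<Rightarrow> 'v \<Rightarrow> bool"
  assumes adj_refl: "E x x" and adj_sym: "E x y \<Longrightarrow> E y x"
begin

lemma link_clique_complex: "v \<notin> T \<Longrightarrow>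
    link v (clique_complex E (insert v T)) = clique_complex E {x \<in> T. E v x}"
  using adj_refl adj_sym unfolding link_def clique_complex_def by fastforce

lemma betti_clique_insert_le:
  assumes "finite T"
  shows "betti TYPE('k::field) (Suc q) (clique_complex E (insert v T))
    \<le> betti TYPE('k) (Suc q) (clique_complex E T)
      + betti TYPE('k) q (clique_complex E {x \<in> T. E v x})"
proof (cases "v \<in> T")
  case False
  interpret finite_complex "clique_complex E (insert v T)"
    using assms by (intro finite_complex_clique_complex) simp
  show ?thesis
    using betti_Suc_le_delete_plus_link[of q v] False
    by (simp add: delete_vertex_clique_complex link_clique_complex)
qed (simp add: insert_absorb)

lemma betti_clique_apex:
  assumes "finite T" "v \<in> T" "\<And>x. x \<in> T \<Longrightarrow> E v x"
  shows "betti TYPE('k::field) q (clique_complex E T) = 0"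
  by (rule finite_complex.betti_eq_0_if_cone[OF finite_complex_clique_complex[OF assms(1)],
        where v = v])
    (use assms(2,3) adj_sym in \<open>auto simp: clique_complex_def\<close>)

lemma betti_clique_le_by_insertion:
  fixes rank :: "'v \<Rightarrow> 'r::linorder"
  assumes A: "finite A" and D: "finite D"
    and base: "betti TYPE('k::field) (Suc q) (clique_complex E A) \<le> \<Phi> {}"
    and step: "\<And>v U. v \<in> D \<Longrightarrow> U \<subseteq> D \<Longrightarrow> v \<notin> U \<Longrightarrow> 
      (\<And>u. u \<in> U \<Longrightarrow> rank u \<le> rank v) \<Longrightarrow> (\<And>w. w \<in> D - U \<Longrightarrow> rank v \<le> rank w) \<Longrightarrow>
      \<Phi> U + betti TYPE('k) q (clique_complex E {x \<in> A \<union> U. E v x}) \<le> \<Phi> (insert v U)"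
  shows "betti TYPE('k) (Suc q) (clique_complex E (A \<union> D)) \<le> \<Phi> D"
proof -
  have "U \<subseteq> D \<longrightarrow> (\<forall>u\<in>U. \<forall>w\<in>D - U. rank u \<le> rank w) \<longrightarrow>
      betti TYPE('k) (Suc q) (clique_complex E (A \<union> U)) \<le> \<Phi> U" if "finite U" for U
    using that
  proof (induction U rule: finite_ranking_induct[where f = rank])
    case empty
    show ?case using base by simp
  next
    case (insert v U)
    show ?case
    proof (intro impI)
      assume sub: "insert v U \<subseteq> D" and initial: "\<forall>u\<in>insert v U. \<forall>w\<in>D - insert v U. rank u \<le> rank w"
      have "\<forall>u\<in>U. \<forall>w\<in>D - U. rank u \<le> rank w" using initial insert.hyps(2) by blast
      then have IH: "betti TYPE('k) (Suc q) (clique_complex E (A \<union> U)) \<le> \<Phi> U" using insert.IH sub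
        by simp
      show "betti TYPE('k) (Suc q) (clique_complex E (A \<union> insert v U)) \<le> \<Phi> (insert v U)"
      proof (cases "v \<in> U")
        case True
        then show ?thesis using IH by (simp add: insert_absorb)
      next
        case False
        have "rank v \<le> rank w" if "w \<in> D - U" for w using initial that by (cases "w = v") auto
        then have budget: "\<Phi> U + betti TYPE('k) q (clique_complex E {x \<in> A \<union> U. E v x})
            \<le> \<Phi> (insert v U)"
          using sub False insert.hyps(2) by (intro step) auto
        show ?thesis
          using betti_clique_insert_le[of "A \<union> U" q v, where 'k = 'k] A insert.hyps(1) IH budget
          by simp
      qed
    qed
  qed
  then show ?thesis using D by blast
qed

lemma betti_clique_Un_le:
  assumes "finite A" "finite D"
    and link: "\<And>v U. v \<in> D \<Longrightarrow> U \<subseteq> D \<Longrightarrow>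
        betti TYPE('k::field) q (clique_complex E {x \<in> A \<union> U. E v x}) \<le> m"
  shows "betti TYPE('k) (Suc q) (clique_complex E (A \<union> D))
    \<le> betti TYPE('k) (Suc q) (clique_complex E A) + m * card D"
proof (rule betti_clique_le_by_insertion[where rank = "\<lambda>_. 0 :: nat", OF assms(1,2)])
  fix v U assume "v \<in> D" "U \<subseteq> D" "v \<notin> U"
  then show "betti TYPE('k) (Suc q) (clique_complex E A) + m * card U
      + betti TYPE('k) q (clique_complex E {x \<in> A \<union> U. E v x})
    \<le> betti TYPE('k) (Suc q) (clique_complex E A) + m * card (insert v U)"
    using link[of v U] finite_subset[OF _ assms(2)] by simp
qed simp

lemma betti_clique_le_mult_card:
  assumes "finite T"
    and "\<And>v U. v \<in> T \<Longrightarrow> U \<subseteq> T \<Longrightarrow> betti TYPE('k::field) q (clique_complex E {x \<in> U. E v x}) \<le> m"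
  shows "betti TYPE('k) (Suc q) (clique_complex E T) \<le> m * card T"
proof -
  have "betti TYPE('k) (Suc q) (clique_complex E ({} \<union> T))
      \<le> betti TYPE('k) (Suc q) (clique_complex E {}) + m * card T"
    by (rule betti_clique_Un_le) (simp_all add: assms)
  then show ?thesis by (simp add: betti_clique_empty)
qed

lemma betti_clique_transitive:
  assumes "finite T" and trans: "\<And>x y z. x \<in> T \<Longrightarrow> y \<in> T \<Longrightarrow> z \<in> T \<Longrightarrow> E x y \<Longrightarrow> E y z \<Longrightarrow> E x z"
  shows "betti TYPE('k::field) (Suc (Suc q)) (clique_complex E T) = 0"
proof -
  have "betti TYPE('k) (Suc q) (clique_complex E {x \<in> U. E v x}) \<le> 0" if "v \<in> T" "U \<subseteq> T" for v U
  proof (cases "{x \<in> U. E v x} = {}")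
    case True
    then show ?thesis by (simp only: betti_clique_empty order_refl)
  next
    case False
    then obtain w where w: "w \<in> U" "E v w" by blast
    have "E w x" if "x \<in> U" "E v x" for x
      using trans[of w v x] w that \<open>v \<in> T\<close> \<open>U \<subseteq> T\<close> adj_sym by blast
    then show ?thesis
      using w finite_subset[OF that(2) assms(1)] by (intro eq_refl betti_clique_apex[of _ w]) auto
  qed
  from betti_clique_le_mult_card[OF assms(1) this] show ?thesis by simp
qed

lemma betti_clique_1_le_card_colours:
  assumes "finite T" and same_colour: "\<And>x y. x \<in> T \<Longrightarrow> y \<in> T \<Longrightarrow> \<kappa> x = \<kappa> y \<Longrightarrow> E x y"
  shows "betti TYPE('k::field) 1 (clique_complex E T) \<le> card (\<kappa> ` T)"
proof -
  have "betti TYPE('k) (Suc 0) (clique_complex E ({} \<union> T)) \<le> card (\<kappa> ` T)"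
  proof (rule betti_clique_le_by_insertion[where rank = "\<lambda>_. 0 :: nat" and \<Phi> = "\<lambda>U. card (\<kappa> ` U)"])
    fix v U assume U: "v \<in> T" "U \<subseteq> T"
    let ?N = "clique_complex E {x \<in> U. E v x}"
    have finU: "finite U" by (rule finite_subset[OF U(2) assms(1)])
    then interpret N: finite_complex ?N by (intro finite_complex_clique_complex) simp
    have "card (\<kappa> ` U) + betti TYPE('k) 0 ?N \<le> card (\<kappa> ` insert v U)"
    proof (cases "\<kappa> v \<in> \<kappa> ` U")
      case True
      then obtain w where "w \<in> U" "\<kappa> v = \<kappa> w" by auto
      then have "{w} \<in> ?N" using same_colour U adj_refl by (auto simp: clique_complex_def)
      then have "betti TYPE('k) 0 ?N = 0"
        using N.finite_face by (intro N.betti_eq_0_if_cone[of 0 w]) auto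
      then show ?thesis using True by (simp add: insert_absorb)
    next
      case False
      then show ?thesis using N.betti_0_le_1[where 'k = 'k] finU by simp
    qed
    then show "card (\<kappa> ` U) + betti TYPE('k) 0 (clique_complex E {x \<in> {} \<union> U. E v x})
        \<le> card (\<kappa> ` insert v U)"
      by simp
  qed (simp_all add: assms(1) betti_clique_empty)
  then show ?thesis by simp
qed

end

section \<open>Coloured graphs\<close>

locale coloured_graph = reflexive_graph E for E :: "'v \<Rightarrow> 'v \<Rightarrow> bool" +
  fixes \<kappa> :: "'v \<Rightarrow> 'c"
  assumes finite_colours: "finite (range \<kappa>)"
    and common_neighbour: "E z x \<Longrightarrow> E z y \<Longrightarrow> \<kappa> x = \<kappa> y \<Longrightarrow> E x y"
begin

abbreviation num_colours :: nat where
  "num_colours \<equiv> card (range \<kappa>)"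

lemma betti_1_link_le:
  assumes "finite U"
  shows "betti TYPE('k::field) 1 (clique_complex E {x \<in> U. E v x}) \<le> num_colours"
proof -
  have "betti TYPE('k) 1 (clique_complex E {x \<in> U. E v x}) \<le> card (\<kappa> ` {x \<in> U. E v x})"
    using assms common_neighbour by (intro betti_clique_1_le_card_colours) auto
  also have "\<dots> \<le> num_colours" using finite_colours by (intro card_mono) auto
  finally show ?thesis .
qed

lemma betti_2_le:
  assumes "finite T"
  shows "betti TYPE('k::field) 2 (clique_complex E T) \<le> num_colours * card T"
  unfolding numeral_2_eq_2 One_nat_def[symmetric]
  by (intro betti_clique_le_mult_card betti_1_link_le assms finite_subset[OF _ assms])

lemma betti_2_link_le:
  assumes U: "finite U" "w \<in> U" and col: "\<kappa> v = \<kappa> w"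
  shows "betti TYPE('k::field) 2 (clique_complex E {x \<in> U. E v x}) \<le> num_colours * card {x
      \<in> U. E v x \<and> \<not> E w x}"
proof -
  let ?A = "{x \<in> U. E v x \<and> E w x}" and ?D = "{x \<in> U. E v x \<and> \<not> E w x}"
  have A: "betti TYPE('k) 2 (clique_complex E ?A) = 0"
  proof (cases "?A = {}")
    case True
    then show ?thesis by (simp only: betti_clique_empty numeral_2_eq_2)
  next
    case False
    then obtain x where "E v x" "E w x" by blast
    then have "E v w" using common_neighbour[of x v w] adj_sym col by blast
    then show ?thesis using U adj_refl by (intro betti_clique_apex[of _ w]) auto
  qed
  have "betti TYPE('k) (Suc 1) (clique_complex E (?A \<union> ?D))
      \<le> betti TYPE('k) (Suc 1) (clique_complex E ?A) + num_colours * card ?D"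
    using U(1) finite_subset[of _ ?D] by (intro betti_clique_Un_le betti_1_link_le) auto
  moreover have "?A \<union> ?D = {x \<in> U. E v x}" by auto
  ultimately show ?thesis using A by (simp add: numeral_2_eq_2)
qed

text \<open>As long as the \<open>\<theta>\<close>-class of \<open>v\<close> contains another vertex \<open>w\<close>, inserting \<open>v\<close> is cheap: its link is
  a cone with apex \<open>w\<close> up to at most \<open>m\<close> vertices.\<close>

lemma betti_3_le_classes:
  fixes \<theta> :: "'v \<Rightarrow> 'b"
  assumes T: "finite T"
    and twins: "\<And>v w. v \<in> T \<Longrightarrow> w \<in> T \<Longrightarrow> \<theta> v = \<theta> w \<Longrightarrow> \<kappa> v = \<kappa> w \<and> card {x \<in> T. E v x \<and> \<not> E w x} \<le> m"
  shows "betti TYPE('k::field) 3 (clique_complex E T) \<le> num_colours * (m + card (\<theta> ` T)) * card T"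
proof -
  define \<Phi> where "\<Phi> U = num_colours * (m * card U + card T * card (\<theta> ` U))" for U
  have "betti TYPE('k) (Suc 2) (clique_complex E ({} \<union> T)) \<le> \<Phi> T"
  proof (rule betti_clique_le_by_insertion[where rank = "\<lambda>_. 0 :: nat"])
    fix v U assume U: "v \<in> T" "U \<subseteq> T" "v \<notin> U"
    have finU: "finite U" by (rule finite_subset[OF U(2) T])
    have "\<Phi> U + betti TYPE('k) 2 (clique_complex E {x \<in> U. E v x}) \<le> \<Phi> (insert v U)"
    proof (cases "\<theta> v \<in> \<theta> ` U")
      case True
      then obtain w where w: "w \<in> U" "\<theta> v = \<theta> w" by auto
      then have vw: "\<kappa> v = \<kappa> w" "card {x \<in> T. E v x \<and> \<not> E w x} \<le> m" using twins[of v w] U by auto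
      have "card {x \<in> U. E v x \<and> \<not> E w x} \<le> card {x \<in> T. E v x \<and> \<not> E w x}"
        using T U(2) by (intro card_mono) auto
      then have "betti TYPE('k) 2 (clique_complex E {x \<in> U. E v x}) \<le> num_colours * m"
        using vw(2)
        by (intro order_trans[OF betti_2_link_le[OF finU w(1) vw(1)] mult_le_mono2]) simp
      then show ?thesis using True U(3) finU by (simp add: \<Phi>_def insert_absorb algebra_simps)
    next
      case False
      have "card {x \<in> U. E v x} \<le> card T" using T U(2) by (intro card_mono) auto
      then have "betti TYPE('k) 2 (clique_complex E {x \<in> U. E v x}) \<le> num_colours * card T"
        using finU by (intro order_trans[OF betti_2_le mult_le_mono2]) simp_all
      then show ?thesis using False U(3) finU by (simp add: \<Phi>_def algebra_simps)
    qed
    then show "\<Phi> U + betti TYPE('k) 2 (clique_complex E {x \<in> {} \<union> U. E v x}) \<le> \<Phi> (insert v U)"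
      by simp
  qed (simp_all only: T betti_clique_empty finite.emptyI zero_le)
  then show ?thesis by (simp add: \<Phi>_def algebra_simps)
qed

definition same_colour_adj :: "'v \<Rightarrow> 'v \<Rightarrow> bool" where
  "same_colour_adj x y \<longleftrightarrow> E x y \<and> \<kappa> x = \<kappa> y"

sublocale same_colour: reflexive_graph same_colour_adj
  by unfold_locales (auto simp: same_colour_adj_def adj_refl adj_sym)

lemma betti_same_colour_eq_0:
  assumes "finite T"
  shows "betti TYPE('k::field) (Suc (Suc q)) (clique_complex same_colour_adj T) = 0"
proof (rule same_colour.betti_clique_transitive[OF assms])
  fix x y z assume "same_colour_adj x y" "same_colour_adj y z"
  then show "same_colour_adj x z"
    using common_neighbour[of y x z] adj_sym by (auto simp: same_colour_adj_def)
qed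

lemma colour_skeleton_1_clique_complex:
  assumes "finite T"
  shows "colour_skeleton (clique_complex E T) \<kappa> 1 = clique_complex same_colour_adj T"
proof -
  have "card (\<kappa> ` \<sigma>) \<le> 1 \<longleftrightarrow> (\<forall>x\<in>\<sigma>. \<forall>y\<in>\<sigma>. \<kappa> x = \<kappa> y)" if "\<sigma> \<subseteq> T" for \<sigma>
    using finite_subset[OF that assms] card_le_Suc0_iff_eq[of "\<kappa> ` \<sigma>"] by simp
  then show ?thesis unfolding colour_skeleton_def clique_complex_def same_colour_adj_def by auto
qed

lemma clique_vertex_exchange:
  assumes "insert x \<sigma> \<in> clique_complex E T" "insert y \<sigma> \<in> clique_complex E T" "\<sigma> \<noteq> {}"
    and "x \<notin> \<sigma>" "\<kappa> x = \<kappa> y" "inj_on \<kappa> (insert x \<sigma>)"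
  shows "(insert x \<sigma>, insert y \<sigma>) \<in> vertex_exchange (clique_complex E T) \<kappa>"
proof -
  obtain z where "z \<in> \<sigma>" using assms(3) by blast
  then have "E z x" "E z y" using assms(1,2) by (auto simp: clique_complex_def)
  then have "E x y" using assms(5) by (rule common_neighbour)
  moreover from this have "E y x" by (rule adj_sym)
  ultimately have "insert x (insert y \<sigma>) \<in> clique_complex E T"
    using assms(1,2) by (auto simp: clique_complex_def)
  moreover have "y \<notin> \<sigma>" using assms(4-6) by auto
  ultimately show ?thesis using assms(4-6) unfolding vertex_exchange_def by blast
qed

lemma colour_skeleton_2_clique_complex:
  assumes T: "finite T"
  shows "colour_skeleton (clique_complex E T) \<kappa> 2
    = clique_complex same_colour_adj T \<union>
      (\<Union>W\<in>{W. W \<subseteq> range \<kappa> \<and> card W = 2}. clique_complex E {x \<in> T. \<kappa> x \<in> W})"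
    (is "?L = ?X\<^sub>0 \<union> (\<Union>W\<in>?I. ?X W)")
proof (intro equalityI subsetI)
  fix \<sigma> assume "\<sigma> \<in> ?L"
  then have \<sigma>: "\<sigma> \<in> clique_complex E T" "card (\<kappa> ` \<sigma>) \<le> 2" by (auto simp: colour_skeleton_def)
  show "\<sigma> \<in> ?X\<^sub>0 \<union> (\<Union>W\<in>?I. ?X W)"
  proof (cases "card (\<kappa> ` \<sigma>) = 2")
    case True
    then show ?thesis using \<sigma>(1) by (intro UnI2 UN_I[of "\<kappa> ` \<sigma>"]) (auto simp: clique_complex_def)
  next
    case False
    then have "\<sigma> \<in> colour_skeleton (clique_complex E T) \<kappa> 1" using \<sigma>
      by (simp add: colour_skeleton_def)
    then show ?thesis using colour_skeleton_1_clique_complex[OF T] by blast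
  qed
next
  fix \<sigma> assume "\<sigma> \<in> ?X\<^sub>0 \<union> (\<Union>W\<in>?I. ?X W)"
  then consider (same_colour) "\<sigma> \<in> ?X\<^sub>0" | (two_colours) W where "W \<in> ?I" "\<sigma> \<in> ?X W" by blast
  then show "\<sigma> \<in> ?L"
  proof cases
    case same_colour
    then show ?thesis
      unfolding colour_skeleton_1_clique_complex[OF T, symmetric] by (simp add: colour_skeleton_def)
  next
    case two_colours
    then have "\<kappa> ` \<sigma> \<subseteq> W" "finite W" by (auto simp: clique_complex_def intro: card_ge_0_finite)
    then have "card (\<kappa> ` \<sigma>) \<le> 2" using card_mono[of W "\<kappa> ` \<sigma>"] two_colours(1) by simp
    then show ?thesis using two_colours(2) by (auto simp: colour_skeleton_def clique_complex_def)
  qed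
qed

lemma same_colour_Un_Int_two_coloured:
  assumes W: "card W = 2" and J: "\<And>W'. W' \<in> J \<Longrightarrow> card W' = 2 \<and> W' \<noteq> W"
  shows "(clique_complex same_colour_adj T
      \<union> (\<Union>W'\<in>J. clique_complex E {x \<in> T. \<kappa> x \<in> W'})) \<inter> clique_complex E {x \<in> T. \<kappa> x \<in> W}
    = clique_complex same_colour_adj {x \<in> T. \<kappa> x \<in> W}"
proof -
  have card_2_eq: "W = {i, j}" if "card W = 2" "i \<in> W" "j \<in> W" "i \<noteq> j" for W :: "'c set" and i j
    using that by (auto simp: card_2_iff)
  have "\<sigma> \<in> clique_complex same_colour_adj {x \<in> T. \<kappa> x \<in> W}"
    if W': "W' \<in> J" and \<sigma>: "\<sigma> \<in> clique_complex E {x \<in> T. \<kappa> x \<in> W'}"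
      "\<sigma> \<in> clique_complex E {x \<in> T. \<kappa> x \<in> W}" for \<sigma> W'
  proof -
    have "\<kappa> x = \<kappa> y" if "x \<in> \<sigma>" "y \<in> \<sigma>" for x y
    proof (rule ccontr)
      assume "\<kappa> x \<noteq> \<kappa> y"
      moreover have "{\<kappa> x, \<kappa> y} \<subseteq> W \<inter> W'" using that \<sigma> by (auto simp: clique_complex_def)
      ultimately have "W = W'" using card_2_eq[OF W] card_2_eq[of W' "\<kappa> x" "\<kappa> y"] J[OF W'] by simp
      then show False using J[OF W'] by simp
    qed
    then show ?thesis using \<sigma>(2) unfolding clique_complex_def same_colour_adj_def by blast
  qed
  moreover have "clique_complex same_colour_adj T \<inter> clique_complex E {x \<in> T. \<kappa> x \<in> W}
      = clique_complex same_colour_adj {x \<in> T. \<kappa> x \<in> W}"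
    by (auto simp: clique_complex_def same_colour_adj_def)
  ultimately show ?thesis by blast
qed

lemma betti_3_colour_skeleton_2_le:
  assumes T: "finite T"
    and two_colours: "\<And>i j. i \<noteq> j \<Longrightarrow>
        betti TYPE('k::field) 3 (clique_complex E {x \<in> T. \<kappa> x \<in> {i, j}}) \<le> m"
  shows "betti TYPE('k) 3 (colour_skeleton (clique_complex E T) \<kappa> 2) \<le> 2 ^ num_colours * m"
proof -
  let ?I = "{W. W \<subseteq> range \<kappa> \<and> card W = 2}" and ?X = "\<lambda>W. clique_complex E {x \<in> T. \<kappa> x \<in> W}"
  have "finite ?I" using finite_colours by simp
  have "betti TYPE('k) (Suc 2) (clique_complex same_colour_adj T \<union> (\<Union>W\<in>?I. ?X W))
      \<le> betti TYPE('k) (Suc 2) (clique_complex same_colour_adj T)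
        + (\<Sum>W\<in>?I. betti TYPE('k) (Suc 2) (?X W))"
  proof (rule betti_Un_UN_le[OF \<open>finite ?I\<close>])
    fix W J assume "W \<in> ?I" "J \<subseteq> ?I - {W}"
    then have "(clique_complex same_colour_adj T \<union> (\<Union>W'\<in>J. ?X W')) \<inter> ?X W
        = clique_complex same_colour_adj {x \<in> T. \<kappa> x \<in> W}"
      by (intro same_colour_Un_Int_two_coloured) auto
    then show "betti TYPE('k) 2 ((clique_complex same_colour_adj T \<union> (\<Union>W'\<in>J. ?X W')) \<inter> ?X W) = 0"
      using T by (simp add: numeral_2_eq_2 betti_same_colour_eq_0)
  qed (use T in \<open>simp_all add: finite_complex_clique_complex\<close>)
  also have "betti TYPE('k) (Suc 2) (clique_complex same_colour_adj T) = 0"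
    using betti_same_colour_eq_0[OF T] by (simp add: numeral_2_eq_2)
  also have "(\<Sum>W\<in>?I. betti TYPE('k) (Suc 2) (?X W)) \<le> (\<Sum>W\<in>?I. m)"
  proof (rule sum_mono)
    fix W assume "W \<in> ?I"
    then obtain i j where W: "W = {i, j}" and "i \<noteq> j" by (auto simp: card_2_iff)
    then show "betti TYPE('k) (Suc 2) (?X W) \<le> m" using two_colours[OF \<open>i \<noteq> j\<close>] unfolding W by simp
  qed
  also have "(\<Sum>W\<in>?I. m) = card ?I * m" by simp
  also have "\<dots> \<le> 2 ^ num_colours * m"
    using card_mono[of "Pow (range \<kappa>)" ?I] finite_colours
    by (intro mult_right_mono) (auto simp: card_Pow)
  finally show ?thesis by (simp add: colour_skeleton_2_clique_complex[OF T])
qed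

end

section \<open>Two-coloured graphs\<close>

lemma card_le_if_last_in_row_or_first_in_column:
  fixes Q :: "('a::linorder \<times> 'b::linorder) set"
  assumes Q: "finite Q"
    and extremal: "\<And>x y. (x, y) \<in> Q \<Longrightarrow> (\<forall>y'. (x, y') \<in> Q \<longrightarrow> y' \<le> y) \<or> (\<forall>x'. (x', y) \<in> Q \<longrightarrow> x \<le> x')"
  shows "card Q \<le> card (fst ` Q) + card (snd ` Q)"
proof -
  define R where "R = {(x, y) \<in> Q. \<forall>y'. (x, y') \<in> Q \<longrightarrow> y' \<le> y}"
  define L where "L = {(x, y) \<in> Q. \<forall>x'. (x', y) \<in> Q \<longrightarrow> x \<le> x'}"
  have "inj_on fst R" by (auto simp: R_def intro!: inj_onI order_antisym)
  then have "card R \<le> card (fst ` Q)"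
    using Q by (intro card_inj_on_le[of fst]) (auto simp: R_def)
  moreover have "inj_on snd L" by (auto simp: L_def intro!: inj_onI order_antisym)
  then have "card L \<le> card (snd ` Q)"
    using Q by (intro card_inj_on_le[of snd]) (auto simp: L_def)
  moreover have "card Q \<le> card R + card L"
  proof -
    have "Q = R \<union> L" using extremal by (auto simp: R_def L_def)
    then show ?thesis using card_Un_le[of R L] by simp
  qed
  ultimately show ?thesis by linarith
qed

text \<open>Inserting the vertices of \<open>C\<close> in the order of \<open>rank\<close>, the link of \<open>v\<close> contributes one class of
  rainbow edges for each \<open>c\<close> which is consecutive to \<open>v\<close>.\<close>

locale two_coloured_graph = coloured_graph E \<kappa> for E :: "'v \<Rightarrow> 'v \<Rightarrow> bool" and \<kappa> :: "'v \<Rightarrow> 'c" +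
  fixes A C :: "'v set" and i j :: 'c and rank :: "'v \<Rightarrow> nat"
  assumes finite_A: "finite A" and finite_C: "finite C"
    and colour_A: "a \<in> A \<Longrightarrow> \<kappa> a = i" and colour_C: "c \<in> C \<Longrightarrow> \<kappa> c = j" and colours_neq: "i \<noteq> j"
    and inj_on_rank: "inj_on rank C"
    and no_alternation: "a \<in> A \<Longrightarrow> b \<in> A \<Longrightarrow> E a b \<Longrightarrow> p \<in> C \<Longrightarrow> q \<in> C \<Longrightarrow> r \<in> C \<Longrightarrow>
      rank p < rank q \<Longrightarrow> rank q < rank r \<Longrightarrow>
      E a p \<Longrightarrow> \<not> E b p \<Longrightarrow> E b q \<Longrightarrow> \<not> E a q \<Longrightarrow> E a r \<Longrightarrow> \<not> E b r \<Longrightarrow> False"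
begin

definition consecutive :: "'v \<Rightarrow> 'v \<Rightarrow> bool" where
  "consecutive c v \<longleftrightarrow> c \<in> C \<and> v \<in> C \<and> rank c < rank v \<and> (\<exists>a\<in>A. E a c \<and> E a v) \<and>
     (\<forall>a\<in>A. \<forall>c'\<in>C. E a c \<longrightarrow> E a c' \<longrightarrow> E a v \<longrightarrow> \<not> (rank c < rank c' \<and> rank c' < rank v))"

definition lower_link :: "'v \<Rightarrow> 'v set set" where
  "lower_link v = clique_complex E {x \<in> A \<union> {c \<in> C. rank c < rank v}. E v x}"

definition lower_edges :: "'v \<Rightarrow> ('v \<times> 'v) set" where
  "lower_edges v = {(a, c) \<in> A \<times> C. E a c \<and> E a v \<and> rank c < rank v}"

lemma colours_A_C: "a \<in> A \<Longrightarrow> c \<in> C \<Longrightarrow> \<kappa> a \<noteq> \<kappa> c"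
  using colour_A colour_C colours_neq by auto

lemma adj_C: "c \<in> C \<Longrightarrow> c' \<in> C \<Longrightarrow> E a c \<Longrightarrow> E a c' \<Longrightarrow> E c c'"
  using common_neighbour[of a c c'] colour_C by simp

lemma adj_A: "a \<in> A \<Longrightarrow> a' \<in> A \<Longrightarrow> E a c \<Longrightarrow> E a' c \<Longrightarrow> E a a'"
  using common_neighbour[of c a a'] adj_sym colour_A by simp

lemma finite_complex_lower_link: "finite_complex (lower_link v)"
  unfolding lower_link_def using finite_A finite_C by (intro finite_complex_clique_complex) simp

lemma lower_edge_in_lower_link:
  assumes "v \<in> C" "(a, c) \<in> lower_edges v"
  shows "{a, c} \<in> lower_link v"
proof -
  have ac: "a \<in> A" "c \<in> C" "E a c" "E a v" "rank c < rank v"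
    using assms(2) by (auto simp: lower_edges_def)
  have "E v c" by (rule adj_C[OF assms(1) ac(2) ac(4,3)])
  then show ?thesis
    using ac adj_refl adj_sym[OF ac(3)] adj_sym[OF ac(4)]
    by (simp add: lower_link_def clique_complex_def)
qed

lemma rainbow_lower_link:
  assumes "\<tau> \<in> rainbow (lower_link v) \<kappa> 2"
  obtains a c where "(a, c) \<in> lower_edges v" "\<tau> = {a, c}"
proof -
  have \<tau>: "\<tau> \<in> lower_link v" "inj_on \<kappa> \<tau>" "card \<tau> = 2" using assms by (auto simp: rainbow_def)
  obtain x y where xy: "\<tau> = {x, y}" "x \<noteq> y" using \<tau>(3) unfolding card_2_iff by blast
  have adj: "E v x" "E v y" "E x y" "E y x"
    using \<tau>(1) xy(1) by (auto simp: lower_link_def clique_complex_def)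
  have mem: "x \<in> A \<or> x \<in> C \<and> rank x < rank v" "y \<in> A \<or> y \<in> C \<and> rank y < rank v"
    using \<tau>(1) xy(1) by (auto simp: lower_link_def clique_complex_def)
  have "\<kappa> x \<noteq> \<kappa> y" using \<tau>(2) xy by simp
  then consider (x_in_A) "x \<in> A" "y \<in> C" "rank y < rank v" | (y_in_A) "y \<in> A" "x \<in> C" "rank x < rank v"
    using mem colour_A colour_C by metis
  then show thesis
  proof cases
    case x_in_A
    then show thesis using that[of x y] adj adj_sym xy(1) by (simp add: lower_edges_def)
  next
    case y_in_A
    then show thesis using that[of y x] adj adj_sym xy(1)
      by (simp add: lower_edges_def insert_commute)
  qed
qed

lemma lower_edge_exchange:
  assumes "v \<in> C"
  shows "(a, c) \<in> lower_edges v \<Longrightarrow> (a', c) \<in> lower_edges v \<Longrightarrow>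
      ({a, c}, {a', c}) \<in> vertex_exchange (lower_link v) \<kappa>"
    and "(a, c) \<in> lower_edges v \<Longrightarrow> (a, c') \<in> lower_edges v \<Longrightarrow>
        ({a, c}, {a, c'}) \<in> vertex_exchange (lower_link v) \<kappa>"
proof -
  assume e: "(a, c) \<in> lower_edges v" "(a', c) \<in> lower_edges v"
  then have "a \<in> A" "a' \<in> A" "c \<in> C" by (auto simp: lower_edges_def)
  then show "({a, c}, {a', c}) \<in> vertex_exchange (lower_link v) \<kappa>"
    using e[THEN lower_edge_in_lower_link[OF assms]] colours_A_C[of a c] colour_A
    unfolding lower_link_def by (intro clique_vertex_exchange) auto
next
  assume e: "(a, c) \<in> lower_edges v" "(a, c') \<in> lower_edges v"
  then have "a \<in> A" "c \<in> C" "c' \<in> C" by (auto simp: lower_edges_def)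
  then have "({c, a}, {c', a}) \<in> vertex_exchange (lower_link v) \<kappa>"
    using e[THEN lower_edge_in_lower_link[OF assms]] colours_A_C[of a c] colour_C
    unfolding lower_link_def insert_commute[of a] by (intro clique_vertex_exchange) auto
  then show "({a, c}, {a, c'}) \<in> vertex_exchange (lower_link v) \<kappa>" by (simp add: insert_commute)
qed

lemma lower_edge_exchange_consecutive:
  assumes v: "v \<in> C" and "(a, c) \<in> lower_edges v"
  obtains a' c' where "consecutive c' v" "(a', c') \<in> lower_edges v"
    "({a, c}, {a', c'}) \<in> (vertex_exchange (lower_link v) \<kappa>)\<^sup>*"
proof -
  have "\<exists>a' c'. consecutive c' v \<and> (a', c') \<in> lower_edges v \<and> ({a, c}, {a', c'})
      \<in> (vertex_exchange (lower_link v) \<kappa>)\<^sup>*"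
    using assms(2)
  proof (induction "rank v - rank c" arbitrary: a c rule: less_induct)
    case less
    have ac: "a \<in> A" "c \<in> C" "E a c" "E a v" "rank c < rank v"
      using less.prems by (auto simp: lower_edges_def)
    show ?case
    proof (cases "consecutive c v")
      case True
      then show ?thesis using less.prems by blast
    next
      case False
      then obtain a' c' where between: "a' \<in> A" "c' \<in> C" "E a' c" "E a' c'" "E a' v" "rank c < rank c'"
        "rank c' < rank v"
        using ac v unfolding consecutive_def by blast
      then have edges: "(a', c) \<in> lower_edges v" "(a', c') \<in> lower_edges v"
        using ac by (auto simp: lower_edges_def)
      have "rank v - rank c' < rank v - rank c" using between(6,7) by linarith
      from less.hyps[OF this edges(2)] obtain a'' c''
        where IH: "consecutive c'' v" "(a'', c'') \<in> lower_edges v"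
        "({a', c'}, {a'', c''}) \<in> (vertex_exchange (lower_link v) \<kappa>)\<^sup>*" by blast
      have "({a, c}, {a', c}) \<in> vertex_exchange (lower_link v) \<kappa>"
        "({a', c}, {a', c'}) \<in> vertex_exchange (lower_link v) \<kappa>"
        using lower_edge_exchange[OF v] less.prems edges by blast+
      then have "({a, c}, {a'', c''}) \<in> (vertex_exchange (lower_link v) \<kappa>)\<^sup>*"
        using IH(3) by (meson converse_rtrancl_into_rtrancl)
      then show ?thesis using IH(1,2) by blast
    qed
  qed
  then show thesis using that by blast
qed

lemma finite_consecutive: "finite {c. consecutive c v}"
  by (rule finite_subset[OF _ finite_C]) (auto simp: consecutive_def)

lemma betti_2_lower_link_le:
  assumes v: "v \<in> C"
  shows "betti TYPE('k::field) 2 (lower_link v) \<le> card {c. consecutive c v}"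
proof -
  interpret finite_complex "lower_link v" by (rule finite_complex_lower_link)
  define F where "F = (\<lambda>c. {SOME a. (a, c) \<in> lower_edges v, c}) ` {c. consecutive c v}"
  have "betti TYPE('k) (Suc 1) (lower_link v)
      \<le> card F + betti TYPE('k) (Suc 1) (colour_skeleton (lower_link v) \<kappa> 1)"
  proof (rule betti_le_rainbow_plus_colour_skeleton)
    show "finite F" using finite_consecutive by (simp add: F_def)
    fix \<tau> assume "\<tau> \<in> rainbow (lower_link v) \<kappa> (Suc 1)"
    then obtain a c where "(a, c) \<in> lower_edges v" and \<tau>: "\<tau> = {a, c}"
      using rainbow_lower_link[of \<tau> v] by (auto simp: numeral_2_eq_2)
    then obtain a' c' where c': "consecutive c' v" and edge: "(a', c') \<in> lower_edges v"
      and path: "({a, c}, {a', c'}) \<in> (vertex_exchange (lower_link v) \<kappa>)\<^sup>*"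
      using lower_edge_exchange_consecutive[OF v] by metis
    define b where "b = (SOME b. (b, c') \<in> lower_edges v)"
    have "(b, c') \<in> lower_edges v" unfolding b_def using edge by (rule someI)
    then have "(\<tau>, {b, c'}) \<in> (vertex_exchange (lower_link v) \<kappa>)\<^sup>*"
      unfolding \<tau> using path lower_edge_exchange(1)[OF v edge] by (meson rtrancl_into_rtrancl)
    moreover have "{b, c'} \<in> F" unfolding F_def b_def using c' by blast
    ultimately show "\<exists>\<tau>'\<in>F. (\<tau>, \<tau>') \<in> (vertex_exchange (lower_link v) \<kappa>)\<^sup>*" by blast
  qed
  moreover have "betti TYPE('k) (Suc 1) (colour_skeleton (lower_link v) \<kappa> 1) = 0"
    using finite_A finite_C unfolding lower_link_def
    by (subst colour_skeleton_1_clique_complex) (simp_all add: betti_same_colour_eq_0)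
  moreover have "card F \<le> card {c. consecutive c v}"
    unfolding F_def by (rule card_image_le[OF finite_consecutive])
  ultimately show ?thesis by (simp add: numeral_2_eq_2)
qed

text \<open>Choosing common neighbours \<open>a\<close>, \<open>a'\<close>, \<open>b\<close> of the three pairs, either \<open>a'\<close>, \<open>b\<close> alternate on
  \<open>c' < c < v\<close> or \<open>b\<close>, \<open>a\<close> alternate on \<open>c' < v < w\<close>.\<close>

lemma not_consecutive_below_and_above:
  assumes cv: "consecutive c v" and c'v: "consecutive c' v" and cw: "consecutive c w"
    and less: "rank c' < rank c" "rank v < rank w"
  shows False
proof -
  have C: "c \<in> C" "c' \<in> C" "v \<in> C" "w \<in> C" "rank c < rank v"
    using cv c'v cw by (auto simp: consecutive_def)
  obtain a where a: "a \<in> A" "E a c" "E a v" using cv by (auto simp: consecutive_def)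
  obtain a' where a': "a' \<in> A" "E a' c'" "E a' v" using c'v by (auto simp: consecutive_def)
  obtain b where b: "b \<in> A" "E b c" "E b w" using cw by (auto simp: consecutive_def)
  have "\<not> E a w" "\<not> E b v"
    using cw a b C less by (auto simp: consecutive_def)
  have "\<not> E a c'" "\<not> E a' c"
    using c'v a a' C less by (auto simp: consecutive_def)
  have "E a b" by (rule adj_A[OF a(1) b(1) a(2) b(2)])
  have "E a a'" by (rule adj_A[OF a(1) a'(1) a(3) a'(3)])
  show False
  proof (cases "E b c'")
    case True
    show False
      by (rule no_alternation[of b a c' v w])
        (use True a b C less \<open>E a b\<close> \<open>\<not> E a w\<close> \<open>\<not> E b v\<close> \<open>\<not> E a c'\<close> in \<open>auto intro: adj_sym\<close>)
  next
    case False
    have "E a' b" using common_neighbour[OF \<open>E a a'\<close> \<open>E a b\<close>] colour_A a'(1) b(1) by simp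
    then show False
      by (intro no_alternation[of a' b c' c v])
        (use False a' b C less \<open>\<not> E b v\<close> \<open>\<not> E a' c\<close> in auto)
  qed
qed

lemma card_consecutive_le: "(\<Sum>v\<in>C. card {c. consecutive c v}) \<le> 2 * card C"
proof -
  define Q where "Q = {(c, v). consecutive c v}"
  define R where "R = map_prod rank rank ` Q"
  have Q: "Q \<subseteq> C \<times> C" by (auto simp: Q_def consecutive_def)
  then have "finite Q" using finite_C finite_subset by blast
  have rank_eq: "c = c'" if "rank c = rank c'" "c \<in> C" "c' \<in> C" for c c'
    using inj_onD[OF inj_on_rank that] .
  have "(\<Sum>v\<in>C. card {c. consecutive c v}) = card (SIGMA v:C. {c. consecutive c v})"
    using finite_C finite_consecutive by simp
  also have "(SIGMA v:C. {c. consecutive c v}) = prod.swap ` Q"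
    by (auto simp: Q_def image_iff consecutive_def)
  also have "card \<dots> = card Q" by (simp add: card_image)
  also have "\<dots> = card R"
    unfolding R_def using inj_on_subset[OF map_prod_inj_on[OF inj_on_rank inj_on_rank] Q]
    by (rule card_image[symmetric])
  also have "\<dots> \<le> card (fst ` R) + card (snd ` R)"
  proof (rule card_le_if_last_in_row_or_first_in_column)
    show "finite R" using \<open>finite Q\<close> by (simp add: R_def)
    fix x y assume "(x, y) \<in> R"
    then obtain c v where cv: "consecutive c v" "x = rank c" "y = rank v"
      by (auto simp: R_def Q_def)
    show "(\<forall>y'. (x, y') \<in> R \<longrightarrow> y' \<le> y) \<or> (\<forall>x'. (x', y) \<in> R \<longrightarrow> x \<le> x')"
    proof (rule ccontr)
      assume "\<not> ?thesis"
      then obtain w c' where "(x, w) \<in> R" "y < w" "(c', y) \<in> R" "c' < x" by (auto simp: not_le)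
      then obtain c\<^sub>1 w\<^sub>1 c\<^sub>2 v\<^sub>2 where extremes: "consecutive c\<^sub>1 w\<^sub>1" "rank c\<^sub>1 = rank c"
        "rank v < rank w\<^sub>1"
        "consecutive c\<^sub>2 v\<^sub>2" "rank v\<^sub>2 = rank v" "rank c\<^sub>2 < rank c"
        using cv by (auto simp: R_def Q_def)
      then have "c\<^sub>1 = c" "v\<^sub>2 = v"
        using rank_eq cv(1) by (auto simp: consecutive_def)
      then show False using not_consecutive_below_and_above[OF cv(1), of c\<^sub>2 w\<^sub>1] extremes by simp
    qed
  qed
  also have "\<dots> \<le> card (rank ` C) + card (rank ` C)"
    using finite_C Q by (intro add_mono card_mono) (auto simp: R_def)
  also have "\<dots> = 2 * card C" by (simp add: card_image[OF inj_on_rank])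
  finally show ?thesis .
qed

lemma betti_3_two_colours_le: "betti TYPE('k::field) 3 (clique_complex E (A \<union> C)) \<le> 2 * card C"
proof -
  have "betti TYPE('k) (Suc 2) (clique_complex E (A \<union> C)) \<le> (\<Sum>v\<in>C. card {c. consecutive c v})"
  proof (rule betti_clique_le_by_insertion[where \<Phi> = "\<lambda>U. \<Sum>v\<in>U. card {c. consecutive c v}",
        OF finite_A finite_C])
    have "betti TYPE('k) (Suc (Suc 1)) (clique_complex E A) = 0"
    proof (rule betti_clique_transitive[OF finite_A])
      fix x y z assume "x \<in> A" "z \<in> A" "E x y" "E y z"
      then show "E x z" using adj_A[of x z y] adj_sym by blast
    qed
    then show "betti TYPE('k) (Suc 2) (clique_complex E A) \<le> (\<Sum>v\<in>{}. card {c. consecutive c v})"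
      by (simp add: numeral_2_eq_2)
  next
    fix v U assume v: "v \<in> C" "U \<subseteq> C" "v \<notin> U"
      and below: "\<And>u. u \<in> U \<Longrightarrow> rank u \<le> rank v" and above: "\<And>w. w \<in> C - U \<Longrightarrow> rank v \<le> rank w"
    have "rank u \<noteq> rank v" if "u \<in> U" for u
      using inj_onD[OF inj_on_rank, of u v] that v by blast
    then have "U = {c \<in> C. rank c < rank v}"
      using v(2) below above by (force simp: less_le)
    then have "clique_complex E {x \<in> A \<union> U. E v x} = lower_link v" by (simp add: lower_link_def)
    then show "(\<Sum>v\<in>U. card {c. consecutive c v}) + betti TYPE('k) 2 (clique_complex E {x \<in> A
        \<union> U. E v x})
        \<le> (\<Sum>v\<in>insert v U. card {c. consecutive c v})"
      using betti_2_lower_link_le[OF v(1), where 'k = 'k] finite_subset[OF v(2) finite_C] v(3)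
      by simp
  qed
  also have "\<dots> \<le> 2 * card C" by (rule card_consecutive_le)
  finally show ?thesis by simp
qed

end

section \<open>Hitting sets and the Sauer--Shelah lemma\<close>

lemma exists_element_in_many:
  fixes \<epsilon> :: real
  assumes S: "finite S" "S \<noteq> {}" and \<G>: "finite \<G>" "\<And>F. F \<in> \<G> \<Longrightarrow> F \<subseteq> S \<and> \<epsilon> * card S \<le> card F"
  obtains x where "x \<in> S" "\<epsilon> * card \<G> \<le> card {F \<in> \<G>. x \<in> F}"
proof -
  have "\<not> (\<forall>x\<in>S. card {F \<in> \<G>. x \<in> F} < \<epsilon> * card \<G>)"
  proof
    assume rare: "\<forall>x\<in>S. card {F \<in> \<G>. x \<in> F} < \<epsilon> * card \<G>"
    have "{x \<in> S. x \<in> F} = F" if "F \<in> \<G>" for F using \<G>(2)[OF that] by auto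
    then have "(\<Sum>x\<in>S. card {F \<in> \<G>. x \<in> F}) = (\<Sum>F\<in>\<G>. card F)"
      using S(1) \<G>(1) by (intro sum_multicount_gen) auto
    moreover have "(\<Sum>x\<in>S. real (card {F \<in> \<G>. x \<in> F})) < (\<Sum>x\<in>S. \<epsilon> * card \<G>)"
      using rare S by (intro sum_strict_mono) auto
    moreover have "(\<Sum>F\<in>\<G>. \<epsilon> * card S) \<le> (\<Sum>F\<in>\<G>. real (card F))"
      using \<G>(2) by (intro sum_mono) auto
    ultimately show False by (simp add: mult.commute mult.left_commute flip: of_nat_sum)
  qed
  then show thesis using that by (auto simp: not_less)
qed

lemma greedy_hitting_set:
  fixes \<epsilon> :: real
  assumes S: "finite S" "S \<noteq> {}" and \<F>: "finite \<F>" "\<And>F. F \<in> \<F> \<Longrightarrow> F \<subseteq> S \<and> \<epsilon> * card S \<le> card F"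
    and \<epsilon>: "\<epsilon> \<le> 1"
  shows "\<exists>T\<subseteq>S. card T \<le> s \<and> card {F \<in> \<F>. F \<inter> T = {}} \<le> (1 - \<epsilon>) ^ s * card \<F>"
proof (induction s)
  case 0
  show ?case by (intro exI[of _ "{}"]) simp
next
  case (Suc s)
  then obtain T where T: "T \<subseteq> S" "card T \<le> s" "card {F \<in> \<F>. F \<inter> T = {}} \<le> (1 - \<epsilon>) ^ s * card \<F>"
    by blast
  define \<G> where "\<G> = {F \<in> \<F>. F \<inter> T = {}}"
  have "finite \<G>" using \<F>(1) by (simp add: \<G>_def)
  then obtain x where x: "x \<in> S" "\<epsilon> * card \<G> \<le> card {F \<in> \<G>. x \<in> F}"
    using exists_element_in_many[OF S, of \<G> \<epsilon>] \<F>(2) by (auto simp: \<G>_def)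
  have "{F \<in> \<F>. F \<inter> insert x T = {}} = \<G> - {F \<in> \<G>. x \<in> F}" by (auto simp: \<G>_def)
  then have "real (card {F \<in> \<F>. F \<inter> insert x T = {}}) = real (card \<G>) - card {F \<in> \<G>. x \<in> F}"
    using \<open>finite \<G>\<close> card_mono[of \<G> "{F \<in> \<G>. x \<in> F}"] by (simp add: card_Diff_subset of_nat_diff)
  also have "\<dots> \<le> (1 - \<epsilon>) * card \<G>" using x(2) by (simp add: algebra_simps)
  also have "\<dots> \<le> (1 - \<epsilon>) * ((1 - \<epsilon>) ^ s * card \<F>)"
    using T(3) \<epsilon> by (intro mult_left_mono) (auto simp: \<G>_def)
  finally have "card {F \<in> \<F>. F \<inter> insert x T = {}} \<le> (1 - \<epsilon>) ^ Suc s * card \<F>"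
    by (simp add: mult.assoc)
  moreover have "card (insert x T) \<le> Suc s" using T(2) card_insert_le_m1[of "Suc s" T x] by simp
  ultimately show ?case using T(1) x(1) by (intro exI[of _ "insert x T"]) auto
qed

definition shatters :: "'a set set \<Rightarrow> 'a set \<Rightarrow> bool" where
  "shatters \<F> Y \<longleftrightarrow> (\<forall>Z\<subseteq>Y. \<exists>F\<in>\<F>. F \<inter> Y = Z)"

lemma shattersE:
  assumes "shatters \<F> Y" "Z \<subseteq> Y"
  obtains F where "F \<in> \<F>" "F \<inter> Y = Z"
  using assms unfolding shatters_def by blast

lemma shatters_mono: "shatters \<F> Y \<Longrightarrow> \<F> \<subseteq> \<G> \<Longrightarrow> shatters \<G> Y"
  unfolding shatters_def by blast

lemma shatters_subset: "shatters \<F> Y \<Longrightarrow> \<F> \<subseteq> Pow X \<Longrightarrow> Y \<subseteq> X"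
  by (elim shattersE[OF _ order_refl]) blast

lemma shatters_remove_iff:
  assumes "x \<notin> Y"
  shows "shatters ((\<lambda>F. F - {x}) ` \<F>) Y \<longleftrightarrow> shatters \<F> Y"
proof -
  have "(F - {x}) \<inter> Y = F \<inter> Y" for F using assms by blast
  then show ?thesis by (simp add: shatters_def)
qed

lemma shatters_insert:
  assumes "shatters {F \<in> \<F>. x \<notin> F} Y" "shatters {F \<in> \<F>. x \<in> F} Y" "x \<notin> Y"
  shows "shatters \<F> (insert x Y)"
  unfolding shatters_def
proof (intro allI impI)
  fix Z assume Z: "Z \<subseteq> insert x Y"
  show "\<exists>F\<in>\<F>. F \<inter> insert x Y = Z"
  proof (cases "x \<in> Z")
    case True
    then obtain F where "F \<in> {F \<in> \<F>. x \<in> F}" "F \<inter> Y = Z - {x}"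
      using Z shattersE[OF assms(2), of "Z - {x}"] by blast
    then show ?thesis using True by (intro bexI[of _ F]) auto
  next
    case False
    then obtain F where "F \<in> {F \<in> \<F>. x \<notin> F}" "F \<inter> Y = Z"
      using Z shattersE[OF assms(1), of Z] by blast
    then show ?thesis by (intro bexI[of _ F]) auto
  qed
qed

lemma card_add_card_eq_card_Un_insert_image:
  assumes fin: "finite A" "finite B" and notin: "\<And>Y. Y \<in> A \<union> B \<Longrightarrow> x \<notin> Y"
  shows "card A + card B = card (A \<union> B \<union> insert x ` (A \<inter> B))"
proof -
  have "card A + card B = card (A \<union> B) + card (A \<inter> B)" by (rule card_Un_Int[OF fin])
  also have "card (A \<inter> B) = card (insert x ` (A \<inter> B))"
    using notin
    by (intro card_image[symmetric] inj_onI) (auto dest: insert_ident[THEN iffD1, rotated 2])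
  also have "card (A \<union> B) + \<dots> = card (A \<union> B \<union> insert x ` (A \<inter> B))"
    using fin notin by (intro card_Un_disjoint[symmetric]) auto
  finally show ?thesis .
qed

lemma card_le_card_shattered:
  assumes "finite X" "\<F> \<subseteq> Pow X"
  shows "card \<F> \<le> card {Y. shatters \<F> Y}"
  using assms
proof (induction X arbitrary: \<F> rule: finite_induct)
  case empty
  then have "\<F> = {} \<or> \<F> = {{}}" by auto
  then show ?case
  proof
    assume "\<F> = {{}}"
    then have "{Y. shatters \<F> Y} = {{}}" by (auto simp: shatters_def)
    then show ?thesis using \<open>\<F> = {{}}\<close> by simp
  qed simp
next
  case (insert x X)
  define \<F>\<^sub>0 \<F>\<^sub>1 where "\<F>\<^sub>0 = {F \<in> \<F>. x \<notin> F}" and "\<F>\<^sub>1 = (\<lambda>F. F - {x}) ` {F \<in> \<F>. x \<in> F}"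
  let ?S\<^sub>0 = "{Y. shatters \<F>\<^sub>0 Y}" and ?S\<^sub>1 = "{Y. shatters \<F>\<^sub>1 Y}"
  have fin: "finite {Y. shatters \<G> Y}" if "\<G> \<subseteq> Pow (insert x X)" for \<G>
  proof (rule finite_subset)
    show "{Y. shatters \<G> Y} \<subseteq> Pow (insert x X)" using shatters_subset[OF _ that] by blast
  qed (use insert.hyps(1) in simp)
  have sub: "\<F>\<^sub>0 \<subseteq> Pow X" "\<F>\<^sub>1 \<subseteq> Pow X" using insert.prems by (auto simp: \<F>\<^sub>0_def \<F>\<^sub>1_def)
  then have finite_S: "finite ?S\<^sub>0" "finite ?S\<^sub>1" by (auto intro!: fin)
  have notin: "x \<notin> Y" if "Y \<in> ?S\<^sub>0 \<union> ?S\<^sub>1" for Y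
    using that sub insert.hyps(2) shatters_subset by blast
  have "card \<F> = card \<F>\<^sub>0 + card {F \<in> \<F>. x \<in> F}"
    using insert.prems insert.hyps(1) finite_subset[of \<F> "Pow (insert x X)"]
    by (subst card_Un_disjoint[symmetric]) (auto simp: \<F>\<^sub>0_def intro: arg_cong[of _ _ card])
  also have "card {F \<in> \<F>. x \<in> F} = card \<F>\<^sub>1"
    unfolding \<F>\<^sub>1_def by (rule card_image[symmetric]) (auto simp: inj_on_def)
  also have "card \<F>\<^sub>0 + card \<F>\<^sub>1 \<le> card ?S\<^sub>0 + card ?S\<^sub>1"
    using sub by (intro add_mono insert.IH)
  also have "\<dots> = card (?S\<^sub>0 \<union> ?S\<^sub>1 \<union> insert x ` (?S\<^sub>0 \<inter> ?S\<^sub>1))"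
    using finite_S notin by (rule card_add_card_eq_card_Un_insert_image)
  also have "\<dots> \<le> card {Y. shatters \<F> Y}"
  proof (rule card_mono[OF fin[OF insert.prems]], rule subsetI)
    fix Y assume "Y \<in> ?S\<^sub>0 \<union> ?S\<^sub>1 \<union> insert x ` (?S\<^sub>0 \<inter> ?S\<^sub>1)"
    then consider "shatters \<F>\<^sub>0 Y" | "shatters \<F>\<^sub>1 Y" "x \<notin> Y"
      | Y' where "shatters \<F>\<^sub>0 Y'" "shatters \<F>\<^sub>1 Y'" "x \<notin> Y'" "Y = insert x Y'"
      using notin by blast
    then have "shatters \<F> Y"
      unfolding \<F>\<^sub>0_def \<F>\<^sub>1_def
      by cases (auto simp: shatters_remove_iff intro: shatters_mono shatters_insert)
    then show "Y \<in> {Y. shatters \<F> Y}" by simp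
  qed
  finally show ?case .
qed

lemma convex_closer:
  fixes a b :: "'a::real_inner"
  shows "convex {x. dist x a < dist x b}"
proof -
  have "dist x a < dist x b \<longleftrightarrow> (2 *\<^sub>R (b - a)) \<bullet> x < b \<bullet> b - a \<bullet> a" for x
  proof -
    have "dist x a < dist x b \<longleftrightarrow> (dist x a)\<^sup>2 < (dist x b)\<^sup>2"
      by (simp add: power_mono_iff flip: not_le)
    then show ?thesis
      by (simp add: dist_norm power2_norm_eq_inner inner_diff inner_commute algebra_simps)
  qed
  then show ?thesis by (simp only: convex_halfspace_lt)
qed

lemma card_shattered_by_balls:
  fixes Y :: "'a::euclidean_space set"
  assumes shattered: "shatters ((\<lambda>a. T \<inter> cball a r) ` A) Y" and Y: "finite Y" "Y \<subseteq> T"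
  shows "card Y \<le> DIM('a) + 1"
proof (rule ccontr)
  assume "\<not> ?thesis"
  then have "affine_dependent Y" using affine_dependent_biggerset[OF Y(1)] by simp
  from Radon[OF this] obtain M P where MP: "M \<subseteq> Y" "P \<subseteq> Y" "M \<inter> P = {}"
    "convex hull M \<inter> convex hull P \<noteq> {}" .
  obtain a where a: "T \<inter> cball a r \<inter> Y = M" using shattersE[OF shattered MP(1)] by auto
  obtain b where b: "T \<inter> cball b r \<inter> Y = P" using shattersE[OF shattered MP(2)] by auto
  have "M \<subseteq> cball a r - cball b r" "P \<subseteq> cball b r - cball a r" using a b MP(1-3) Y(2) by blast+
  then have "M \<subseteq> {x. dist x a < dist x b}" "P \<subseteq> {x. dist x b < dist x a}"
    by (auto simp: dist_commute)
  then have "convex hull M \<subseteq> {x. dist x a < dist x b}" "convex hull P \<subseteq> {x. dist x b < dist x a}"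
    by (simp_all add: hull_minimal convex_closer)
  then show False using MP(4) by fastforce
qed

lemma card_small_subsets_le:
  assumes "finite T"
  shows "card {Y. Y \<subseteq> T \<and> card Y \<le> k} \<le> (k + 1) * (card T + 1) ^ k"
proof -
  have "{Y. Y \<subseteq> T \<and> card Y \<le> k} = (\<Union>i\<le>k. {Y. Y \<subseteq> T \<and> card Y = i})" by auto
  then have "card {Y. Y \<subseteq> T \<and> card Y \<le> k} \<le> (\<Sum>i\<le>k. card {Y. Y \<subseteq> T \<and> card Y = i})"
    using card_UN_le[of "{..k}" "\<lambda>i. {Y. Y \<subseteq> T \<and> card Y = i}"] by simp
  also have "\<dots> \<le> (\<Sum>i\<le>k. (card T + 1) ^ k)"
  proof (rule sum_mono)
    fix i assume i: "i \<in> {..k}"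
    have "card {Y. Y \<subseteq> T \<and> card Y = i} = card T choose i" by (rule n_subsets[OF assms])
    also have "\<dots> \<le> card T ^ i" by (cases "i \<le> card T") (auto simp: binomial_le_pow binomial_eq_0)
    also have "\<dots> \<le> (card T + 1) ^ i" by (intro power_mono) auto
    also have "\<dots> \<le> (card T + 1) ^ k" using i by (intro power_increasing) auto
    finally show "card {Y. Y \<subseteq> T \<and> card Y = i} \<le> (card T + 1) ^ k" .
  qed
  finally show ?thesis by simp
qed

lemma card_ball_traces_le:
  fixes T :: "'a::euclidean_space set"
  assumes "finite T"
  shows "card ((\<lambda>a. T \<inter> cball a r) ` A) \<le> (DIM('a) + 2) * (card T + 1) ^ (DIM('a) + 1)"
proof -
  let ?F = "(\<lambda>a. T \<inter> cball a r) ` A"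
  have "card ?F \<le> card {Y. shatters ?F Y}" by (rule card_le_card_shattered[OF assms]) auto
  also have "\<dots> \<le> card {Y. Y \<subseteq> T \<and> card Y \<le> DIM('a) + 1}"
  proof (rule card_mono)
    have "Y \<subseteq> T \<and> card Y \<le> DIM('a) + 1" if Y: "shatters ?F Y" for Y
    proof -
      have "Y \<subseteq> T" by (rule shatters_subset[OF Y]) auto
      then show ?thesis using card_shattered_by_balls[OF Y] finite_subset[OF _ assms] by blast
    qed
    then show "{Y. shatters ?F Y} \<subseteq> {Y. Y \<subseteq> T \<and> card Y \<le> DIM('a) + 1}" by blast
  qed (use assms in simp)
  also have "\<dots> \<le> (DIM('a) + 1 + 1) * (card T + 1) ^ (DIM('a) + 1)"
    by (rule card_small_subsets_le[OF assms])
  finally show ?thesis by simp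
qed

lemma separating_sample_exists:
  fixes S :: "'a::metric_space set" and \<epsilon> :: real
  assumes S: "finite S" and \<epsilon>: "0 < \<epsilon>" "\<epsilon> \<le> 1" and s: "(1 - \<epsilon>) ^ s * (card S)\<^sup>2 < 1"
  obtains T where "T \<subseteq> S" "card T \<le> s"
    "\<And>v w. v \<in> S \<Longrightarrow> w \<in> S \<Longrightarrow> T \<inter> cball v r = T \<inter> cball w r \<Longrightarrow>
        card (S \<inter> cball v r - cball w r) \<le> \<epsilon> * card S"
proof (cases "S = {}")
  case True
  then show thesis using that[of "{}"] by simp
next
  case False
  let ?d = "\<lambda>(v, w). S \<inter> cball v r - cball w r"
  define \<F> where "\<F> = {F \<in> ?d ` (S \<times> S). \<epsilon> * card S < card F}"
  have "finite \<F>" using S by (simp add: \<F>_def)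
  moreover have "F \<subseteq> S \<and> \<epsilon> * card S \<le> card F" if "F \<in> \<F>" for F
    using that by (auto simp: \<F>_def)
  ultimately obtain T where T: "T \<subseteq> S" "card T \<le> s"
    "card {F \<in> \<F>. F \<inter> T = {}} \<le> (1 - \<epsilon>) ^ s * card \<F>"
    using greedy_hitting_set[OF S False _ _ \<epsilon>(2), of \<F> s] by blast
  have "card \<F> \<le> card (?d ` (S \<times> S))" using S by (intro card_mono) (auto simp: \<F>_def)
  also have "\<dots> \<le> (card S)\<^sup>2"
    using card_image_le[of "S \<times> S" ?d] S by (simp add: card_cartesian_product power2_eq_square)
  finally have "(1 - \<epsilon>) ^ s * card \<F> \<le> (1 - \<epsilon>) ^ s * real ((card S)\<^sup>2)"
    using \<epsilon> by (intro mult_left_mono) auto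
  then have "card {F \<in> \<F>. F \<inter> T = {}} = 0" using T(3) s by simp
  then have hit: "F \<inter> T \<noteq> {}" if "F \<in> \<F>" for F using that \<open>finite \<F>\<close> by auto
  show thesis
  proof (rule that[OF T(1,2)], rule ccontr)
    fix v w assume vw: "v \<in> S" "w \<in> S" "T \<inter> cball v r = T \<inter> cball w r"
      and "\<not> card (S \<inter> cball v r - cball w r) \<le> \<epsilon> * card S"
    then have "?d (v, w) \<in> \<F>" by (auto simp: \<F>_def)
    from hit[OF this] show False using vw(3) by auto
  qed
qed

lemma exp_sample_size:
  fixes \<epsilon> :: real
  assumes "0 < \<epsilon>" "\<epsilon> \<le> 1" "n > 0"
  shows "(1 - \<epsilon>) ^ (nat \<lceil>2 * ln (real n) / \<epsilon>\<rceil> + 1) * (real n)\<^sup>2 < 1"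
proof -
  define s where "s = nat \<lceil>2 * ln (real n) / \<epsilon>\<rceil> + 1"
  have "2 * ln (real n) / \<epsilon> < real s" unfolding s_def by linarith
  then have "- \<epsilon> * s + 2 * ln (real n) < 0" using assms(1) by (simp add: field_simps)
  have "(1 - \<epsilon>) ^ s \<le> exp (- \<epsilon>) ^ s"
    using assms exp_ge_add_one_self[of "- \<epsilon>"] by (intro power_mono) auto
  also have "\<dots> = exp (- \<epsilon> * s)" by (simp add: exp_of_nat_mult[symmetric] mult.commute)
  finally have "(1 - \<epsilon>) ^ s * (real n)\<^sup>2 \<le> exp (- \<epsilon> * s) * (real n)\<^sup>2"
    by (intro mult_right_mono) auto
  also have "\<dots> = exp (- \<epsilon> * s + 2 * ln (real n))" using assms(3) unfolding exp_add
    by (simp add: exp_double)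
  also have "\<dots> < 1" using \<open>- \<epsilon> * s + 2 * ln (real n) < 0\<close> by simp
  finally show ?thesis unfolding s_def .
qed

lemma logarithmic_separating_sample_exists:
  fixes S :: "'a::metric_space set" and \<epsilon> :: real
  assumes S: "finite S" "card S \<le> n" "n > 0" and \<epsilon>: "0 < \<epsilon>" "\<epsilon> \<le> 1"
  obtains T where "T \<subseteq> S" "card T + 1 \<le> 2 / \<epsilon> * ln n + 3"
    "\<And>v w. v \<in> S \<Longrightarrow> w \<in> S \<Longrightarrow> T \<inter> cball v r = T \<inter> cball w r \<Longrightarrow> card (S \<inter> cball v r - cball w r) \<le> \<epsilon> * n"
proof -
  define s where "s = nat \<lceil>2 * ln (real n) / \<epsilon>\<rceil> + 1"
  have "(1 - \<epsilon>) ^ s * (card S)\<^sup>2 \<le> (1 - \<epsilon>) ^ s * (real n)\<^sup>2"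
    using S(2) \<epsilon> by (intro mult_left_mono) (simp_all add: power_mono)
  also have "\<dots> < 1" unfolding s_def by (rule exp_sample_size[OF \<epsilon> S(3)])
  finally obtain T where T: "T \<subseteq> S" "card T \<le> s" and separating: "\<And>v w. v \<in> S \<Longrightarrow> w \<in> S \<Longrightarrow>
      T \<inter> cball v r = T \<inter> cball w r \<Longrightarrow> card (S \<inter> cball v r - cball w r) \<le> \<epsilon> * card S"
    using separating_sample_exists[OF S(1) \<epsilon>, of s r] by blast
  show thesis
  proof (rule that[OF T(1)])
    have "0 \<le> 2 * ln (real n) / \<epsilon>" using S(3) \<epsilon>(1) by simp
    then show "card T + 1 \<le> 2 / \<epsilon> * ln n + 3" using T(2) unfolding s_def by simp linarith
    fix v w assume "v \<in> S" "w \<in> S" "T \<inter> cball v r = T \<inter> cball w r"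
    then have "card (S \<inter> cball v r - cball w r) \<le> \<epsilon> * card S" by (rule separating)
    also have "\<dots> \<le> \<epsilon> * n" using S(2) \<epsilon>(1) by (intro mult_left_mono) simp_all
    finally show "card (S \<inter> cball v r - cball w r) \<le> \<epsilon> * n" .
  qed
qed

section \<open>Displacement colourings\<close>

lemma grid_displacement_close:
  fixes x y x' y' N r :: real
  assumes N: "N > 0" and M: "2 * N * r + 2 \<le> of_int M"
    and cells: "\<lfloor>N * x\<rfloor> mod M = \<lfloor>N * x'\<rfloor> mod M" "\<lfloor>N * y\<rfloor> mod M = \<lfloor>N * y'\<rfloor> mod M"
    and near: "\<bar>y - x\<bar> \<le> r" "\<bar>y' - x'\<bar> \<le> r"
  shows "\<bar>(y - x) - (y' - x')\<bar> \<le> 2 / N"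
proof -
  have scaled: "\<bar>N * v - N * u\<bar> \<le> N * r" if "\<bar>v - u\<bar> \<le> r" for u v
    using that N by (simp add: abs_mult flip: right_diff_distrib)
  define p q where "p = \<lfloor>N * y\<rfloor> - \<lfloor>N * x\<rfloor>" and "q = \<lfloor>N * y'\<rfloor> - \<lfloor>N * x'\<rfloor>"
  have "\<bar>of_int p - of_int q\<bar> < real_of_int M"
    using scaled[OF near(1)] scaled[OF near(2)] M unfolding p_def q_def of_int_diff by linarith
  then have "\<bar>p - q\<bar> < M" by linarith
  moreover have "M dvd p - q"
    using cells unfolding p_def q_def by (intro mod_eq_dvd_iff[THEN iffD1] mod_diff_cong) auto
  ultimately have "p = q" using dvd_imp_le_int[of "p - q" M] by force
  then have "real_of_int \<lfloor>N * y\<rfloor> - of_int \<lfloor>N * x\<rfloor> = of_int \<lfloor>N * y'\<rfloor> - of_int \<lfloor>N * x'\<rfloor>"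
    unfolding p_def q_def by linarith
  then have "\<bar>(N * y - N * x) - (N * y' - N * x')\<bar> \<le> 2" by linarith
  then have "N * \<bar>(y - x) - (y' - x')\<bar> \<le> 2"
    using N by (simp add: abs_mult flip: right_diff_distrib)
  then show ?thesis using N by (simp add: pos_le_divide_eq mult.commute)
qed

abbreviation rips_adj :: "'a::metric_space \<Rightarrow> 'a \<Rightarrow> bool" where
  "rips_adj x y \<equiv> dist x y \<le> 1"

interpretation rips: reflexive_graph "rips_adj :: 'a::metric_space \<Rightarrow> 'a \<Rightarrow> bool"
  by unfold_locales (auto simp: dist_commute)

text \<open>The radius \<open>3\<close> covers all pairs joined by a path of three edges of length at most \<open>1\<close>.\<close>

locale displacement_colouring =
  fixes \<kappa> :: "'a::real_normed_vector \<Rightarrow> 'c" and \<eta> :: real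
  assumes finite_range: "finite (range \<kappa>)" and precision_le_1: "\<eta> \<le> 1"
    and displacement_near: "\<kappa> a = \<kappa> a' \<Longrightarrow> \<kappa> c = \<kappa> c' \<Longrightarrow> dist a c \<le> 3 \<Longrightarrow> dist a' c' \<le> 3 \<Longrightarrow>
      dist (c - a) (c' - a') \<le> \<eta>"
begin

lemma same_colour_near:
  assumes "\<kappa> x = \<kappa> y" "dist z x \<le> 1" "dist z y \<le> 1"
  shows "dist x y \<le> \<eta>"
proof -
  have "dist x y \<le> 3" using assms(2,3) dist_triangle[of x y z] by (simp add: dist_commute)
  then have "dist (x - x) (y - x) \<le> \<eta>" using assms(1) by (intro displacement_near) simp_all
  then show ?thesis by (simp add: dist_norm norm_minus_commute)
qed

sublocale coloured_graph rips_adj \<kappa>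
  using finite_range same_colour_near precision_le_1 by unfold_locales force+

end

lemma displacement_colouring_exists:
  fixes \<eta> :: real
  assumes "0 < \<eta>" "\<eta> \<le> 1"
  obtains \<kappa> :: "real ^ 'n \<Rightarrow> 'n \<Rightarrow> int" where "displacement_colouring \<kappa> \<eta>"
proof -
  define N where "N = 2 * real CARD('n) / \<eta>"
  define M where "M = \<lceil>2 * N * 3 + 2\<rceil>"
  define \<kappa> :: "real ^ 'n \<Rightarrow> 'n \<Rightarrow> int" where "\<kappa> x i = \<lfloor>N * x $ i\<rfloor> mod M" for x i
  have N: "N > 0" using assms(1) by (simp add: N_def)
  then have M: "2 * N * 3 + 2 \<le> of_int M" "M > 0" unfolding M_def by linarith+
  have "displacement_colouring \<kappa> \<eta>"
  proof
    have "range \<kappa> \<subseteq> UNIV \<rightarrow>\<^sub>E {0..<M}" using M(2) by (auto simp: \<kappa>_def)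
    then show "finite (range \<kappa>)" by (rule finite_subset) (intro finite_PiE; simp)
    fix a a' c c' assume pairs: "\<kappa> a = \<kappa> a'" "\<kappa> c = \<kappa> c'" "dist a c \<le> 3" "dist a' c' \<le> 3"
    have "\<bar>((c - a) - (c' - a')) $ i\<bar> \<le> 2 / N" for i
    proof -
      have "\<bar>c $ i - a $ i\<bar> \<le> 3" "\<bar>c' $ i - a' $ i\<bar> \<le> 3"
        using component_le_norm_cart[of "c - a" i] component_le_norm_cart[of "c' - a'" i] pairs(3,4)
        by (simp_all add: dist_norm norm_minus_commute)
      then show ?thesis
        using grid_displacement_close[OF N M(1), of "a $ i" "a' $ i" "c $ i" "c' $ i"]
          fun_cong[OF pairs(1), of i] fun_cong[OF pairs(2), of i] by (simp add: \<kappa>_def)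
    qed
    then have "dist (c - a) (c' - a') \<le> (\<Sum>i\<in>(UNIV :: 'n set). 2 / N)"
      unfolding dist_norm by (intro order_trans[OF norm_le_l1_cart] sum_mono)
    then show "dist (c - a) (c' - a') \<le> \<eta>" using assms(1) by (simp add: N_def)
  qed (rule assms(2))
  then show thesis by (rule that)
qed

section \<open>Rips complexes in dimension d\<close>

lemma card_classes_le:
  fixes T :: "'a::euclidean_space set"
  assumes "finite (range \<kappa>)" "finite T"
  shows "card ((\<lambda>v. (\<kappa> v, T \<inter> cball v r)) ` S)
      \<le> card (range \<kappa>) * ((DIM('a) + 2) * (card T + 1) ^ (DIM('a) + 1))"
proof -
  let ?traces = "(\<lambda>v. T \<inter> cball v r) ` S"
  have "finite ?traces" by (rule finite_subset[of _ "Pow T"]) (use assms(2) in auto)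
  then have "card ((\<lambda>v. (\<kappa> v, T \<inter> cball v r)) ` S) \<le> card (range \<kappa> \<times> ?traces)"
    using assms(1) by (intro card_mono) auto
  also have "\<dots> \<le> card (range \<kappa>) * ((DIM('a) + 2) * (card T + 1) ^ (DIM('a) + 1))"
    unfolding card_cartesian_product by (intro mult_left_mono card_ball_traces_le assms(2)) simp
  finally show ?thesis .
qed

lemma betti_3_rips_le:
  fixes S :: "'a::euclidean_space set" and \<kappa> :: "'a \<Rightarrow> 'c" and \<epsilon> :: real
  assumes \<kappa>: "displacement_colouring \<kappa> \<eta>" and S: "finite S" "card S \<le> n" "n > 0"
    and \<epsilon>: "0 < \<epsilon>" "\<epsilon> \<le> 1"
  defines "K \<equiv> card (range \<kappa>)"
  shows "betti TYPE('k::field) 3 (clique_complex rips_adj S)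
    \<le> K * (\<epsilon> * n + K * ((DIM('a) + 2) * (2 / \<epsilon> * ln n + 3) ^ (DIM('a) + 1))) * n"
proof -
  interpret displacement_colouring \<kappa> \<eta> by (rule \<kappa>)
  obtain T where T: "T \<subseteq> S" "card T + 1 \<le> 2 / \<epsilon> * ln n + 3" and separating: "\<And>v w. v \<in> S \<Longrightarrow> w \<in> S \<Longrightarrow>
      T \<inter> cball v 1 = T \<inter> cball w 1 \<Longrightarrow> card (S \<inter> cball v 1 - cball w 1) \<le> \<epsilon> * n"
    using logarithmic_separating_sample_exists[OF S \<epsilon>, of 1] by blast
  let ?\<theta> = "\<lambda>v. (\<kappa> v, T \<inter> cball v 1)"
  have "card {x \<in> S. rips_adj v x \<and> \<not> rips_adj w x} \<le> nat \<lfloor>\<epsilon> * n\<rfloor>"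
    if "v \<in> S" "w \<in> S" "?\<theta> v = ?\<theta> w" for v w
  proof (rule le_nat_floor)
    have "{x \<in> S. rips_adj v x \<and> \<not> rips_adj w x} = S \<inter> cball v 1 - cball w 1" by auto
    then show "card {x \<in> S. rips_adj v x \<and> \<not> rips_adj w x} \<le> \<epsilon> * n"
      using separating[of v w] that by simp
  qed
  then have "betti TYPE('k) 3 (clique_complex rips_adj S)
      \<le> K * (nat \<lfloor>\<epsilon> * n\<rfloor> + card (?\<theta> ` S)) * card S"
    unfolding K_def by (intro betti_3_le_classes[where \<theta> = ?\<theta>] S(1)) simp
  then have "real (betti TYPE('k) 3 (clique_complex rips_adj S))
      \<le> real (K * (nat \<lfloor>\<epsilon> * n\<rfloor> + card (?\<theta> ` S)) * card S)"
    by (rule of_nat_mono)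
  also have "\<dots> = real K * (real (nat \<lfloor>\<epsilon> * n\<rfloor>) + real (card (?\<theta> ` S))) * card S" by simp
  also have "\<dots> \<le> real K * (\<epsilon> * n + K * ((DIM('a) + 2) * (2 / \<epsilon> * ln n + 3) ^ (DIM('a) + 1))) * n"
  proof (intro mult_mono add_mono)
    have "card (?\<theta> ` S) \<le> K * ((DIM('a) + 2) * (card T + 1) ^ (DIM('a) + 1))"
      unfolding K_def using finite_range finite_subset[OF T(1) S(1)] by (rule card_classes_le)
    then have "real (card (?\<theta> ` S)) \<le> real (K * ((DIM('a) + 2) * (card T + 1) ^ (DIM('a) + 1)))"
      by (rule of_nat_mono)
    also have "\<dots> \<le> K * ((DIM('a) + 2) * (2 / \<epsilon> * ln n + 3) ^ (DIM('a) + 1))"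
      unfolding of_nat_mult of_nat_power using T(2) by (intro mult_left_mono power_mono) simp_all
    finally show "real (card (?\<theta> ` S)) \<le> K * ((DIM('a) + 2) * (2 / \<epsilon> * ln n + 3) ^ (DIM('a) + 1))" .
  qed (use S \<epsilon> in simp_all)
  finally show ?thesis .
qed

lemma eventually_betti_3_rips_le:
  fixes \<delta> :: real
  assumes "\<delta> > 0"
  shows "\<forall>\<^sub>F n in sequentially. \<forall>S :: (real ^ 'd) set. finite S \<longrightarrow> card S \<le> n \<longrightarrow>
    betti TYPE('k::field) 3 (clique_complex rips_adj S) \<le> \<delta> * (real n)\<^sup>2"
proof -
  obtain \<kappa> :: "real ^ 'd \<Rightarrow> 'd \<Rightarrow> int" where \<kappa>: "displacement_colouring \<kappa> 1"
    using displacement_colouring_exists[of 1] by auto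
  define K where "K = card (range \<kappa>)"
  have "K > 0" unfolding K_def using displacement_colouring.finite_range[OF \<kappa>]
    by (simp add: card_gt_0_iff)
  define \<epsilon> where "\<epsilon> = min 1 (\<delta> / (2 * K))"
  have \<epsilon>: "0 < \<epsilon>" "\<epsilon> \<le> 1" "K * \<epsilon> \<le> \<delta> / 2"
    using assms \<open>K > 0\<close> by (auto simp: \<epsilon>_def min_def field_simps)
  define d where "d = CARD('d)"
  define c where "c = real (K * (K * (d + 2)))"
  have "c > 0" unfolding c_def of_nat_0_less_iff using \<open>K > 0\<close> by simp
  have "2 / \<epsilon> > 0" "\<delta> / (2 * c) > 0" using \<epsilon>(1) assms \<open>c > 0\<close> by simp_all
  then have "\<forall>\<^sub>F n in sequentially. (2 / \<epsilon> * ln (real n) + 3) ^ (d + 1) \<le> \<delta> / (2 * c) * n"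
    by real_asymp
  moreover have "\<forall>\<^sub>F n in sequentially. n > (0::nat)" by (rule eventually_gt_at_top)
  ultimately show ?thesis
  proof (eventually_elim, intro allI impI)
    fix n and S :: "(real ^ 'd) set"
    let ?L = "(2 / \<epsilon> * ln (real n) + 3) ^ (d + 1)"
    assume L: "?L \<le> \<delta> / (2 * c) * n" and n: "n > 0" and S: "finite S" "card S \<le> n"
    have "betti TYPE('k) 3 (clique_complex rips_adj S) \<le> K * (\<epsilon> * n + K * ((d + 2) * ?L)) * n"
      using betti_3_rips_le[OF \<kappa> S n \<epsilon>(1,2), where 'k = 'k] by (simp add: K_def d_def)
    also have "\<dots> = (K * \<epsilon> * n + c * ?L) * n" by (simp add: c_def algebra_simps)
    also have "\<dots> \<le> (\<delta> / 2 * n + c * (\<delta> / (2 * c) * n)) * n"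
      using \<epsilon>(3) L \<open>c > 0\<close> by (intro mult_right_mono add_mono mult_left_mono) simp_all
    also have "\<dots> = \<delta> * (real n)\<^sup>2" using \<open>c > 0\<close> by (simp add: power2_eq_square field_simps)
    finally show "betti TYPE('k) 3 (clique_complex rips_adj S) \<le> \<delta> * (real n)\<^sup>2" .
  qed
qed

section \<open>Maximal Betti numbers\<close>

lemma rips_eq_clique_complex:
  fixes S :: "'a::real_normed_vector set"
  assumes "finite S"
  shows "rips S = clique_complex rips_adj S"
proof -
  have "diameter \<sigma> \<le> 1 \<longleftrightarrow> (\<forall>x\<in>\<sigma>. \<forall>y\<in>\<sigma>. dist x y \<le> 1)" if "\<sigma> \<subseteq> S" for \<sigma>
  proof
    assume "diameter \<sigma> \<le> 1"
    moreover have "bounded \<sigma>" using finite_subset[OF that assms] by (rule finite_imp_bounded)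
    ultimately show "\<forall>x\<in>\<sigma>. \<forall>y\<in>\<sigma>. dist x y \<le> 1"
      using diameter_bounded_bound[of \<sigma>] by force
  qed (auto intro!: diameter_le simp: dist_norm)
  then show ?thesis unfolding rips_def clique_complex_def by auto
qed

lemma max_betti_le_iff:
  "max_betti TYPE('k::field) TYPE('d::finite) p n \<le> m \<longleftrightarrow>
    (\<forall>S :: (real ^ 'd) set. finite S \<longrightarrow> card S \<le> n \<longrightarrow>
      betti TYPE('k) (Suc p) (clique_complex rips_adj S) \<le> m)"
proof -
  let ?B = "{reduced_betti TYPE('k) p (rips S) | S :: (real ^ 'd) set. finite S \<and> card S \<le> n}"
  have "reduced_betti TYPE('k) p (rips ({} :: (real ^ 'd) set)) \<in> ?B"
    by (intro CollectI exI[of _ "{}"]) simp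
  then have "max_betti TYPE('k) TYPE('d) p n \<le> m \<longleftrightarrow> (\<forall>b\<in>?B. b \<le> m)"
    unfolding max_betti_def by (intro Max_le_iff finite_betti_values) blast
  also have "\<dots> \<longleftrightarrow> (\<forall>S :: (real ^ 'd) set. finite S \<longrightarrow> card S \<le> n \<longrightarrow>
      betti TYPE('k) (Suc p) (clique_complex rips_adj S) \<le> m)"
    by (auto simp: reduced_betti_eq_betti simp flip: rips_eq_clique_complex)
  finally show ?thesis .
qed

lemma max_betti_Suc_le:
  "max_betti TYPE('k::field) TYPE('d::finite) (Suc p) n \<le> max_betti TYPE('k) TYPE('d) p n * n"
  unfolding max_betti_le_iff[where p = "Suc p"]
proof (intro allI impI)
  fix S :: "(real ^ 'd) set" assume S: "finite S" "card S \<le> n"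
  let ?M = "max_betti TYPE('k) TYPE('d) p n"
  have "betti TYPE('k) (Suc (Suc p)) (clique_complex rips_adj S) \<le> ?M * card S"
  proof (rule rips.betti_clique_le_mult_card[OF S(1)])
    fix v U assume "U \<subseteq> S"
    then have N: "{x \<in> U. rips_adj v x} \<subseteq> S" by auto
    have "finite {x \<in> U. rips_adj v x}" by (rule finite_subset[OF N S(1)])
    moreover have "card {x \<in> U. rips_adj v x} \<le> n"
      by (rule order_trans[OF card_mono[OF S(1) N] S(2)])
    ultimately show "betti TYPE('k) (Suc p) (clique_complex rips_adj {x \<in> U. rips_adj v x}) \<le> ?M"
      using max_betti_le_iff[where 'k = 'k and 'd = 'd and m = ?M] by blast
  qed
  also have "\<dots> \<le> ?M * n" using S(2) by simp
  finally show "betti TYPE('k) (Suc (Suc p)) (clique_complex rips_adj S) \<le> ?M * n" .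
qed

lemma max_betti_add_le:
  "max_betti TYPE('k::field) TYPE('d::finite) (p + r) n \<le> max_betti TYPE('k) TYPE('d) p n * n ^ r"
proof (induction r)
  case (Suc r)
  have "max_betti TYPE('k) TYPE('d) (p + Suc r) n \<le> max_betti TYPE('k) TYPE('d) (p + r) n * n"
    using max_betti_Suc_le[where p = "p + r"] by simp
  also have "\<dots> \<le> max_betti TYPE('k) TYPE('d) p n * n ^ r * n" using Suc.IH by simp
  finally show ?case by (simp add: algebra_simps)
qed simp

lemma eventually_max_betti_2_less:
  fixes \<delta> :: real
  assumes "\<delta> > 0"
  shows "\<forall>\<^sub>F n in sequentially. max_betti TYPE('k::field) TYPE('d::finite) 2 n < \<delta> * (real n)\<^sup>2"
proof -
  have "\<delta> / 2 > 0" using assms by simp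
  from eventually_betti_3_rips_le[OF this, where 'd = 'd and 'k = 'k] eventually_gt_at_top[of 0]
  show ?thesis
  proof eventually_elim
    case (elim n)
    have "max_betti TYPE('k) TYPE('d) 2 n \<le> nat \<lfloor>\<delta> / 2 * (real n)\<^sup>2\<rfloor>"
      unfolding max_betti_le_iff using elim(1) by (simp add: le_nat_floor)
    then have "max_betti TYPE('k) TYPE('d) 2 n \<le> \<delta> / 2 * (real n)\<^sup>2"
      using assms by (simp add: le_nat_iff le_floor_iff)
    also have "\<dots> < \<delta> * (real n)\<^sup>2" using assms elim(2) by simp
    finally show ?case .
  qed
qed

section \<open>Geometry of the plane\<close>

definition cross2 :: "real ^ 2 \<Rightarrow> real ^ 2 \<Rightarrow> real" where
  "cross2 x y = x $ 1 * y $ 2 - x $ 2 * y $ 1"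

lemma inner_real_2: "x \<bullet> y = x $ 1 * y $ 1 + x $ 2 * y $ 2" for x y :: "real ^ 2"
  by (simp add: inner_vec_def sum_2)

lemma cross2_diff_right: "cross2 x (y - z) = cross2 x y - cross2 x z"
  by (simp add: cross2_def algebra_simps)

lemma cross2_minus_right: "cross2 x (- y) = - cross2 x y"
  by (simp add: cross2_def)

lemma linear_cross2: "linear (cross2 x)"
  by (rule linearI) (simp_all add: cross2_def algebra_simps)

lemma norm_square_mult_inner: "(norm u)\<^sup>2 * (x \<bullet> y) = (x \<bullet> u) * (y \<bullet> u) + cross2 u x * cross2 u y"
  unfolding power2_norm_eq_inner inner_real_2 cross2_def by (simp add: algebra_simps)

lemma inner_square_plus_cross2_square: "(u \<bullet> x)\<^sup>2 + (cross2 u x)\<^sup>2 = (norm u)\<^sup>2 * (norm x)\<^sup>2"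
  using norm_square_mult_inner[of u x x]
  by (simp add: power2_norm_eq_inner[of x] power2_eq_square[of "u \<bullet> x"]
      power2_eq_square[of "cross2 u x"] inner_commute)

lemma dist_square_cross2:
  "(u \<bullet> z - u \<bullet> w)\<^sup>2 + (cross2 u z - cross2 u w)\<^sup>2 = (norm u)\<^sup>2 * (dist w z)\<^sup>2"
  using inner_square_plus_cross2_square[of u "z - w"]
  by (simp add: inner_diff_right cross2_diff_right dist_norm norm_minus_commute)

subsection \<open>Unit circles\<close>

text \<open>The first coordinate points from the centres towards the other points. Since \<open>q\<close> and \<open>r\<close> lie below
  \<open>b\<close>, the point \<open>r\<close> can only be outside the disc of \<open>b\<close> if it lies to the right of \<open>q\<close>. But \<open>q\<close> is
  closer to \<open>b\<close> and \<open>r\<close> is closer to \<open>a\<close>, which places \<open>r\<close> to the left of \<open>q\<close>.\<close>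

lemma half_circles_cross_once_below:
  fixes a\<^sub>1 a\<^sub>2 b\<^sub>1 b\<^sub>2 q\<^sub>1 q\<^sub>2 r\<^sub>1 r\<^sub>2 R :: real
  assumes right: "a\<^sub>1 < b\<^sub>1" "b\<^sub>1 \<le> q\<^sub>1" "b\<^sub>1 \<le> r\<^sub>1" and above: "q\<^sub>2 \<le> r\<^sub>2" "r\<^sub>2 < b\<^sub>2"
    and q: "(q\<^sub>1 - b\<^sub>1)\<^sup>2 + (q\<^sub>2 - b\<^sub>2)\<^sup>2 \<le> R" "R < (q\<^sub>1 - a\<^sub>1)\<^sup>2 + (q\<^sub>2 - a\<^sub>2)\<^sup>2"
    and r: "(r\<^sub>1 - a\<^sub>1)\<^sup>2 + (r\<^sub>2 - a\<^sub>2)\<^sup>2 \<le> R" "R < (r\<^sub>1 - b\<^sub>1)\<^sup>2 + (r\<^sub>2 - b\<^sub>2)\<^sup>2"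
  shows False
proof -
  have "(r\<^sub>1 - b\<^sub>1)\<^sup>2 \<le> (r\<^sub>1 - a\<^sub>1)\<^sup>2" using right by (intro power_mono) auto
  then have "(r\<^sub>2 - a\<^sub>2)\<^sup>2 < (r\<^sub>2 - b\<^sub>2)\<^sup>2" using r by linarith
  then have "\<bar>r\<^sub>2 - a\<^sub>2\<bar> < \<bar>r\<^sub>2 - b\<^sub>2\<bar>" using abs_le_square_iff[of "r\<^sub>2 - b\<^sub>2" "r\<^sub>2 - a\<^sub>2"]
    by linarith
  then have "a\<^sub>2 < b\<^sub>2" using above(2) by linarith
  then have "(b\<^sub>2 - a\<^sub>2) * (q\<^sub>2 - r\<^sub>2) \<le> 0" using above(1) by (simp add: mult_nonneg_nonpos)
  moreover have "(b\<^sub>1 - a\<^sub>1) * (q\<^sub>1 - r\<^sub>1) + (b\<^sub>2 - a\<^sub>2) * (q\<^sub>2 - r\<^sub>2) > 0"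
    using q r by (simp add: power2_eq_square algebra_simps)
  ultimately have "(b\<^sub>1 - a\<^sub>1) * (q\<^sub>1 - r\<^sub>1) > 0" by linarith
  then have "r\<^sub>1 < q\<^sub>1" using right(1) by (simp add: zero_less_mult_iff)
  then have "(r\<^sub>1 - b\<^sub>1)\<^sup>2 \<le> (q\<^sub>1 - b\<^sub>1)\<^sup>2" using right by (intro power_mono) auto
  moreover have "(b\<^sub>2 - r\<^sub>2)\<^sup>2 \<le> (b\<^sub>2 - q\<^sub>2)\<^sup>2" using above by (intro power_mono) auto
  ultimately show False using q(1) r(2) by (simp add: power2_commute)
qed

lemma half_circles_cross_once:
  fixes a\<^sub>1 a\<^sub>2 b\<^sub>1 b\<^sub>2 p\<^sub>1 p\<^sub>2 q\<^sub>1 q\<^sub>2 r\<^sub>1 r\<^sub>2 R :: real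
  assumes right: "a\<^sub>1 < b\<^sub>1" "b\<^sub>1 \<le> p\<^sub>1" "b\<^sub>1 \<le> q\<^sub>1" "b\<^sub>1 \<le> r\<^sub>1" and order: "p\<^sub>2 \<le> q\<^sub>2" "q\<^sub>2 \<le> r\<^sub>2"
    and p: "(p\<^sub>1 - a\<^sub>1)\<^sup>2 + (p\<^sub>2 - a\<^sub>2)\<^sup>2 \<le> R" "R < (p\<^sub>1 - b\<^sub>1)\<^sup>2 + (p\<^sub>2 - b\<^sub>2)\<^sup>2"
    and q: "(q\<^sub>1 - b\<^sub>1)\<^sup>2 + (q\<^sub>2 - b\<^sub>2)\<^sup>2 \<le> R" "R < (q\<^sub>1 - a\<^sub>1)\<^sup>2 + (q\<^sub>2 - a\<^sub>2)\<^sup>2"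
    and r: "(r\<^sub>1 - a\<^sub>1)\<^sup>2 + (r\<^sub>2 - a\<^sub>2)\<^sup>2 \<le> R" "R < (r\<^sub>1 - b\<^sub>1)\<^sup>2 + (r\<^sub>2 - b\<^sub>2)\<^sup>2"
  shows False
proof -
  have vertically_closer: "\<bar>z\<^sub>2 - a\<^sub>2\<bar> < \<bar>z\<^sub>2 - b\<^sub>2\<bar>"
    if "b\<^sub>1 \<le> z\<^sub>1" "(z\<^sub>1 - a\<^sub>1)\<^sup>2 + (z\<^sub>2 - a\<^sub>2)\<^sup>2 \<le> R" "R < (z\<^sub>1 - b\<^sub>1)\<^sup>2 + (z\<^sub>2 - b\<^sub>2)\<^sup>2"
      for z\<^sub>1 z\<^sub>2
  proof -
    have "(z\<^sub>1 - b\<^sub>1)\<^sup>2 \<le> (z\<^sub>1 - a\<^sub>1)\<^sup>2" using that(1) right(1) by (intro power_mono) auto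
    then have "(z\<^sub>2 - a\<^sub>2)\<^sup>2 < (z\<^sub>2 - b\<^sub>2)\<^sup>2" using that by linarith
    then show ?thesis using abs_le_square_iff[of "z\<^sub>2 - b\<^sub>2" "z\<^sub>2 - a\<^sub>2"] by linarith
  qed
  consider (below) "r\<^sub>2 < b\<^sub>2" | (above) "b\<^sub>2 < p\<^sub>2"
    using vertically_closer[OF right(2) p] vertically_closer[OF right(4) r] order by linarith
  then show False
  proof cases
    case below
    show False by (rule half_circles_cross_once_below[OF right(1,3,4) order(2) below q r])
  next
    case above
    show False
      by (rule half_circles_cross_once_below[of a\<^sub>1 b\<^sub>1 q\<^sub>1 p\<^sub>1 "- q\<^sub>2" "- p\<^sub>2" "- b\<^sub>2" R "- a\<^sub>2"])
        (use right order p q above in \<open>simp_all add: power2_eq_square algebra_simps\<close>)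
  qed
qed

lemma unit_circles_no_alternation:
  fixes u a b p q r :: "real ^ 2"
  assumes u: "u \<noteq> 0" and front: "u \<bullet> a \<le> u \<bullet> q" "u \<bullet> b \<le> u \<bullet> p" "u \<bullet> b \<le> u \<bullet> q" "u \<bullet> b \<le> u \<bullet> r"
    and order: "cross2 u p \<le> cross2 u q" "cross2 u q \<le> cross2 u r"
    and p: "dist a p \<le> 1" "1 < dist b p" and q: "dist b q \<le> 1" "1 < dist a q"
    and r: "dist a r \<le> 1" "1 < dist b r"
  shows False
proof -
  let ?X = "\<lambda>z. u \<bullet> z" and ?Y = "cross2 u" and ?R = "(norm u)\<^sup>2"
  have R: "?R > 0" using u by simp
  have inside: "(?X z - ?X w)\<^sup>2 + (?Y z - ?Y w)\<^sup>2 \<le> ?R" if "dist w z \<le> 1" for z w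
    unfolding dist_square_cross2 using R power_mono[OF that, of 2] by simp
  have outside: "?R < (?X z - ?X w)\<^sup>2 + (?Y z - ?Y w)\<^sup>2" if "1 < dist w z" for z w
    unfolding dist_square_cross2 using R power_strict_mono[OF that, of 2] by simp
  have "?Y q \<in> closed_segment (?Y p) (?Y r)"
    using order by (simp add: closed_segment_eq_real_ivl)
  then obtain m where m: "m \<in> closed_segment p r" "?Y m = ?Y q"
    unfolding closed_segment_linear_image[OF linear_cross2] by auto
  have "closed_segment p r \<subseteq> cball a 1" using p r by (intro closed_segment_subset) simp_all
  then have "dist a m \<le> 1" using m(1) by auto
  have "closed_segment p r \<subseteq> {x. dist x a < dist x b}"
    using p r by (intro closed_segment_subset convex_closer) (simp_all add: dist_commute)
  then have "dist m a < dist m b" using m(1) by blast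
  have "?X m < ?X q"
  proof (rule ccontr)
    assume "\<not> ?X m < ?X q"
    then have "(?X q - ?X a)\<^sup>2 \<le> (?X m - ?X a)\<^sup>2" using front(1) by (intro power_mono) auto
    then show False using inside[OF \<open>dist a m \<le> 1\<close>] outside[OF q(2)] m(2) by simp
  qed
  moreover have "0 < (?X b - ?X a) * (?X q - ?X m)"
  proof -
    have "?R * (dist a m)\<^sup>2 < ?R * (dist b m)\<^sup>2"
      using \<open>dist m a < dist m b\<close> R by (simp add: dist_commute power_strict_mono)
    then have "(?X m - ?X a)\<^sup>2 + (?Y q - ?Y a)\<^sup>2 < (?X m - ?X b)\<^sup>2 + (?Y q - ?Y b)\<^sup>2"
      using dist_square_cross2[of u m a] dist_square_cross2[of u m b] m(2) by simp
    then show ?thesis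
      using inside[OF q(1)] outside[OF q(2)] by (simp add: power2_eq_square algebra_simps)
  qed
  ultimately have "?X a < ?X b" by (simp add: zero_less_mult_iff)
  from half_circles_cross_once[OF this front(2-4) order inside[OF p(1)] outside[OF p(2)]
      inside[OF q(1)] outside[OF q(2)] inside[OF r(1)] outside[OF r(2)]]
  show False .
qed

subsection \<open>Nearly equilateral triangles\<close>

lemma displacements_nearly_orthogonal:
  fixes n P Q :: "'a::real_inner"
  assumes short: "norm n \<le> 1" "norm (n + Q - P) \<le> 1" and long: "1 < norm (n + Q)" "1 < norm (n - P)"
    and small: "norm P \<le> 1/100" "norm Q \<le> 1/100"
  shows "1 - (norm n)\<^sup>2 < 2 * (P \<bullet> Q)" "1 - (norm (n + Q - P))\<^sup>2 < 2 * (P \<bullet> Q)"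
    and "\<bar>P \<bullet> n\<bar> \<le> norm P / 100" "\<bar>Q \<bullet> n\<bar> \<le> norm Q / 100"
proof -
  have shorts: "(norm n)\<^sup>2 \<le> 1" "(norm (n + Q - P))\<^sup>2 \<le> 1"
    using short by (simp_all add: power_le_one)
  have long_Q: "1 < (norm n)\<^sup>2 + 2 * (Q \<bullet> n) + (norm Q)\<^sup>2"
    using power_strict_mono[OF long(1), of 2]
    by (simp add: power2_norm_eq_inner inner_add inner_commute algebra_simps)
  have long_P: "1 < (norm n)\<^sup>2 - 2 * (P \<bullet> n) + (norm P)\<^sup>2"
    using power_strict_mono[OF long(2), of 2]
    by (simp add: power2_norm_eq_inner inner_diff inner_commute algebra_simps)
  have expand: "(norm (n + Q - P))\<^sup>2
      = (norm n)\<^sup>2 + 2 * (Q \<bullet> n) - 2 * (P \<bullet> n) + (norm P)\<^sup>2 + (norm Q)\<^sup>2 - 2 * (P \<bullet> Q)"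
    by (simp add: power2_norm_eq_inner inner_add inner_diff inner_commute algebra_simps)
  show "1 - (norm n)\<^sup>2 < 2 * (P \<bullet> Q)" "1 - (norm (n + Q - P))\<^sup>2 < 2 * (P \<bullet> Q)"
    using long_P long_Q expand shorts by linarith+
  have "P \<bullet> Q \<le> norm P * norm Q" by (rule norm_cauchy_schwarz)
  moreover have "norm P * norm Q \<le> norm P / 100" "norm P * norm Q \<le> norm Q / 100"
    "(norm P)\<^sup>2 \<le> norm P / 100" "(norm Q)\<^sup>2 \<le> norm Q / 100"
    using mult_left_mono[OF small(2), of "norm P"] mult_right_mono[OF small(1), of "norm Q"]
      mult_left_mono[OF small(1), of "norm P"] mult_left_mono[OF small(2), of "norm Q"]
    by (simp_all add: power2_eq_square)
  ultimately show "\<bar>P \<bullet> n\<bar> \<le> norm P / 100" "\<bar>Q \<bullet> n\<bar> \<le> norm Q / 100"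
    using long_P long_Q expand shorts zero_le_power2[of "norm P"] zero_le_power2[of "norm Q"]
    by linarith+
qed

lemma abs_cross2_ge_if_nearly_orthogonal:
  assumes n: "49/50 \<le> (norm n)\<^sup>2" and orth: "\<bar>P \<bullet> n\<bar> \<le> norm P / 100"
  shows "98/100 * norm P \<le> \<bar>cross2 n P\<bar>"
proof -
  have "(P \<bullet> n)\<^sup>2 \<le> (norm P)\<^sup>2 / 10000"
    using power_mono[OF orth, of 2] by (simp add: power_divide)
  moreover have "49/50 * (norm P)\<^sup>2 \<le> (norm n)\<^sup>2 * (norm P)\<^sup>2" using n
    by (intro mult_right_mono) auto
  moreover have "(98/100 * norm P)\<^sup>2 = 9604/10000 * (norm P)\<^sup>2" by (simp add: power2_eq_square)
  ultimately have "(98/100 * norm P)\<^sup>2 \<le> (cross2 n P)\<^sup>2"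
    using inner_square_plus_cross2_square[of n P] zero_le_power2[of "norm P"]
    unfolding inner_commute[of n P] by linarith
  then show ?thesis using abs_le_square_iff[of "98/100 * norm P" "cross2 n P"] by simp
qed

lemma cross2_same_sign_if_nearly_orthogonal:
  assumes n: "49/50 \<le> (norm n)\<^sup>2" and orth: "\<bar>P \<bullet> n\<bar> \<le> norm P / 100" "\<bar>Q \<bullet> n\<bar> \<le> norm Q / 100"
    and pos: "0 < P \<bullet> Q"
  shows "0 < cross2 n P * cross2 n Q"
proof (rule ccontr)
  assume "\<not> ?thesis"
  then have "cross2 n P * cross2 n Q = - (\<bar>cross2 n P\<bar> * \<bar>cross2 n Q\<bar>)" by (simp flip: abs_mult)
  moreover have "(98/100 * norm P) * (98/100 * norm Q) \<le> \<bar>cross2 n P\<bar> * \<bar>cross2 n Q\<bar>"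
    using abs_cross2_ge_if_nearly_orthogonal[OF n] orth by (intro mult_mono) auto
  moreover have "(P \<bullet> n) * (Q \<bullet> n) \<le> (norm P / 100) * (norm Q / 100)"
    using mult_mono[OF orth] by (simp flip: abs_mult)
  moreover have "0 < (norm n)\<^sup>2 * (P \<bullet> Q)" using n pos by (intro mult_pos_pos) linarith+
  moreover have "0 \<le> norm P * norm Q" by simp
  ultimately show False using norm_square_mult_inner[of n P Q] by simp
qed

lemma abs_cross2_ge_if_oblique:
  assumes "49/50 \<le> (norm n)\<^sup>2" "49/50 \<le> (norm b)\<^sup>2" "\<bar>b \<bullet> n\<bar> \<le> 51/100"
  shows "83/100 \<le> \<bar>cross2 n b\<bar>"
proof -
  have "(n \<bullet> b)\<^sup>2 \<le> (51/100)\<^sup>2" using power_mono[OF assms(3), of 2] by (simp add: inner_commute)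
  moreover have "(49/50) * (49/50) \<le> (norm n)\<^sup>2 * (norm b)\<^sup>2" using assms by (intro mult_mono) auto
  ultimately have "(83/100)\<^sup>2 \<le> (cross2 n b)\<^sup>2"
    using inner_square_plus_cross2_square[of n b] by (simp add: power2_eq_square)
  then show ?thesis using abs_le_square_iff[of "83/100" "cross2 n b"] by simp
qed

text \<open>The components of \<open>P\<close> and \<open>b\<close> along \<open>n\<close> are small enough for the orthogonal ones to dominate.\<close>

lemma inner_ge_if_cross2_same_sign:
  assumes n: "49/50 \<le> (norm n)\<^sup>2" "norm n \<le> 1" and b: "49/50 \<le> (norm b)\<^sup>2" "\<bar>b \<bullet> n\<bar> \<le> 51/100"
    and orth: "\<bar>P \<bullet> n\<bar> \<le> norm P / 100" and sign: "0 < cross2 n P * cross2 n b"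
  shows "8/10 * norm P \<le> P \<bullet> b"
proof -
  have "(98/100 * norm P) * (83/100) \<le> \<bar>cross2 n P\<bar> * \<bar>cross2 n b\<bar>"
    using abs_cross2_ge_if_nearly_orthogonal[OF n(1) orth] abs_cross2_ge_if_oblique[OF n(1) b]
    by (intro mult_mono) auto
  also have "\<dots> = cross2 n P * cross2 n b" using sign by (simp flip: abs_mult)
  finally have "(98/100 * norm P) * (83/100) \<le> cross2 n P * cross2 n b" .
  moreover have "\<bar>(P \<bullet> n) * (b \<bullet> n)\<bar> \<le> (norm P / 100) * (51/100)"
    unfolding abs_mult using orth b(2) by (intro mult_mono) auto
  ultimately have lower: "8/10 * norm P \<le> (norm n)\<^sup>2 * (P \<bullet> b)"
    unfolding norm_square_mult_inner using norm_ge_zero[of P] by linarith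
  then have "0 \<le> (norm n)\<^sup>2 * (P \<bullet> b)" using norm_ge_zero[of P] by linarith
  moreover have "0 < (norm n)\<^sup>2" using n(1) by linarith
  ultimately have "0 \<le> P \<bullet> b" by (simp add: zero_le_mult_iff)
  then have "(norm n)\<^sup>2 * (P \<bullet> b) \<le> 1 * (P \<bullet> b)"
    using n(2) by (intro mult_right_mono) (simp_all add: power_le_one)
  then show ?thesis using lower by simp
qed

lemma abs_inner_le_if_nearly_equilateral:
  fixes b v :: "'a::real_inner"
  assumes "49/50 \<le> (norm b)\<^sup>2" "49/50 \<le> (norm v)\<^sup>2" "49/50 \<le> (norm (v - b))\<^sup>2"
    and "(norm b)\<^sup>2 \<le> 1" "(norm v)\<^sup>2 \<le> 1" "(norm (v - b))\<^sup>2 \<le> 1"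
  shows "\<bar>b \<bullet> (v - b)\<bar> \<le> 51/100" "\<bar>v \<bullet> (v - b)\<bar> \<le> 51/100"
proof -
  have "2 * (b \<bullet> (v - b)) = (norm v)\<^sup>2 - (norm b)\<^sup>2 - (norm (v - b))\<^sup>2"
    "2 * (v \<bullet> (v - b)) = (norm v)\<^sup>2 - (norm b)\<^sup>2 + (norm (v - b))\<^sup>2"
    by (simp_all add: power2_norm_eq_inner inner_diff inner_commute algebra_simps)
  then show "\<bar>b \<bullet> (v - b)\<bar> \<le> 51/100" "\<bar>v \<bullet> (v - b)\<bar> \<le> 51/100" using assms by linarith+
qed

lemma norm_less_if_outward_step:
  fixes x y z :: "'a::real_inner"
  assumes "y \<noteq> 0" "norm (x + y) \<le> 1" "norm y / 100 \<le> y \<bullet> x" "1 - norm y / 50 \<le> (norm z)\<^sup>2"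
  shows "norm x < norm z"
proof (rule power2_less_imp_less)
  have "(norm x)\<^sup>2 + 2 * (y \<bullet> x) + (norm y)\<^sup>2 = (norm (x + y))\<^sup>2"
    by (simp add: power2_norm_eq_inner inner_add inner_commute algebra_simps)
  also have "\<dots> \<le> 1" using assms(2) by (simp add: power_le_one)
  finally have "(norm x)\<^sup>2 + 2 * (y \<bullet> x) + (norm y)\<^sup>2 \<le> 1" .
  moreover have "0 < (norm y)\<^sup>2" using assms(1) by simp
  ultimately show "(norm x)\<^sup>2 < (norm z)\<^sup>2" using assms(3,4) by linarith
qed simp

lemma norm_less_if_displaced_outwards:
  fixes b n P z :: "real ^ 2"
  assumes "49/50 \<le> (norm n)\<^sup>2" "norm n \<le> 1" "49/50 \<le> (norm b)\<^sup>2" "\<bar>b \<bullet> n\<bar> \<le> 51/100"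
    and "\<bar>P \<bullet> n\<bar> \<le> norm P / 100" "0 < cross2 n P * cross2 n b"
    and P: "P \<noteq> 0" "norm (b + P) \<le> 1" and z: "1 - norm P / 50 \<le> (norm z)\<^sup>2"
  shows "norm b < norm z"
proof (rule norm_less_if_outward_step[OF P _ z])
  have "8/10 * norm P \<le> P \<bullet> b" by (rule inner_ge_if_cross2_same_sign) fact+
  then show "norm P / 100 \<le> P \<bullet> b" using norm_ge_zero[of P] by linarith
qed

lemma norm_displaced_less_if_inwards:
  fixes b n P z :: "real ^ 2"
  assumes n: "49/50 \<le> (norm n)\<^sup>2" "norm n \<le> 1" and b: "49/50 \<le> (norm b)\<^sup>2" "\<bar>b \<bullet> n\<bar> \<le> 51/100"
    and P: "\<bar>P \<bullet> n\<bar> \<le> norm P / 100" "cross2 n P * cross2 n b < 0" "P \<noteq> 0" "norm P \<le> 1/100"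
    and "norm b \<le> 1" and z: "1 - norm P / 50 \<le> (norm z)\<^sup>2"
  shows "norm (b + P) < norm z"
proof (rule norm_less_if_outward_step[of "- P"])
  have "8/10 * norm (- P) \<le> - P \<bullet> b"
    using P by (intro inner_ge_if_cross2_same_sign[OF n b]) (simp_all add: cross2_minus_right)
  moreover have "P \<bullet> P \<le> norm P / 100"
    using mult_left_mono[OF P(4), of "norm P"]
    by (simp add: power2_eq_square flip: power2_norm_eq_inner)
  ultimately show "norm (- P) / 100 \<le> - P \<bullet> (b + P)"
    using norm_ge_zero[of P]
    unfolding norm_minus_cancel inner_minus_left inner_add_right by linarith
qed (use assms in simp_all)

text \<open>Seen from the common apex \<open>0\<close>, one of the edges \<open>b v\<close> and \<open>b' v'\<close> lies farther away than the
  other; this shortens the sides of the triangle with the near edge, while both edges have length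
  almost \<open>1\<close>.\<close>

lemma far_edge_longest:
  fixes b v P Q :: "real ^ 2"
  assumes lower: "49/50 \<le> (norm b)\<^sup>2" "49/50 \<le> (norm v)\<^sup>2" "49/50 \<le> (norm (v - b))\<^sup>2"
    and upper: "norm b \<le> 1" "norm v \<le> 1" "norm (v - b) \<le> 1"
    and upper': "norm (b + P) \<le> 1" "norm (v + Q) \<le> 1" "norm (v - b + Q - P) \<le> 1"
    and small: "norm P \<le> 1/100" "norm Q \<le> 1/100"
    and far: "1 < norm (v - b + Q)" "1 < norm (v - b - P)"
  shows "(norm b < norm (v - b) \<and> norm v < norm (v - b)) \<or>
    (norm (b + P) < norm (v - b + Q - P) \<and> norm (v + Q) < norm (v - b + Q - P))"
proof -
  define n where "n = v - b"
  note n = lower(3)[folded n_def] upper(3)[folded n_def]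
  note displacements =
    displacements_nearly_orthogonal[OF upper(3) upper'(3) far small, folded n_def]
  have upper_sq: "(norm x)\<^sup>2 \<le> 1" if "norm x \<le> 1" for x :: "real ^ 2"
    using that by (simp add: power_le_one)
  have inner_n: "\<bar>b \<bullet> n\<bar> \<le> 51/100" "\<bar>v \<bullet> n\<bar> \<le> 51/100"
    using abs_inner_le_if_nearly_equilateral[OF lower] upper upper_sq unfolding n_def by blast+
  have "0 < P \<bullet> Q" using displacements(1) upper_sq[OF n(2)] by linarith
  then have nonzero: "P \<noteq> 0" "Q \<noteq> 0" by auto
  have "P \<bullet> Q \<le> norm P * norm Q" by (rule norm_cauchy_schwarz)
  moreover have "norm P * norm Q \<le> norm P / 100" "norm P * norm Q \<le> norm Q / 100"
    using mult_left_mono[OF small(2), of "norm P"] mult_right_mono[OF small(1), of "norm Q"]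
    by simp_all
  ultimately have edges: "1 - norm P / 50 \<le> (norm n)\<^sup>2" "1 - norm Q / 50 \<le> (norm n)\<^sup>2"
    "1 - norm P / 50 \<le> (norm (n + Q - P))\<^sup>2" "1 - norm Q / 50 \<le> (norm (n + Q - P))\<^sup>2"
    using displacements(1,2) by linarith+
  have same_height: "cross2 n v = cross2 n b" by (simp add: n_def cross2_def algebra_simps)
  have same_sign: "0 < cross2 n P * cross2 n Q"
    by (rule cross2_same_sign_if_nearly_orthogonal[OF n(1) displacements(3,4) \<open>0 < P \<bullet> Q\<close>])
  have "cross2 n P * cross2 n b \<noteq> 0"
    using same_sign abs_cross2_ge_if_oblique[OF n(1) lower(1) inner_n(1)] by auto
  then consider (outward) "0 < cross2 n P * cross2 n b" | (inward) "cross2 n P * cross2 n b < 0"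
    by linarith
  then show ?thesis
  proof cases
    case outward
    then have "0 < cross2 n Q * cross2 n v"
      using same_sign same_height by (auto simp: zero_less_mult_iff)
    then have "norm b < norm n" "norm v < norm n"
      using norm_less_if_displaced_outwards[OF n lower(1) inner_n(1) displacements(3) outward
          nonzero(1) upper'(1) edges(1)]
        norm_less_if_displaced_outwards[OF n lower(2) inner_n(2) displacements(4) _
          nonzero(2) upper'(2) edges(2)]
      by blast+
    then show ?thesis unfolding n_def by blast
  next
    case inward
    then have "cross2 n Q * cross2 n v < 0"
      using same_sign same_height by (auto simp: zero_less_mult_iff mult_less_0_iff)
    then have "norm (b + P) < norm (n + Q - P)" "norm (v + Q) < norm (n + Q - P)"
      using norm_displaced_less_if_inwards[OF n lower(1) inner_n(1) displacements(3) inward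
          nonzero(1) small(1) upper(1) edges(3)]
        norm_displaced_less_if_inwards[OF n lower(2) inner_n(2) displacements(4) _
          nonzero(2) small(2) upper(2) edges(4)]
      by blast+
    then show ?thesis unfolding n_def by blast
  qed
qed

lemma opposite_edge_longest:
  fixes a b v b' v' :: "real ^ 2"
  assumes "99/100 \<le> dist a b" "99/100 \<le> dist a v" "99/100 \<le> dist b v"
    and "dist a b \<le> 1" "dist a v \<le> 1" "dist b v \<le> 1" "dist a b' \<le> 1" "dist a v' \<le> 1"
      "dist b' v' \<le> 1"
    and "dist b b' \<le> 1/100" "dist v v' \<le> 1/100" and "1 < dist b v'" "1 < dist b' v"
  shows "(dist a b < dist b v \<and> dist a v < dist b v) \<or>
    (dist a b' < dist b' v' \<and> dist a v' < dist b' v')"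
proof -
  have lower_sq: "49/50 \<le> (norm x)\<^sup>2" if "99/100 \<le> norm x" for x :: "real ^ 2"
    using power_mono[OF that, of 2] by (simp add: power2_eq_square)
  have to_norm: "dist x y = norm (y - x)" for x y :: "real ^ 2"
    by (simp add: dist_norm norm_minus_commute)
  have "(norm (b - a) < norm ((v - a) - (b - a)) \<and> norm (v - a) < norm ((v - a) - (b - a))) \<or>
    (norm ((b - a) + (b' - b)) < norm ((v - a) - (b - a) + (v' - v) - (b' - b)) \<and>
     norm ((v - a) + (v' - v)) < norm ((v - a) - (b - a) + (v' - v) - (b' - b)))"
    using assms unfolding to_norm by (intro far_edge_longest lower_sq) (simp_all add: algebra_simps)
  then show ?thesis unfolding to_norm by (simp add: algebra_simps)
qed

section \<open>Rips complexes in the plane\<close>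

lemma injective_rank_exists:
  fixes f :: "'a \<Rightarrow> real"
  assumes "finite C"
  obtains rank :: "'a \<Rightarrow> nat" where "inj_on rank C"
    "\<And>p q. p \<in> C \<Longrightarrow> q \<in> C \<Longrightarrow> rank p < rank q \<Longrightarrow> f p \<le> f q"
proof -
  have "\<exists>rank :: 'a \<Rightarrow> nat. inj_on rank C \<and> (\<forall>p\<in>C. \<forall>q\<in>C. rank p < rank q \<longrightarrow> f p \<le> f q)"
    using assms
  proof (induction C rule: finite_ranking_induct[where f = f])
    case (insert x C)
    then obtain rank :: "'a \<Rightarrow> nat"
      where rank: "inj_on rank C" "\<forall>p\<in>C. \<forall>q\<in>C. rank p < rank q \<longrightarrow> f p \<le> f q" by blast
    show ?case
    proof (cases "x \<in> C")
      case True
      then show ?thesis using rank by (auto simp: insert_absorb)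
    next
      case False
      define rank' where "rank' = rank(x := Suc (\<Sum>y\<in>C. rank y))"
      have "rank y < rank' x" if "y \<in> C" for y
        using member_le_sum[of y C rank] insert.hyps(1) that by (simp add: rank'_def)
      moreover have "rank' y = rank y" if "y \<in> C" for y using that False by (auto simp: rank'_def)
      ultimately have "inj_on rank' (insert x C)"
        "\<forall>p\<in>insert x C. \<forall>q\<in>insert x C. rank' p < rank' q \<longrightarrow> f p \<le> f q"
        using rank insert.hyps(2) False by (force simp: inj_on_def)+
      then show ?thesis by blast
    qed
  qed simp
  then show thesis using that by blast
qed

locale planar_colouring = displacement_colouring \<kappa> "1/100" for \<kappa> :: "real ^ 2 \<Rightarrow> 'c"
begin

lemma common_direction_exists:
  obtains u :: "real ^ 2" where "\<And>a c x y. \<kappa> a = i \<Longrightarrow> \<kappa> c = j \<Longrightarrow> 1 < dist a c \<Longrightarrow> dist a c \<le> 3 \<Longrightarrow>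
    \<kappa> x = i \<Longrightarrow> \<kappa> y = j \<Longrightarrow> dist x y \<le> 3 \<Longrightarrow> u \<noteq> 0 \<and> u \<bullet> x \<le> u \<bullet> y"
proof (cases "\<exists>a c. \<kappa> a = i \<and> \<kappa> c = j \<and> 1 < dist a c \<and> dist a c \<le> 3")
  case True
  then obtain a c where ac: "\<kappa> a = i" "\<kappa> c = j" "1 < dist a c" "dist a c \<le> 3" by blast
  define u where "u = c - a"
  have u: "1 < norm u" using ac(3) by (simp add: u_def dist_norm norm_minus_commute)
  have "u \<bullet> x \<le> u \<bullet> y" if "\<kappa> x = i" "\<kappa> y = j" "dist x y \<le> 3" for x y
  proof -
    have "dist (y - x) u \<le> 1/100" unfolding u_def using that ac by (intro displacement_near) auto
    then have "norm u * norm (y - x - u) \<le> norm u * 1"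
      by (intro mult_left_mono) (simp_all add: dist_norm)
    moreover have "\<bar>u \<bullet> (y - x - u)\<bar> \<le> norm u * norm (y - x - u)" by (rule Cauchy_Schwarz_ineq2)
    moreover have "norm u * 1 \<le> u \<bullet> u"
      using u mult_left_mono[of 1 "norm u" "norm u"]
      by (simp add: power2_eq_square flip: power2_norm_eq_inner)
    ultimately show ?thesis by (simp add: inner_diff_right)
  qed
  moreover have "u \<noteq> 0" using u by auto
  ultimately show thesis using that by blast
next
  case False
  then show thesis using that by blast
qed

lemma betti_3_two_colours_plane_le:
  assumes S: "finite S" and ij: "i \<noteq> j"
  shows "betti TYPE('k::field) 3 (clique_complex rips_adj {x \<in> S. \<kappa> x \<in> {i, j}}) \<le> 2 * card S"
proof -
  let ?A = "{x \<in> S. \<kappa> x = i}" and ?C = "{x \<in> S. \<kappa> x = j}"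
  obtain u where u: "\<And>a c x y. \<kappa> a = i \<Longrightarrow> \<kappa> c = j \<Longrightarrow> 1 < dist a c \<Longrightarrow> dist a c \<le> 3 \<Longrightarrow>
      \<kappa> x = i \<Longrightarrow> \<kappa> y = j \<Longrightarrow> dist x y \<le> 3 \<Longrightarrow> u \<noteq> 0 \<and> u \<bullet> x \<le> u \<bullet> y"
    using common_direction_exists by blast
  obtain rank :: "real ^ 2 \<Rightarrow> nat" where rank: "inj_on rank ?C"
    "\<And>p q. p \<in> ?C \<Longrightarrow> q \<in> ?C \<Longrightarrow> rank p < rank q \<Longrightarrow> cross2 u p \<le> cross2 u q"
    by (rule injective_rank_exists[of ?C "cross2 u"]) (use S in auto)
  interpret two_coloured_graph rips_adj \<kappa> ?A ?C i j rank
  proof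
    fix a b p q r
    assume ab: "a \<in> ?A" "b \<in> ?A" "dist a b \<le> 1"
      and pqr: "p \<in> ?C" "q \<in> ?C" "r \<in> ?C" "rank p < rank q" "rank q < rank r"
      and adj: "dist a p \<le> 1" "\<not> dist b p \<le> 1" "dist b q \<le> 1" "\<not> dist a q \<le> 1" "dist a r \<le> 1"
        "\<not> dist b r \<le> 1"
    have "dist a q \<le> 3" "dist b p \<le> 3" "dist b q \<le> 3" "dist b r \<le> 3"
      using ab(3) adj dist_triangle[of a q b] dist_triangle[of b p a] dist_triangle[of b r a]
      by (auto simp: dist_commute)
    then have "u \<noteq> 0" "u \<bullet> a \<le> u \<bullet> q" "u \<bullet> b \<le> u \<bullet> p" "u \<bullet> b \<le> u \<bullet> q" "u \<bullet> b \<le> u \<bullet> r"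
      using u[of a q] ab pqr adj(4) by auto
    then show False
      using unit_circles_no_alternation[of u a q b p r] rank(2)[OF pqr(1,2,4)]
        rank(2)[OF pqr(2,3,5)] adj by auto
  qed (use S ij rank(1) in auto)
  have "?A \<union> ?C = {x \<in> S. \<kappa> x \<in> {i, j}}" by auto
  then have "betti TYPE('k) 3 (clique_complex rips_adj {x \<in> S. \<kappa> x \<in> {i, j}}) \<le> 2 * card ?C"
    using betti_3_two_colours_le[where 'k = 'k] by simp
  also have "\<dots> \<le> 2 * card S" using S by (simp add: card_mono)
  finally show ?thesis .
qed

end

locale inequivalent_triangles = planar_colouring \<kappa> for \<kappa> :: "real ^ 2 \<Rightarrow> 'c" +
  fixes S :: "(real ^ 2) set" and F :: "(real ^ 2) set set" and W :: "'c set"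
  assumes finite_points: "finite S" and rainbow: "F \<subseteq> rainbow (clique_complex rips_adj S) \<kappa> 3"
    and inequivalent: "\<sigma> \<in> F \<Longrightarrow> \<tau> \<in> F \<Longrightarrow> (\<sigma>, \<tau>) \<in> (vertex_exchange (clique_complex rips_adj S) \<kappa>)\<^sup>* \<Longrightarrow>
        \<sigma> = \<tau>"
    and colours: "\<sigma> \<in> F \<Longrightarrow> \<kappa> ` \<sigma> = W"
begin

definition corner :: "'c \<Rightarrow> (real ^ 2) set \<Rightarrow> real ^ 2" where
  "corner l \<tau> = inv_into \<tau> \<kappa> l"

lemma corner: "\<tau> \<in> F \<Longrightarrow> l \<in> W \<Longrightarrow> corner l \<tau> \<in> \<tau>" "\<tau> \<in> F \<Longrightarrow> l \<in> W \<Longrightarrow> \<kappa> (corner l \<tau>) = l"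
  using colours[of \<tau>] by (auto simp: corner_def intro: inv_into_into f_inv_into_f)

lemma corner_image: "\<tau> \<in> F \<Longrightarrow> (\<lambda>l. corner l \<tau>) ` W = \<tau>"
  unfolding corner_def using colours[of \<tau>] rainbow inv_into_image_cancel[of \<kappa> \<tau> \<tau>]
  by (auto simp: rainbow_def)

lemma triangle_clique: "\<tau> \<in> F \<Longrightarrow> \<tau> \<in> clique_complex rips_adj S"
  using rainbow by (auto simp: rainbow_def)

lemma edge_le_1: "\<tau> \<in> F \<Longrightarrow> l \<in> W \<Longrightarrow> m \<in> W \<Longrightarrow> dist (corner l \<tau>) (corner m \<tau>) \<le> 1"
  using triangle_clique[of \<tau>] corner(1)[of \<tau>] by (auto simp: clique_complex_def)

lemma corner_near:
  assumes "\<sigma> \<in> F" "\<tau> \<in> F" "l \<in> W" "m \<in> W" "corner l \<sigma> = corner l \<tau>"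
  shows "dist (corner m \<sigma>) (corner m \<tau>) \<le> 1/100"
  using edge_le_1[of \<sigma> l m] edge_le_1[of \<tau> l m] corner(2)[of _ m] assms
  by (intro same_colour_near[of _ _ "corner l \<sigma>"]) auto

lemma corners_far:
  assumes \<sigma>\<tau>: "\<sigma> \<in> F" "\<tau> \<in> F" "\<sigma> \<noteq> \<tau>" and W: "W = {l, m, n}" "distinct [l, m, n]"
    and eq: "corner l \<sigma> = corner l \<tau>"
  shows "1 < dist (corner m \<sigma>) (corner n \<tau>)"
proof (rule ccontr)
  assume near: "\<not> ?thesis"
  define x y z y' z' where "x = corner l \<sigma>" and "y = corner m \<sigma>" and "z = corner n \<sigma>"
    and "y' = corner m \<tau>" and "z' = corner n \<tau>"
  note corner_defs = x_def y_def z_def y'_def z'_def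
  have \<sigma>: "\<sigma> = insert z {x, y}" and \<tau>: "\<tau> = insert y' {x, z'}"
    using corner_image[OF \<sigma>\<tau>(1)] corner_image[OF \<sigma>\<tau>(2)] W(1) eq by (auto simp: corner_defs)
  have col: "\<kappa> x = l" "\<kappa> y = m" "\<kappa> z = n" "\<kappa> y' = m" "\<kappa> z' = n"
    using corner(2)[OF \<sigma>\<tau>(1)] corner(2)[OF \<sigma>\<tau>(2)] W(1) by (auto simp: corner_defs)
  let ?G = "clique_complex rips_adj S"
  have ends: "insert z {x, y} \<in> ?G" "insert y' {x, z'} \<in> ?G"
    using triangle_clique[OF \<sigma>\<tau>(1)] triangle_clique[OF \<sigma>\<tau>(2)] by (simp_all only: \<sigma> \<tau>)
  have "rips_adj y z'" using near by (simp add: corner_defs)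
  then have mid: "{x, y, z'} \<in> ?G"
    using ends by (auto simp: clique_complex_def dist_commute)
  have "(insert z {x, y}, insert z' {x, y}) \<in> vertex_exchange ?G \<kappa>"
    using ends(1) mid col W(2) by (intro clique_vertex_exchange) (auto simp: insert_commute)
  moreover have "(insert y {x, z'}, insert y' {x, z'}) \<in> vertex_exchange ?G \<kappa>"
    using ends(2) mid col W(2) by (intro clique_vertex_exchange) (auto simp: insert_commute)
  moreover have "insert z' {x, y} = insert y {x, z'}" by auto
  ultimately have "(\<sigma>, insert y {x, z'}) \<in> vertex_exchange ?G \<kappa>"
    "(insert y {x, z'}, \<tau>) \<in> vertex_exchange ?G \<kappa>"
    by (simp_all only: \<sigma> \<tau>)
  then have "(\<sigma>, \<tau>) \<in> (vertex_exchange ?G \<kappa>)\<^sup>*"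
    by (rule converse_rtrancl_into_rtrancl[OF _ r_into_rtrancl])
  then show False using inequivalent[OF \<sigma>\<tau>(1,2)] \<sigma>\<tau>(3) by simp
qed

lemma card_le_if_inj_on_corner:
  assumes "inj_on (corner l) G" "G \<subseteq> F" "l \<in> W"
  shows "card G \<le> card S"
proof (rule card_inj_on_le[OF assms(1) _ finite_points])
  show "corner l ` G \<subseteq> S"
    using assms(2,3) corner(1) triangle_clique by (fastforce simp: clique_complex_def)
qed

definition short :: "'c \<Rightarrow> 'c \<Rightarrow> (real ^ 2) set set" where
  "short m n = {\<tau> \<in> F. dist (corner m \<tau>) (corner n \<tau>) \<le> 99/100}"

definition not_longest :: "'c \<Rightarrow> 'c \<Rightarrow> 'c \<Rightarrow> (real ^ 2) set set" where
  "not_longest l m n = {\<tau> \<in> F - short l m - short l n - short m n.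
     \<not> (dist (corner l \<tau>) (corner m \<tau>) < dist (corner m \<tau>) (corner n \<tau>) \<and>
        dist (corner l \<tau>) (corner n \<tau>) < dist (corner m \<tau>) (corner n \<tau>))}"

lemma card_short_le:
  assumes W: "W = {l, m, n}" "distinct [l, m, n]"
  shows "card (short m n) \<le> card S"
proof (rule card_le_if_inj_on_corner)
  show "inj_on (corner l) (short m n)"
  proof (rule inj_onI, rule ccontr)
    fix \<sigma> \<tau> assume pair: "\<sigma> \<in> short m n" "\<tau> \<in> short m n" "corner l \<sigma> = corner l \<tau>" "\<sigma> \<noteq> \<tau>"
    then have F: "\<sigma> \<in> F" "\<tau> \<in> F" "dist (corner m \<sigma>) (corner n \<sigma>) \<le> 99/100" by (auto simp: short_def)
    have "dist (corner n \<sigma>) (corner n \<tau>) \<le> 1/100" using corner_near[OF F(1,2) _ _ pair(3)] W(1) by simp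
    then show False
      using corners_far[OF F(1,2) pair(4) W pair(3)] F(3)
        dist_triangle[of "corner m \<sigma>" "corner n \<tau>" "corner n \<sigma>"] by linarith
  qed
qed (use W in \<open>auto simp: short_def\<close>)

lemma card_not_longest_le:
  assumes W: "W = {l, m, n}" "distinct [l, m, n]"
  shows "card (not_longest l m n) \<le> card S"
proof (rule card_le_if_inj_on_corner)
  show "inj_on (corner l) (not_longest l m n)"
  proof (rule inj_onI, rule ccontr)
    fix \<sigma> \<tau> assume pair: "\<sigma> \<in> not_longest l m n" "\<tau> \<in> not_longest l m n" "corner l \<sigma> = corner l \<tau>"
      "\<sigma> \<noteq> \<tau>"
    then have F: "\<sigma> \<in> F" "\<tau> \<in> F" by (auto simp: not_longest_def)
    have long: "99/100 \<le> dist (corner l \<sigma>) (corner m \<sigma>)" "99/100 \<le> dist (corner l \<sigma>) (corner n \<sigma>)"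
      "99/100 \<le> dist (corner m \<sigma>) (corner n \<sigma>)"
      using pair(1) F(1) by (auto simp: not_longest_def short_def)
    have "1 < dist (corner m \<sigma>) (corner n \<tau>)" by (rule corners_far[OF F pair(4) W pair(3)])
    moreover have "1 < dist (corner m \<tau>) (corner n \<sigma>)"
      using corners_far[OF F(2,1) pair(4)[symmetric] W pair(3)[symmetric]] .
    moreover have "dist (corner m \<sigma>) (corner m \<tau>) \<le> 1/100" "dist (corner n \<sigma>) (corner n \<tau>) \<le> 1/100"
      using corner_near[OF F _ _ pair(3)] W(1) by auto
    ultimately have "(dist (corner l \<sigma>) (corner m \<sigma>) < dist (corner m \<sigma>) (corner n \<sigma>) \<and>
        dist (corner l \<sigma>) (corner n \<sigma>) < dist (corner m \<sigma>) (corner n \<sigma>)) \<or>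
      (dist (corner l \<sigma>) (corner m \<tau>) < dist (corner m \<tau>) (corner n \<tau>) \<and>
        dist (corner l \<sigma>) (corner n \<tau>) < dist (corner m \<tau>) (corner n \<tau>))"
      using long edge_le_1[OF F(1)] edge_le_1[OF F(2), of l, folded pair(3)] edge_le_1[OF F(2)] W(1)
      by (intro opposite_edge_longest) simp_all
    then show False using pair(1-3) by (auto simp: not_longest_def)
  qed
qed (use W in \<open>auto simp: not_longest_def\<close>)

lemma card_inequivalent_triangles_le: "card F \<le> 5 * card S"
proof (cases "F = {}")
  case False
  then obtain \<sigma> where "\<sigma> \<in> F" by blast
  then have "card W = 3" using colours[of \<sigma>] rainbow card_image[of \<kappa> \<sigma>] by (auto simp: rainbow_def)
  then obtain i j k where W: "W = {i, j, k}" "distinct [i, j, k]" unfolding card_3_iff by auto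
  have perm: "W = {j, i, k}" "distinct [j, i, k]" "W = {k, i, j}" "distinct [k, i, j]" using W
    by auto
  have "F = short j k \<union> (short i k \<union> (short i j \<union> (not_longest i j k \<union> not_longest j i k)))"
    by (auto simp: short_def not_longest_def dist_commute)
  then have "card F = card (short j k
      \<union> (short i k \<union> (short i j \<union> (not_longest i j k \<union> not_longest j i k))))"
    by (rule arg_cong)
  also have "\<dots> \<le> card (short j k) + (card (short i k) + (card (short i j) +
      (card (not_longest i j k) + card (not_longest j i k))))"
    by (intro order_trans[OF card_Un_le] add_left_mono order_refl)
  also have "\<dots> \<le> card S + (card S + (card S + (card S + card S)))"
    by (intro add_mono card_short_le[OF W] card_short_le[OF perm(1,2)] card_short_le[OF perm(3,4)]
        card_not_longest_le[OF W] card_not_longest_le[OF perm(1,2)])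
  finally show ?thesis by simp
qed simp

end

context planar_colouring
begin

lemma card_inequivalent_rainbow_triangles_le:
  assumes S: "finite S" and F: "F \<subseteq> rainbow (clique_complex rips_adj S) \<kappa> 3"
    "\<And>\<sigma> \<tau>. \<sigma> \<in> F \<Longrightarrow> \<tau> \<in> F \<Longrightarrow> (\<sigma>, \<tau>) \<in> (vertex_exchange (clique_complex rips_adj S) \<kappa>)\<^sup>* \<Longrightarrow> \<sigma> = \<tau>"
  shows "card F \<le> 2 ^ num_colours * (5 * card S)"
proof -
  have "\<kappa> ` \<sigma> \<in> Pow (range \<kappa>)" for \<sigma> by auto
  then have "F = (\<Union>W\<in>Pow (range \<kappa>). {\<sigma> \<in> F. \<kappa> ` \<sigma> = W})" by blast
  then have "card F = card (\<Union>W\<in>Pow (range \<kappa>). {\<sigma> \<in> F. \<kappa> ` \<sigma> = W})" by (rule arg_cong)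
  also have "\<dots> \<le> (\<Sum>W\<in>Pow (range \<kappa>). card {\<sigma> \<in> F. \<kappa> ` \<sigma> = W})"
    using finite_range by (intro card_UN_le) simp
  also have "\<dots> \<le> (\<Sum>W\<in>Pow (range \<kappa>). 5 * card S)"
  proof (rule sum_mono)
    fix W
    interpret inequivalent_triangles \<kappa> S "{\<sigma> \<in> F. \<kappa> ` \<sigma> = W}" W
      by unfold_locales (use S F in auto)
    show "card {\<sigma> \<in> F. \<kappa> ` \<sigma> = W} \<le> 5 * card S" by (rule card_inequivalent_triangles_le)
  qed
  also have "\<dots> = 2 ^ num_colours * (5 * card S)" using finite_range by (simp add: card_Pow)
  finally show ?thesis .
qed

lemma betti_3_plane_le:
  fixes S :: "(real ^ 2) set"
  assumes S: "finite S"
  shows "betti TYPE('k::field) 3 (clique_complex rips_adj S) \<le> 7 * 2 ^ num_colours * card S"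
proof -
  let ?G = "clique_complex rips_adj S"
  interpret finite_complex ?G by (rule finite_complex_clique_complex[OF S])
  obtain F where F: "F \<subseteq> rainbow ?G \<kappa> 3"
    "\<And>\<tau>. \<tau> \<in> rainbow ?G \<kappa> 3 \<Longrightarrow> \<exists>\<sigma>\<in>F. (\<tau>, \<sigma>) \<in> (vertex_exchange ?G \<kappa>)\<^sup>*"
    "\<And>\<sigma> \<tau>. \<sigma> \<in> F \<Longrightarrow> \<tau> \<in> F \<Longrightarrow> (\<sigma>, \<tau>) \<in> (vertex_exchange ?G \<kappa>)\<^sup>* \<Longrightarrow> \<sigma> = \<tau>"
    using representatives_exist[OF sym_vertex_exchange] by blast
  have "finite F" by (rule finite_subset[OF F(1)]) (use finite_faces in \<open>simp add: rainbow_def\<close>)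
  then have "betti TYPE('k) (Suc 2) ?G \<le> card F + betti TYPE('k) (Suc 2) (colour_skeleton ?G \<kappa> 2)"
    using F(2) by (intro betti_le_rainbow_plus_colour_skeleton) simp_all
  moreover have "card F \<le> 2 ^ num_colours * (5 * card S)"
    by (rule card_inequivalent_rainbow_triangles_le[OF S F(1,3)])
  moreover have "betti TYPE('k) 3 (colour_skeleton ?G \<kappa> 2) \<le> 2 ^ num_colours * (2 * card S)"
    by (intro betti_3_colour_skeleton_2_le S betti_3_two_colours_plane_le)
  ultimately show ?thesis by simp
qed

end

lemma max_betti_2_plane_le: "\<exists>D::nat. \<forall>n. max_betti TYPE('k::field) TYPE(2) 2 n \<le> D * n"
proof -
  obtain \<kappa> :: "real ^ 2 \<Rightarrow> 2 \<Rightarrow> int" where \<kappa>: "displacement_colouring \<kappa> (1/100)"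
    using displacement_colouring_exists[of "1/100"] by auto
  interpret planar_colouring \<kappa> by (rule planar_colouring.intro[OF \<kappa>])
  have "max_betti TYPE('k) TYPE(2) 2 n \<le> 7 * 2 ^ num_colours * n" for n
    unfolding max_betti_le_iff
  proof (intro allI impI)
    fix S :: "(real ^ 2) set" assume S: "finite S" "card S \<le> n"
    have "betti TYPE('k) 3 (clique_complex rips_adj S) \<le> 7 * 2 ^ num_colours * card S"
      by (rule betti_3_plane_le[OF S(1)])
    also have "\<dots> \<le> 7 * 2 ^ num_colours * n" using S(2) by simp
    finally show "betti TYPE('k) (Suc 2) (clique_complex rips_adj S) \<le> 7 * 2 ^ num_colours * n"
      by simp
  qed
  then show ?thesis by blast
qed

theorem theorem5p1:
  shows "(\<forall>p \<ge> 2. \<forall>\<delta> > (0::real). \<forall>\<^sub>F n in sequentially.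
            real (max_betti TYPE('k::field) TYPE('d::finite) p n) < \<delta> * real n ^ p) \<and>
         (\<forall>p \<ge> 2. \<exists>D::real. \<forall>n.
            real (max_betti TYPE('k) TYPE(2) p n) \<le> D * real n ^ (p - 1))"
proof (intro conjI allI impI)
  fix p :: nat and \<delta> :: real assume "2 \<le> p" "0 < \<delta>"
  then obtain r where p: "p = 2 + r" using le_Suc_ex by blast
  show "\<forall>\<^sub>F n in sequentially. real (max_betti TYPE('k) TYPE('d) p n) < \<delta> * real n ^ p"
    using eventually_max_betti_2_less[OF \<open>0 < \<delta>\<close>, where 'k = 'k and 'd = 'd]
      eventually_gt_at_top[of 0]
  proof eventually_elim
    case (elim n)
    have "real (max_betti TYPE('k) TYPE('d) p n) \<le> real (max_betti TYPE('k) TYPE('d) 2 n * n ^ r)"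
      unfolding p by (rule of_nat_mono[OF max_betti_add_le])
    also have "\<dots> < \<delta> * (real n)\<^sup>2 * real n ^ r" using elim by simp
    finally show ?case unfolding p by (simp only: power_add mult.assoc)
  qed
next
  fix p :: nat assume "2 \<le> p"
  then obtain r where p: "p = 2 + r" using le_Suc_ex by blast
  obtain D where D: "\<And>n. max_betti TYPE('k) TYPE(2) 2 n \<le> D * n"
    using max_betti_2_plane_le by blast
  have "max_betti TYPE('k) TYPE(2) p n \<le> D * n * n ^ r" for n
    unfolding p using max_betti_add_le D by (rule order_trans[OF _ mult_right_mono]) simp
  then have "real (max_betti TYPE('k) TYPE(2) p n) \<le> real (D * n * n ^ r)" for n
    by (rule of_nat_mono)
  then show "\<exists>D::real. \<forall>n. real (max_betti TYPE('k) TYPE(2) p n) \<le> D * real n ^ (p - 1)"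
    by (intro exI[of _ "real D"]) (simp add: p mult.assoc)
qed

end
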